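(* Let $E/\mathbb{Q}$ be an elliptic curve and $p\geq 3$ a prime. Then for every integer $n\geq 1$, $\mathbb{Q}(E[p^n])\neq \mathbb{Q}(E[p^{n+1}])$.
   Context: For an integer $N\geq 1$, $\mathbb{Q}(E[N])$ denotes the $N$-th division field of $E$, i.e. the field generated over $\mathbb{Q}$ by the coordinates of all points of $E(\overline{\mathbb{Q}})$ of order dividing $N$. *)

theory Defs
  imports "HOL-Algebra.Algebraic_Closure_Type" "HOL-Algebra.Generated_Fields"
    "HOL-Computational_Algebra.Primes"
begin

text \<open>
  Long Weierstrass equations
  \<open>y\<^sup>2 + a\<^sub>1 x y + a\<^sub>3 y = x\<^sup>3 + a\<^sub>2 x\<^sup>2 + a\<^sub>4 x + a\<^sub>6\<close>;
  \<open>map_weierstrass\<close> is base change along a field embedding.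
\<close>

datatype 'a weierstrass =
  Weierstrass (a\<^sub>1: 'a) (a\<^sub>2: 'a) (a\<^sub>3: 'a) (a\<^sub>4: 'a) (a\<^sub>6: 'a)

definition discriminant :: "'a::field weierstrass \<Rightarrow> 'a" where
  "discriminant E =
    (let b2 = (a\<^sub>1 E)\<^sup>2 + 4 * a\<^sub>2 E;
         b4 = 2 * a\<^sub>4 E + a\<^sub>1 E * a\<^sub>3 E;
         b6 = (a\<^sub>3 E)\<^sup>2 + 4 * a\<^sub>6 E;
         b8 = (a\<^sub>1 E)\<^sup>2 * a\<^sub>6 E + 4 * a\<^sub>2 E * a\<^sub>6 E - a\<^sub>1 E * a\<^sub>3 E * a\<^sub>4 E
              + a\<^sub>2 E * (a\<^sub>3 E)\<^sup>2 - (a\<^sub>4 E)\<^sup>2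
     in - b2\<^sup>2 * b8 - 8 * b4 ^ 3 - 27 * b6\<^sup>2 + 9 * b2 * b4 * b6)"

definition elliptic_curve :: "'a::field weierstrass \<Rightarrow> bool" where
  "elliptic_curve E \<longleftrightarrow> discriminant E \<noteq> 0"

datatype 'a point = Infinity | Affine 'a 'a

fun on_curve :: "'a::field weierstrass \<Rightarrow> 'a point \<Rightarrow> bool" where
  "on_curve E Infinity \<longleftrightarrow> True"
| "on_curve E (Affine x y) \<longleftrightarrow>
     y\<^sup>2 + a\<^sub>1 E * x * y + a\<^sub>3 E * y = x ^ 3 + a\<^sub>2 E * x\<^sup>2 + a\<^sub>4 E * x + a\<^sub>6 E"

text \<open>
  The chord-tangent law. The first test says that the two points are negatives of each other.
  If it fails and \<open>x1 = x2\<close>, then two points on the curve coincide and \<open>l\<close> is the slope of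
  the tangent, whose denominator is nonzero.
\<close>

fun point_add :: "'a::field weierstrass \<Rightarrow> 'a point \<Rightarrow> 'a point \<Rightarrow> 'a point" where
  "point_add E Infinity Q = Q"
| "point_add E P Infinity = P"
| "point_add E (Affine x1 y1) (Affine x2 y2) =
    (if x1 = x2 \<and> y1 + y2 + a\<^sub>1 E * x2 + a\<^sub>3 E = 0 then Infinity
     else
       let l = (if x1 = x2
                then (3 * x1\<^sup>2 + 2 * a\<^sub>2 E * x1 + a\<^sub>4 E - a\<^sub>1 E * y1)
                     / (2 * y1 + a\<^sub>1 E * x1 + a\<^sub>3 E)
                else (y2 - y1) / (x2 - x1));
           x3 = l\<^sup>2 + a\<^sub>1 E * l - a\<^sub>2 E - x1 - x2
       in Affine x3 (- (l * (x3 - x1) + y1) - a\<^sub>1 E * x3 - a\<^sub>3 E))"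

definition point_group :: "'a::field weierstrass \<Rightarrow> 'a point monoid" where
  "point_group E = \<lparr>carrier = {P. on_curve E P}, monoid.mult = point_add E, one = Infinity\<rparr>"

definition torsion_points :: "'a::field weierstrass \<Rightarrow> nat \<Rightarrow> 'a point set" where
  "torsion_points E N =
    {P \<in> carrier (point_group E). P [^]\<^bsub>point_group E\<^esub> N = \<one>\<^bsub>point_group E\<^esub>}"

text \<open>
  \<open>\<rat>(E[N])\<close> as a subfield of the algebraic closure of \<open>\<rat>\<close>; \<open>set_point P\<close> is the set of
  affine coordinates of \<open>P\<close> (empty for the point at infinity).
\<close>

definition division_field :: "rat weierstrass \<Rightarrow> nat \<Rightarrow> rat alg_closure set" where
  "division_field E N =
    generate_field ring_of_type_algebra
      (range to_ac \<union> (\<Union>P \<in> torsion_points (map_weierstrass to_ac E) N. set_point P))"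

end

theory Submission
  imports Defs "HOL-Number_Theory.Number_Theory"
begin

text \<open>
  Suppose the division fields at \<open>p\<^sup>n\<close> and \<open>p\<^sup>n\<^sup>+\<^sup>1\<close> agree. Then every automorphism fixing \<open>E[p\<^sup>n]\<close>
  fixes \<open>E[p\<^sup>n\<^sup>+\<^sup>1]\<close>, and descending along the levels, every automorphism fixing \<open>E[p]\<close> fixes
  \<open>E[p\<^sup>2]\<close>. Choose a primitive root \<open>g\<close> modulo \<open>p\<^sup>2\<close> and, since the cyclotomic polynomial of \<open>p\<^sup>2\<close> is
  irreducible, an automorphism \<open>\<sigma>\<close> raising the roots of unity of order \<open>p\<^sup>2\<close> to the power \<open>g\<close>.
  By the Weil pairing on \<open>E[p\<^sup>2]\<close> the order of \<open>\<sigma>\<close> on \<open>E[p\<^sup>2]\<close>, hence on \<open>E[p]\<close>, is divisible by \<open>p\<close>.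
  A linear map of a plane over the field with \<open>p\<close> elements whose order is divisible by \<open>p\<close> has a
  double eigenvalue, so its determinant is a square. But by the Weil pairing on \<open>E[p]\<close> this
  determinant is \<open>g\<close>, a nonresidue.

  Associativity of the group law, the number of torsion points and the Weil pairing are all
  derived from divisors of functions on the curve: a nonzero function has degree zero and none
  has a single simple pole.
\<close>

section \<open>Points on a monic cubic\<close>

no_notation Polynomials.var (\<open>X\<index>\<close>)

text \<open>Under the assumption the powers of \<sigma> that are trivial on E[p] are exactly those
  trivial on E[p^2]. So \<sigma>^m with m prime to p is nontrivial on E[p], and a further p-power of
  it has order exactly p there. The descent behind this rests on p dividing
  \<open>p choose 2\<close>, hence on p being odd. Level p^2 is where the pairing first sees a
  factor p in the order of g, which is p(p-1). A square modulo p has (p-1)/2-th power 1, and lifting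
  this to p^2 costs only a factor p, half of what the order of g requires.

  The geometric side is shaped by one choice: functions are maps on points, compared outside finite
  sets. Translation then acts by composition, and every local question moves to infinity, where
  orders are degrees of polynomials. The opposite parity of the pole orders two and three of x and y
  keeps leading terms from cancelling, and stands in for Riemann-Roch. The pairing is a commutator
  of operators, so its nondegeneracy comes from counting the zeros of a common eigenvector.\<close>

locale monic_cubic_curve =
  fixes c2 c1 c0 :: "'a::{alg_closed_field, field_char_0}"
  assumes nonsingular: "r ^ 3 + c2 * r\<^sup>2 + c1 * r + c0 = 0 \<Longrightarrow> 3 * r\<^sup>2 + 2 * c2 * r + c1 \<noteq> 0"
begin

definition cf :: "'a \<Rightarrow> 'a" where
  "cf x = x ^ 3 + c2 * x\<^sup>2 + c1 * x + c0"

definition cf' :: "'a \<Rightarrow> 'a" where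
  "cf' x = 3 * x\<^sup>2 + 2 * c2 * x + c1"

lemma cf'_nonzero: "cf r = 0 \<Longrightarrow> cf' r \<noteq> 0"
  using nonsingular[of r] by (simp add: cf_def cf'_def)

definition EC :: "'a point set" where
  "EC = insert Infinity {Affine x y | x y. y\<^sup>2 = cf x}"

lemma Infinity_in_EC [simp]: "Infinity \<in> EC"
  by (simp add: EC_def)

lemma Affine_in_EC [simp]: "Affine x y \<in> EC \<longleftrightarrow> y\<^sup>2 = cf x"
  by (simp add: EC_def)

fun pneg :: "'a point \<Rightarrow> 'a point" (\<open>-\<^sub>E _\<close> [81] 80) where
  "-\<^sub>E Infinity = Infinity"
| "-\<^sub>E (Affine x y) = Affine x (- y)"

fun padd :: "'a point \<Rightarrow> 'a point \<Rightarrow> 'a point" (infixl \<open>+\<^sub>E\<close> 65) where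
  "Infinity +\<^sub>E Q = Q"
| "P +\<^sub>E Infinity = P"
| "Affine x1 y1 +\<^sub>E Affine x2 y2 =
    (if x1 = x2 \<and> y1 + y2 = 0 then Infinity
     else let l = (if x1 = x2 then cf' x1 / (2 * y1) else (y2 - y1) / (x2 - x1));
              x3 = l\<^sup>2 - c2 - x1 - x2
          in Affine x3 (- (l * (x3 - x1) + y1)))"

lemma padd_Infinity_right [simp]: "P +\<^sub>E Infinity = P"
  by (cases P) auto

lemma pneg_pneg [simp]: "-\<^sub>E (-\<^sub>E P) = P"
  by (cases P) auto

lemma pneg_in_EC [simp]: "-\<^sub>E P \<in> EC \<longleftrightarrow> P \<in> EC"
  by (cases P) auto

lemma pneg_eq_iff [simp]: "-\<^sub>E P = -\<^sub>E Q \<longleftrightarrow> P = Q"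
  by (metis pneg_pneg)

lemma pneg_eq_Infinity_iff [simp]: "-\<^sub>E P = Infinity \<longleftrightarrow> P = Infinity"
  by (cases P) auto

lemma padd_pneg [simp]: "P +\<^sub>E (-\<^sub>E P) = Infinity"
  by (cases P) auto

declare padd.simps(3) [simp del]

text \<open>The line y = l x + m cuts the curve at the abscissae x1, x2, x3, with multiplicities. As
  a polynomial identity it treats chords and tangents alike and is symmetric in the three roots, so
  the symmetries of the group law become permutations.\<close>

definition meets :: "'a \<Rightarrow> 'a \<Rightarrow> 'a \<Rightarrow> 'a \<Rightarrow> 'a \<Rightarrow> bool" where
  "meets l m x1 x2 x3 \<longleftrightarrow> (\<forall>x. cf x - (l * x + m)\<^sup>2 = (x - x1) * (x - x2) * (x - x3))"

text \<open>A double root r makes the derivative of \<open>cf x - (l * x + m)\<^sup>2\<close> vanish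
  there. A central difference over r + 1 and r - 1 stands in for the derivative; its cubic
  correction 2 appears on both sides.\<close>

lemma meets_deriv:
  assumes "meets l m x1 r r"
  shows "cf' r = 2 * l * (l * r + m)"
proof -
  have *: "cf (r + t) - (l * (r + t) + m)\<^sup>2 = (r + t - x1) * t * t" for t
    using assms by (simp add: meets_def)
  have "cf (r + 1) - cf (r - 1) = 2 * cf' r + 2"
    by (simp add: cf_def cf'_def algebra_simps power2_eq_square power3_eq_cube)
  moreover have "(l * (r + 1) + m)\<^sup>2 - (l * (r - 1) + m)\<^sup>2 = 4 * l * (l * r + m)"
    by (simp add: algebra_simps power2_eq_square)
  moreover have "cf (r + 1) = (l * (r + 1) + m)\<^sup>2 + (r + 1 - x1)"
    using *[of 1] by (simp add: algebra_simps)
  moreover have "cf (r - 1) = (l * (r - 1) + m)\<^sup>2 + (r - 1 - x1)"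
    using *[of "-1"] by (simp add: algebra_simps)
  ultimately have "2 * cf' r + 2 = (4 * l * (l * r + m)) + 2"
    by (smt (verit, ccfv_threshold) add_diff_cancel add_diff_cancel_left diff_add_eq diff_diff_eq2 one_add_one)
  hence "2 * cf' r = 2 * (2 * l * (l * r + m))"
    by simp
  thus ?thesis by simp
qed

lemma meets_permute:
  assumes "meets l m x1 x2 x3"
  shows "meets l m x2 x1 x3" "meets l m x3 x2 x1" "meets l m x1 x3 x2"
  using assms by (simp_all add: meets_def mult.commute mult.left_commute)

lemma meets_neg: "meets l m x1 x2 x3 \<Longrightarrow> meets (- l) (- m) x1 x2 x3"
proof -
  have "(- l * x - m)\<^sup>2 = (l * x + m)\<^sup>2" for x
    by (simp add: power2_eq_square algebra_simps)
  thus "meets l m x1 x2 x3 \<Longrightarrow> meets (- l) (- m) x1 x2 x3"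
    by (simp add: meets_def)
qed

text \<open>Vieta for the coefficient of x^2. Adding the values at 1 and -1 isolates the even
  coefficients, and the value at 0 removes the constant one.\<close>

lemma meets_x3:
  assumes "meets l m x1 x2 x3"
  shows "x3 = l\<^sup>2 - c2 - x1 - x2"
proof -
  have *: "cf x - (l * x + m)\<^sup>2 = (x - x1) * (x - x2) * (x - x3)" for x
    using assms by (simp add: meets_def)
  have 0: "c0 - m\<^sup>2 = - (x1 * x2 * x3)"
    using *[of 0] by (simp add: cf_def)
  have 1: "1 + c2 + c1 + c0 - (l + m)\<^sup>2 = (1 - x1) * (1 - x2) * (1 - x3)"
    using *[of 1] by (simp add: cf_def)
  have 2: "1 - c2 + c1 - c0 + (l - m)\<^sup>2 = (1 + x1) * (1 + x2) * (1 + x3)"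
    using *[of "-1"] by (simp add: cf_def algebra_simps power2_eq_square)
  have "2 * x3 = 2 * (l\<^sup>2 - c2 - x1 - x2)"
  proof -
    have "(1 + c2 + c1 + c0 - (l + m)\<^sup>2) - (1 - c2 + c1 - c0 + (l - m)\<^sup>2) = 2 * (c2 - l\<^sup>2) + 2 * (c0 - m\<^sup>2)"
      by (simp add: algebra_simps power2_eq_square)
    moreover have "(1 - x1) * (1 - x2) * (1 - x3) - (1 + x1) * (1 + x2) * (1 + x3)
        = - 2 * (x1 + x2 + x3) - 2 * (x1 * x2 * x3)"
      by (simp add: algebra_simps)
    ultimately have "2 * (c2 - l\<^sup>2) + 2 * (- (x1 * x2 * x3)) = - 2 * (x1 + x2 + x3) - 2 * (x1 * x2 * x3)"
      unfolding 0 1 2 by (rule trans[OF sym])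
    hence "2 * (c2 - l\<^sup>2) = - 2 * (x1 + x2 + x3)" by simp
    thus ?thesis by (simp add: algebra_simps)
  qed
  thus ?thesis by (subst (asm) mult_left_cancel) simp_all
qed

text \<open>Chord and tangent slopes answer one requirement, that
  \<open>cf x - (l * x + m)\<^sup>2\<close> vanish at x1 and x2 with multiplicity. In both cases the
  defect of the factorisation is a combination of the curve equations and the equation for the
  slope.\<close>

lemma padd_line:
  assumes "Affine x1 y1 \<in> EC" "Affine x2 y2 \<in> EC" "Affine x2 y2 \<noteq> -\<^sub>E Affine x1 y1"
  obtains l m x3 where "Affine x1 y1 +\<^sub>E Affine x2 y2 = Affine x3 (- (l * x3 + m))"
    "y1 = l * x1 + m" "y2 = l * x2 + m" "meets l m x1 x2 x3"
proof -
  have y: "y1\<^sup>2 = cf x1" "y2\<^sup>2 = cf x2" and n: "\<not> (x1 = x2 \<and> y1 + y2 = 0)"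
    using assms by (auto simp: add_eq_0_iff)
  define l where "l = (if x1 = x2 then cf' x1 / (2 * y1) else (y2 - y1) / (x2 - x1))"
  define m where "m = y1 - l * x1"
  define x3 where "x3 = l\<^sup>2 - c2 - x1 - x2"
  have "y2 = l * x2 + m \<and> meets l m x1 x2 x3"
  proof (cases "x1 = x2")
    case True
    hence "(y1 - y2) * (y1 + y2) = 0" using y by (simp add: algebra_simps power2_eq_square)
    with n True have yy: "y1 = y2" by auto
    with n True have "y1 \<noteq> 0" by auto
    hence l: "2 * l * y1 = cf' x1" using True by (simp add: l_def)
    have "cf x - (l * x + m)\<^sup>2 - (x - x1) * (x - x2) * (x - x3)
        = (cf x1 - y1\<^sup>2) + (x - x1) * (cf' x1 - 2 * l * y1)" for x
      unfolding x3_def m_def cf_def cf'_def using True by (simp add: algebra_simps power2_eq_square power3_eq_cube)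
    hence "meets l m x1 x2 x3" using y l by (simp add: meets_def)
    thus ?thesis using yy True by (simp add: m_def)
  next
    case False
    hence l: "l * (x2 - x1) = y2 - y1" by (simp add: l_def)
    hence y2: "y2 = l * (x2 - x1) + y1" by simp
    have "(x1 - x2) * (cf x - (l * x + m)\<^sup>2 - (x - x1) * (x - x2) * (x - x3))
        = (x - x2) * (cf x1 - y1\<^sup>2) - (x - x1) * (cf x2 - y2\<^sup>2)" for x
      unfolding x3_def m_def cf_def y2 by (simp add: algebra_simps power2_eq_square power3_eq_cube)
    hence "meets l m x1 x2 x3" using y False by (simp add: meets_def)
    thus ?thesis using l by (simp add: m_def algebra_simps)
  qed
  moreover have "Affine x1 y1 +\<^sub>E Affine x2 y2 = Affine x3 (- (l * x3 + m))"
    using n by (auto simp: padd.simps(3) Let_def l_def x3_def m_def algebra_simps)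
  moreover have "y1 = l * x1 + m" by (simp add: m_def)
  ultimately show ?thesis by (elim conjE) (rule that)
qed

text \<open>Converse of \<open>padd_line\<close>: incidence determines the slope, in the tangent
  case through \<open>meets_deriv\<close>. Commutativity, negation and cancellation then only
  relabel the points of one line.\<close>

lemma padd_eqI:
  assumes "y1 = l * x1 + m" "y2 = l * x2 + m" "meets l m x1 x2 x3"
    "Affine x2 y2 \<noteq> -\<^sub>E Affine x1 y1"
  shows "Affine x1 y1 +\<^sub>E Affine x2 y2 = Affine x3 (- (l * x3 + m))"
proof -
  have n: "\<not> (x1 = x2 \<and> y1 + y2 = 0)"
    using assms by (auto simp: add_eq_0_iff)
  have l: "(if x1 = x2 then cf' x1 / (2 * y1) else (y2 - y1) / (x2 - x1)) = l"
  proof (cases "x1 = x2")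
    case True
    hence yy: "y1 = y2" using assms(1,2) by simp
    hence "y1 \<noteq> 0" using n True by auto
    moreover have "meets l m x3 x1 x1" using meets_permute(2)[OF assms(3)] True by simp
    from meets_deriv[OF this] have "cf' x1 = 2 * l * y1" using assms(1) by simp
    ultimately show ?thesis using True by simp
  next
    case False
    have "y2 - y1 = l * (x2 - x1)" using assms by (simp add: algebra_simps)
    thus ?thesis using False by simp
  qed
  have x3: "l\<^sup>2 - c2 - x1 - x2 = x3" using meets_x3[OF assms(3)] by simp
  have "l * x3 + m = l * (x3 - x1) + y1" using assms(1) by (simp add: algebra_simps)
  thus ?thesis using n by (simp only: padd.simps if_False Let_def l x3)
qed

lemma meets_on_curve: "meets l m x1 x2 x3 \<Longrightarrow> (l * x3 + m)\<^sup>2 = cf x3"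
  unfolding meets_def by (drule spec[of _ x3]) simp

lemma padd_in_EC [simp]:
  assumes "P \<in> EC" "Q \<in> EC"
  shows "P +\<^sub>E Q \<in> EC"
proof (cases "P = Infinity \<or> Q = Infinity \<or> Q = -\<^sub>E P")
  case False
  then obtain x1 y1 x2 y2 where "P = Affine x1 y1" "Q = Affine x2 y2"
    by (metis point.exhaust)
  moreover obtain l m x3 where "P +\<^sub>E Q = Affine x3 (- (l * x3 + m))" "meets l m x1 x2 x3"
    by (rule padd_line[of x1 y1 x2 y2]) (use assms False calculation in simp_all)
  ultimately show ?thesis
    using meets_on_curve[of l m x1 x2 x3] by (simp only: Affine_in_EC power2_minus)
qed (use assms in auto)

lemma padd_commute:
  assumes "P \<in> EC" "Q \<in> EC"
  shows "P +\<^sub>E Q = Q +\<^sub>E P"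
proof (cases "P = Infinity \<or> Q = Infinity \<or> Q = -\<^sub>E P")
  case True
  thus ?thesis using padd_pneg[of "-\<^sub>E P"] by auto
next
  case False
  then obtain x1 y1 x2 y2 where PQ: "P = Affine x1 y1" "Q = Affine x2 y2"
    by (metis point.exhaust)
  obtain l m x3 where *: "P +\<^sub>E Q = Affine x3 (- (l * x3 + m))"
    "y1 = l * x1 + m" "y2 = l * x2 + m" "meets l m x1 x2 x3"
    by (rule padd_line[of x1 y1 x2 y2]) (use assms False PQ in simp_all)
  have "Affine x1 y1 \<noteq> -\<^sub>E Affine x2 y2" using False PQ by (metis pneg_pneg)
  hence "Q +\<^sub>E P = Affine x3 (- (l * x3 + m))"
    unfolding PQ by (intro padd_eqI *(2,3) meets_permute(1)[OF *(4)])
  thus ?thesis using *(1) by simp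
qed

lemma pneg_padd:
  assumes "P \<in> EC" "Q \<in> EC"
  shows "-\<^sub>E (P +\<^sub>E Q) = (-\<^sub>E P) +\<^sub>E (-\<^sub>E Q)"
proof (cases "P = Infinity \<or> Q = Infinity \<or> Q = -\<^sub>E P")
  case True
  thus ?thesis using padd_pneg[of "-\<^sub>E P"] by auto
next
  case False
  then obtain x1 y1 x2 y2 where PQ: "P = Affine x1 y1" "Q = Affine x2 y2"
    by (metis point.exhaust)
  obtain l m x3 where *: "P +\<^sub>E Q = Affine x3 (- (l * x3 + m))"
    "y1 = l * x1 + m" "y2 = l * x2 + m" "meets l m x1 x2 x3"
    by (rule padd_line[of x1 y1 x2 y2]) (use assms False PQ in simp_all)
  have "Affine x2 (- y2) \<noteq> -\<^sub>E Affine x1 (- y1)" using False PQ by auto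
  hence "Affine x1 (- y1) +\<^sub>E Affine x2 (- y2) = Affine x3 (- (- l * x3 + - m))"
    using padd_eqI[of "- y1" "- l" x1 "- m" "- y2" x2 x3] meets_neg * by simp
  thus ?thesis using * PQ by simp
qed

lemma padd_cancel:
  assumes "P \<in> EC" "Q \<in> EC"
  shows "(P +\<^sub>E Q) +\<^sub>E (-\<^sub>E Q) = P"
proof (cases "P = Infinity \<or> Q = Infinity \<or> Q = -\<^sub>E P")
  case True
  thus ?thesis using padd_pneg[of "-\<^sub>E P"] by auto
next
  case False
  then obtain x1 y1 x2 y2 where PQ: "P = Affine x1 y1" "Q = Affine x2 y2"
    by (metis point.exhaust)
  obtain l m x3 where *: "P +\<^sub>E Q = Affine x3 (- (l * x3 + m))"
    "y1 = l * x1 + m" "y2 = l * x2 + m" "meets l m x1 x2 x3"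
    by (rule padd_line[of x1 y1 x2 y2]) (use assms False PQ in simp_all)
  \<comment> \<open>Otherwise the line would be tangent at x2 with y2 = 0, which makes
    \<open>cf\<close> and \<open>cf'\<close> vanish together at x2, against nonsingularity.\<close>
  have "Affine x2 (- y2) \<noteq> -\<^sub>E Affine x3 (- (l * x3 + m))"
  proof
    assume "Affine x2 (- y2) = -\<^sub>E Affine x3 (- (l * x3 + m))"
    hence x: "x3 = x2" and "- y2 = l * x3 + m" by auto
    hence "- y2 = y2" using *(3) by metis
    hence "y2 + y2 = 0" by (metis add.right_inverse)
    hence "2 * y2 = 0" by (simp only: mult_2)
    hence y2: "y2 = 0" by simp
    have "meets l m x1 x2 x2" using * x by simp
    hence "cf' x2 = 0" using meets_deriv[of l m x1 x2] y2 * by simp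
    moreover have "cf x2 = 0" using assms PQ y2 by auto
    ultimately show False using cf'_nonzero by blast
  qed
  hence "Affine x3 (- (l * x3 + m)) +\<^sub>E Affine x2 (- y2) = Affine x1 (- (- l * x1 + - m))"
    using padd_eqI[of "- (l * x3 + m)" "- l" x3 "- m" "- y2" x2 x1] meets_neg[OF meets_permute(2)] *
    by simp
  thus ?thesis using * PQ by simp
qed

lemma padd_cancel': "P \<in> EC \<Longrightarrow> Q \<in> EC \<Longrightarrow> (P +\<^sub>E (-\<^sub>E Q)) +\<^sub>E Q = P"
  using padd_cancel[of P "-\<^sub>E Q"] by simp

lemma bij_betw_padd: "X \<in> EC \<Longrightarrow> bij_betw (\<lambda>P. P +\<^sub>E X) EC EC"
  by (rule bij_betwI[where g = "\<lambda>P. P +\<^sub>E (-\<^sub>E X)"]) (auto simp: padd_cancel padd_cancel')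

lemma bij_betw_pneg: "bij_betw pneg EC EC"
  by (rule bij_betwI[where g = pneg]) auto

end

section \<open>Rational functions and their order at infinity\<close>

context monic_cubic_curve
begin

definition cp :: "'a poly" where
  "cp = [:c0, c1, c2, 1:]"

lemma poly_cp [simp]: "poly cp x = cf x"
  by (simp add: cp_def cf_def algebra_simps power2_eq_square power3_eq_cube)

lemma degree_cp [simp]: "degree cp = 3"
  by (simp add: cp_def)

lemma cp_nonzero [simp]: "cp \<noteq> 0"
  by (simp add: cp_def)

fun xc :: "'a point \<Rightarrow> 'a" where
  "xc Infinity = 0"
| "xc (Affine x y) = x"

fun yc :: "'a point \<Rightarrow> 'a" where
  "yc Infinity = 0"
| "yc (Affine x y) = y"

lemma EC_E:
  assumes "P \<in> EC" "P \<noteq> Infinity"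
  obtains x y where "P = Affine x y" "y\<^sup>2 = cf x"
  using assms by (cases P) auto

lemma exists_point_over: "\<exists>y. Affine x y \<in> EC"
proof -
  obtain y where "y ^ 2 = cf x" using nth_root_exists[of 2 "cf x"] by auto
  thus ?thesis by auto
qed

lemma finite_sqrt: "finite {y :: 'a. y\<^sup>2 = c}"
proof (cases "\<exists>s. s\<^sup>2 = c")
  case True
  then obtain s where "s\<^sup>2 = c" by blast
  hence "{y. y\<^sup>2 = c} \<subseteq> {s, - s}" by (auto simp: power2_eq_iff)
  thus ?thesis by (rule finite_subset) simp
qed auto

lemma infinite_EC: "infinite EC"
proof
  assume "finite EC"
  hence "finite (xc ` EC)" by simp
  moreover have "x \<in> xc ` EC" for x
    using exists_point_over[of x] by (auto intro: image_eqI[of _ xc "Affine x _"])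
  hence "xc ` EC = UNIV" by blast
  ultimately show False using infinite_UNIV_char_0 by metis
qed

text \<open>Eventually along this filter means at all but finitely many points of the curve.
  Functions are identified along it, so the arbitrary values at poles and at \<open>Infinity\<close>
  (division by zero, \<open>xc Infinity = 0\<close>) carry no information.\<close>

definition ecf :: "'a point filter" where
  "ecf = inf cofinite (principal EC)"

lemma eventually_ecf: "eventually \<Phi> ecf \<longleftrightarrow> finite {P \<in> EC. \<not> \<Phi> P}"
proof -
  have "{P. \<not> (P \<in> EC \<longrightarrow> \<Phi> P)} = {P \<in> EC. \<not> \<Phi> P}" by blast
  thus ?thesis by (simp add: ecf_def eventually_inf_principal eventually_cofinite)
qed

lemma not_eventually_ecf_False [simp]: "\<not> eventually (\<lambda>P. False) ecf"
  using infinite_EC by (simp add: eventually_ecf)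

lemma eventually_ecf_neq: "\<forall>\<^sub>F P in ecf. P \<in> EC \<and> P \<noteq> Q"
  unfolding eventually_ecf by (rule finite_subset[of _ "{Q}"]) auto

lemma eventually_ecf_xc_neq: "\<forall>\<^sub>F P in ecf. xc P \<noteq> r"
proof -
  have "{P \<in> EC. \<not> xc P \<noteq> r} \<subseteq> insert Infinity (Affine r ` {y. y\<^sup>2 = cf r})"
  proof
    fix P assume "P \<in> {P \<in> EC. \<not> xc P \<noteq> r}"
    thus "P \<in> insert Infinity (Affine r ` {y. y\<^sup>2 = cf r})" by (cases P) auto
  qed
  thus ?thesis unfolding eventually_ecf by (rule finite_subset) (simp add: finite_sqrt)
qed

lemma eventually_poly_xc_nonzero:
  assumes "d \<noteq> 0"
  shows "\<forall>\<^sub>F P in ecf. poly d (xc P) \<noteq> 0"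
proof -
  have "\<forall>\<^sub>F P in ecf. \<forall>r\<in>{r. poly d r = 0}. xc P \<noteq> r"
    using poly_roots_finite[OF assms] eventually_ecf_xc_neq
    by (intro eventually_ball_finite ballI)
  thus ?thesis by (rule eventually_mono) blast
qed

lemma filtermap_bij_ecf:
  assumes "bij_betw f EC EC"
  shows "eventually (\<lambda>P. \<Phi> (f P)) ecf \<longleftrightarrow> eventually \<Phi> ecf"
proof -
  have "bij_betw f {P \<in> EC. \<not> \<Phi> (f P)} {P \<in> EC. \<not> \<Phi> P}"
    using assms by (intro bij_betw_Collect) auto
  thus ?thesis
    unfolding eventually_ecf by (rule bij_betw_finite)
qed

section \<open>The functions a(x) + b(x) y and their norms\<close>

definition evp :: "'a poly \<Rightarrow> 'a poly \<Rightarrow> 'a point \<Rightarrow> 'a" where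
  "evp a b P = poly a (xc P) + poly b (xc P) * yc P"

text \<open>The norm down to the polynomials in x, namely (a + b y)(a - b y) with y^2 replaced by
  the cubic.\<close>

definition nrm :: "'a poly \<Rightarrow> 'a poly \<Rightarrow> 'a poly" where
  "nrm a b = a * a - b * b * cp"

lemma nrm_0_0 [simp]: "nrm 0 0 = 0"
  by (simp add: nrm_def)

text \<open>The two terms of the norm have degrees of opposite parity, 2 deg a and 2 deg b + 3, so
  their leading terms cannot cancel. The statements about orders at infinity go back to
  this.\<close>

lemma degree_nrm:
  assumes "a \<noteq> 0 \<or> b \<noteq> 0"
  shows "nrm a b \<noteq> 0"
    and "degree (nrm a b) = max (2 * degree a) (if b = 0 then 0 else 2 * degree b + 3)"
proof -
  have A: "degree (a * a) = 2 * degree a" if "a \<noteq> 0" using that by (simp add: degree_mult_eq)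
  have B: "degree (b * b * cp) = 2 * degree b + 3" if "b \<noteq> 0"
    using that by (simp add: degree_mult_eq)
  have "nrm a b \<noteq> 0 \<and> degree (nrm a b) = max (2 * degree a) (if b = 0 then 0 else 2 * degree b + 3)"
  proof (cases "a = 0 \<or> b = 0")
    case True
    thus ?thesis using assms A B by (auto simp: nrm_def)
  next
    case False
    have n: "nrm a b = a * a + - (b * b * cp)" by (simp add: nrm_def)
    have ne: "2 * degree a \<noteq> 2 * degree b + 3" by presburger
    show ?thesis
    proof (cases "2 * degree a < 2 * degree b + 3")
      case True
      hence "degree (nrm a b) = 2 * degree b + 3"
        unfolding n using False A B by (subst degree_add_eq_right) auto
      thus ?thesis using False True by auto
    next
      case F: False
      hence "degree (nrm a b) = 2 * degree a"
        unfolding n using False A B ne by (subst degree_add_eq_left) auto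
      thus ?thesis using False F ne by auto
    qed
  qed
  thus "nrm a b \<noteq> 0" "degree (nrm a b) = max (2 * degree a) (if b = 0 then 0 else 2 * degree b + 3)"
    by auto
qed

lemma nrm_mult: "nrm (a * a' + b * b' * cp) (a * b' + a' * b) = nrm a b * nrm a' b'"
  by (simp add: nrm_def algebra_simps)

lemma evp_mult:
  assumes "P \<in> EC" "P \<noteq> Infinity"
  shows "evp a b P * evp a' b' P = evp (a * a' + b * b' * cp) (a * b' + a' * b) P"
proof -
  from assms obtain x y where P: "P = Affine x y" "y\<^sup>2 = cf x" by (rule EC_E)
  have "evp (a * a' + b * b' * cp) (a * b' + a' * b) P - evp a b P * evp a' b' P
     = poly b x * poly b' x * (cf x - y\<^sup>2)"
    unfolding P(1) evp_def by (simp add: algebra_simps power2_eq_square)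
  thus ?thesis using P by simp
qed

lemma evp_nrm:
  assumes "P \<in> EC" "P \<noteq> Infinity"
  shows "evp a b P * evp a (- b) P = poly (nrm a b) (xc P)"
  unfolding evp_mult[OF assms] by (simp add: evp_def nrm_def)

lemma evp_add: "evp a b P + evp a' b' P = evp (a + a') (b + b') P"
  by (simp add: evp_def algebra_simps)

lemma evp_scale: "evp a b P * poly d (xc P) = evp (a * d) (b * d) P"
  by (simp add: evp_def algebra_simps)

lemma eventually_evp_nonzero:
  assumes "a \<noteq> 0 \<or> b \<noteq> 0"
  shows "\<forall>\<^sub>F P in ecf. evp a b P \<noteq> 0"
  using eventually_poly_xc_nonzero[OF degree_nrm(1)[OF assms]] eventually_ecf_neq[of Infinity]
proof eventually_elim
  case (elim P)
  thus ?case using evp_nrm[of P a b] by force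
qed

lemma evp_unique:
  assumes "\<forall>\<^sub>F P in ecf. evp a b P = evp a' b' P"
  shows "a = a' \<and> b = b'"
proof (rule ccontr)
  assume "\<not> (a = a' \<and> b = b')"
  hence "\<forall>\<^sub>F P in ecf. evp (a - a') (b - b') P \<noteq> 0" by (intro eventually_evp_nonzero) auto
  with assms have "\<forall>\<^sub>F P in ecf. False"
    by eventually_elim (auto simp: evp_def algebra_simps)
  thus False by simp
qed

text \<open>
  A rational function is any function on points that agrees with \<open>(a(x) + b(x) y) / d(x)\<close>
  outside a finite set. Its order \<open>ord\<close> at infinity is half the order of its norm
  \<open>nrm a b / d\<^sup>2\<close>, and \<open>x\<close> has a double pole there.
\<close>

definition rep :: "('a point \<Rightarrow> 'a) \<Rightarrow> 'a poly \<Rightarrow> 'a poly \<Rightarrow> 'a poly \<Rightarrow> bool" where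
  "rep \<phi> a b d \<longleftrightarrow> d \<noteq> 0 \<and> (\<forall>\<^sub>F P in ecf. \<phi> P * poly d (xc P) = evp a b P)"

definition RF :: "('a point \<Rightarrow> 'a) set" where
  "RF = {\<phi>. \<exists>a b d. rep \<phi> a b d}"

definition RFN :: "('a point \<Rightarrow> 'a) set" where
  "RFN = {\<phi>. \<exists>a b d. rep \<phi> a b d \<and> (a \<noteq> 0 \<or> b \<noteq> 0)}"

definition ord :: "('a point \<Rightarrow> 'a) \<Rightarrow> int" where
  "ord \<phi> = (THE k. \<exists>a b d. rep \<phi> a b d \<and> (a \<noteq> 0 \<or> b \<noteq> 0) \<and>
              k = 2 * int (degree d) - int (degree (nrm a b)))"

lemma RFN_E:
  assumes "\<phi> \<in> RFN"
  obtains a b d where "rep \<phi> a b d" "a \<noteq> 0 \<or> b \<noteq> 0"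
  using assms unfolding RFN_def by blast

lemma RFN_I: "rep \<phi> a b d \<Longrightarrow> a \<noteq> 0 \<or> b \<noteq> 0 \<Longrightarrow> \<phi> \<in> RFN"
  unfolding RFN_def by blast

lemma RF_E:
  assumes "\<phi> \<in> RF"
  obtains a b d where "rep \<phi> a b d"
  using assms unfolding RF_def by blast

lemma RF_I: "rep \<phi> a b d \<Longrightarrow> \<phi> \<in> RF"
  unfolding RF_def by blast

lemma RFN_imp_RF: "\<phi> \<in> RFN \<Longrightarrow> \<phi> \<in> RF"
  by (auto simp: RF_def RFN_def)

lemma rep_unique:
  assumes "rep \<phi> a b d" "rep \<phi> a' b' d'"
  shows "a * d' = a' * d \<and> b * d' = b' * d"
proof (rule evp_unique)
  from assms have "\<forall>\<^sub>F P in ecf. \<phi> P * poly d (xc P) = evp a b P"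
    "\<forall>\<^sub>F P in ecf. \<phi> P * poly d' (xc P) = evp a' b' P" by (auto simp: rep_def)
  thus "\<forall>\<^sub>F P in ecf. evp (a * d') (b * d') P = evp (a' * d) (b' * d) P"
  proof eventually_elim
    case (elim P)
    have "evp (a * d') (b * d') P = \<phi> P * poly d (xc P) * poly d' (xc P)"
      by (simp only: evp_scale[symmetric] elim)
    moreover have "evp (a' * d) (b' * d) P = \<phi> P * poly d' (xc P) * poly d (xc P)"
      by (simp only: evp_scale[symmetric] elim)
    ultimately show ?case by (simp add: mult_ac)
  qed
qed

lemma ord_rep:
  assumes "rep \<phi> a b d" "a \<noteq> 0 \<or> b \<noteq> 0"
  shows "ord \<phi> = 2 * int (degree d) - int (degree (nrm a b))"
  unfolding ord_def
proof (rule the_equality)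
  show "\<exists>a' b' d'. rep \<phi> a' b' d' \<and> (a' \<noteq> 0 \<or> b' \<noteq> 0) \<and>
      2 * int (degree d) - int (degree (nrm a b)) = 2 * int (degree d') - int (degree (nrm a' b'))"
    using assms by blast
next
  fix k assume "\<exists>a' b' d'. rep \<phi> a' b' d' \<and> (a' \<noteq> 0 \<or> b' \<noteq> 0) \<and>
      k = 2 * int (degree d') - int (degree (nrm a' b'))"
  then obtain a' b' d' where *: "rep \<phi> a' b' d'" "a' \<noteq> 0 \<or> b' \<noteq> 0"
    and k: "k = 2 * int (degree d') - int (degree (nrm a' b'))" by blast
  have d: "d \<noteq> 0" "d' \<noteq> 0" using assms * by (auto simp: rep_def)
  have "nrm a b * (d' * d') = nrm (a * d') (b * d')" by (simp add: nrm_def algebra_simps)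
  also have "\<dots> = nrm (a' * d) (b' * d)" using rep_unique[OF assms(1) *(1)] by simp
  also have "\<dots> = nrm a' b' * (d * d)" by (simp add: nrm_def algebra_simps)
  finally have "degree (nrm a b * (d' * d')) = degree (nrm a' b' * (d * d))" by simp
  hence "degree (nrm a b) + 2 * degree d' = degree (nrm a' b') + 2 * degree d"
    using d degree_nrm(1)[OF assms(2)] degree_nrm(1)[OF *(2)] by (simp add: degree_mult_eq)
  thus "k = 2 * int (degree d) - int (degree (nrm a b))" unfolding k by linarith
qed

lemma rep_cong:
  assumes "rep \<phi> a b d" "\<forall>\<^sub>F P in ecf. \<phi> P = \<psi> P"
  shows "rep \<psi> a b d"
proof -
  have "\<forall>\<^sub>F P in ecf. \<phi> P * poly d (xc P) = evp a b P" using assms by (simp add: rep_def)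
  with assms(2) have "\<forall>\<^sub>F P in ecf. \<psi> P * poly d (xc P) = evp a b P"
    by eventually_elim simp
  thus ?thesis using assms by (simp add: rep_def)
qed

lemma RFN_cong: "\<phi> \<in> RFN \<Longrightarrow> \<forall>\<^sub>F P in ecf. \<phi> P = \<psi> P \<Longrightarrow> \<psi> \<in> RFN"
  by (elim RFN_E, rule RFN_I, rule rep_cong)

lemma RF_cong: "\<phi> \<in> RF \<Longrightarrow> \<forall>\<^sub>F P in ecf. \<phi> P = \<psi> P \<Longrightarrow> \<psi> \<in> RF"
  by (elim RF_E, rule RF_I, rule rep_cong)

lemma ord_cong: "\<phi> \<in> RFN \<Longrightarrow> \<forall>\<^sub>F P in ecf. \<phi> P = \<psi> P \<Longrightarrow> ord \<phi> = ord \<psi>"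
proof -
  assume "\<phi> \<in> RFN" and e: "\<forall>\<^sub>F P in ecf. \<phi> P = \<psi> P"
  then obtain a b d where r: "rep \<phi> a b d" "a \<noteq> 0 \<or> b \<noteq> 0" by (elim RFN_E)
  show "ord \<phi> = ord \<psi>"
    by (simp only: ord_rep[OF r] ord_rep[OF rep_cong[OF r(1) e] r(2)])
qed

lemma RFN_nonzero:
  assumes "\<phi> \<in> RFN"
  shows "\<forall>\<^sub>F P in ecf. \<phi> P \<noteq> 0"
proof -
  from assms obtain a b d where r: "rep \<phi> a b d" "a \<noteq> 0 \<or> b \<noteq> 0" by (rule RFN_E)
  from r have "\<forall>\<^sub>F P in ecf. \<phi> P * poly d (xc P) = evp a b P" by (simp add: rep_def)
  with eventually_evp_nonzero[OF r(2)] show ?thesis by eventually_elim auto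
qed

lemma RF_cases:
  assumes "\<phi> \<in> RF"
  shows "\<phi> \<in> RFN \<or> (\<forall>\<^sub>F P in ecf. \<phi> P = 0)"
proof (rule disjCI)
  from assms obtain a b d where r: "rep \<phi> a b d" by (rule RF_E)
  assume nz: "\<not> (\<forall>\<^sub>F P in ecf. \<phi> P = 0)"
  have "a \<noteq> 0 \<or> b \<noteq> 0"
  proof (rule ccontr)
    assume "\<not> (a \<noteq> 0 \<or> b \<noteq> 0)"
    hence "\<forall>\<^sub>F P in ecf. \<phi> P * poly d (xc P) = 0" "d \<noteq> 0" using r by (auto simp: rep_def evp_def)
    from this(1) eventually_poly_xc_nonzero[OF this(2)] have "\<forall>\<^sub>F P in ecf. \<phi> P = 0"
      by eventually_elim auto
    with nz show False by simp
  qed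
  thus "\<phi> \<in> RFN" using r RFN_I by blast
qed

lemma not_RFN_zero: "\<forall>\<^sub>F P in ecf. \<phi> P = 0 \<Longrightarrow> \<phi> \<notin> RFN"
proof
  assume "\<forall>\<^sub>F P in ecf. \<phi> P = 0" "\<phi> \<in> RFN"
  from this(1) RFN_nonzero[OF this(2)] have "\<forall>\<^sub>F P in ecf. False" by eventually_elim auto
  thus False by simp
qed

lemma rep_const: "rep (\<lambda>_. c) [:c:] 0 1"
  by (simp add: rep_def evp_def)

lemma rep_xc: "rep xc [:0, 1:] 0 1"
  by (simp add: rep_def evp_def)

lemma rep_yc: "rep yc 0 1 1"
  by (simp add: rep_def evp_def)

lemma rep_mult:
  assumes "rep \<phi> a b d" "rep \<psi> a' b' d'"
  shows "rep (\<lambda>P. \<phi> P * \<psi> P) (a * a' + b * b' * cp) (a * b' + a' * b) (d * d')"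
proof -
  from assms have "\<forall>\<^sub>F P in ecf. \<phi> P * poly d (xc P) = evp a b P"
    "\<forall>\<^sub>F P in ecf. \<psi> P * poly d' (xc P) = evp a' b' P" by (auto simp: rep_def)
  with eventually_ecf_neq[of Infinity]
  have "\<forall>\<^sub>F P in ecf. \<phi> P * \<psi> P * poly (d * d') (xc P) = evp (a * a' + b * b' * cp) (a * b' + a' * b) P"
  proof eventually_elim
    case (elim P)
    have "\<phi> P * \<psi> P * poly (d * d') (xc P) = (\<phi> P * poly d (xc P)) * (\<psi> P * poly d' (xc P))"
      by simp
    thus ?case using elim evp_mult by metis
  qed
  thus ?thesis using assms by (simp add: rep_def)
qed

lemma rep_add:
  assumes "rep \<phi> a b d" "rep \<psi> a' b' d'"
  shows "rep (\<lambda>P. \<phi> P + \<psi> P) (a * d' + a' * d) (b * d' + b' * d) (d * d')"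
proof -
  from assms have "\<forall>\<^sub>F P in ecf. \<phi> P * poly d (xc P) = evp a b P"
    "\<forall>\<^sub>F P in ecf. \<psi> P * poly d' (xc P) = evp a' b' P" by (auto simp: rep_def)
  hence "\<forall>\<^sub>F P in ecf. (\<phi> P + \<psi> P) * poly (d * d') (xc P) = evp (a * d' + a' * d) (b * d' + b' * d) P"
    by eventually_elim (simp flip: evp_add evp_scale add: algebra_simps)
  thus ?thesis using assms by (simp add: rep_def)
qed

lemma rep_inverse:
  assumes "rep \<phi> a b d" "a \<noteq> 0 \<or> b \<noteq> 0"
  shows "rep (\<lambda>P. inverse (\<phi> P)) (a * d) (- b * d) (nrm a b)"
proof -
  from assms have "\<forall>\<^sub>F P in ecf. \<phi> P * poly d (xc P) = evp a b P" by (simp add: rep_def)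
  with eventually_ecf_neq[of Infinity] eventually_evp_nonzero[OF assms(2)]
  have "\<forall>\<^sub>F P in ecf. inverse (\<phi> P) * poly (nrm a b) (xc P) = evp (a * d) (- b * d) P"
  proof eventually_elim
    case (elim P)
    hence nz: "\<phi> P \<noteq> 0" by auto
    have "poly (nrm a b) (xc P) = \<phi> P * (poly d (xc P) * evp a (- b) P)"
      using evp_nrm[of P a b] elim by (metis mult.assoc)
    moreover have "evp (a * d) (- b * d) P = evp a (- b) P * poly d (xc P)"
      by (rule evp_scale[symmetric])
    ultimately show ?case using nz by (simp add: mult_ac)
  qed
  thus ?thesis using degree_nrm(1)[OF assms(2)] by (simp add: rep_def)
qed

section \<open>Field operations on rational functions and the order of the result\<close>

lemma RF_const [simp]: "(\<lambda>_. c) \<in> RF"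
  using rep_const by (rule RF_I)

lemma RF_xc [simp]: "xc \<in> RF" using rep_xc by (rule RF_I)

lemma RF_yc [simp]: "yc \<in> RF" using rep_yc by (rule RF_I)

lemma RF_mult: "\<phi> \<in> RF \<Longrightarrow> \<psi> \<in> RF \<Longrightarrow> (\<lambda>P. \<phi> P * \<psi> P) \<in> RF"
  by (elim RF_E, rule RF_I, rule rep_mult)

lemma RF_add: "\<phi> \<in> RF \<Longrightarrow> \<psi> \<in> RF \<Longrightarrow> (\<lambda>P. \<phi> P + \<psi> P) \<in> RF"
  by (elim RF_E, rule RF_I, rule rep_add)

lemma RF_uminus: "\<phi> \<in> RF \<Longrightarrow> (\<lambda>P. - \<phi> P) \<in> RF"
  using RF_mult[of "\<lambda>_. -1" \<phi>] by simp

lemma RF_diff: "\<phi> \<in> RF \<Longrightarrow> \<psi> \<in> RF \<Longrightarrow> (\<lambda>P. \<phi> P - \<psi> P) \<in> RF"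
  using RF_add[of \<phi> "\<lambda>P. - \<psi> P"] RF_uminus[of \<psi>] by simp

lemma RF_inverse: "\<phi> \<in> RF \<Longrightarrow> (\<lambda>P. inverse (\<phi> P)) \<in> RF"
proof -
  assume "\<phi> \<in> RF"
  from RF_cases[OF this] show ?thesis
  proof
    assume "\<phi> \<in> RFN"
    then obtain a b d where r: "rep \<phi> a b d" "a \<noteq> 0 \<or> b \<noteq> 0" by (rule RFN_E)
    show ?thesis by (rule RF_I[OF rep_inverse[OF r]])
  next
    assume "\<forall>\<^sub>F P in ecf. \<phi> P = 0"
    hence "\<forall>\<^sub>F P in ecf. 0 = inverse (\<phi> P)" by eventually_elim simp
    thus ?thesis by (rule RF_cong[OF RF_const[of 0]])
  qed
qed

lemma RF_divide: "\<phi> \<in> RF \<Longrightarrow> \<psi> \<in> RF \<Longrightarrow> (\<lambda>P. \<phi> P / \<psi> P) \<in> RF"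
  using RF_mult[OF _ RF_inverse, of \<phi> \<psi>] by (simp add: divide_inverse)

lemma RF_power: "\<phi> \<in> RF \<Longrightarrow> (\<lambda>P. \<phi> P ^ n) \<in> RF"
  by (induction n) (auto intro: RF_mult)

lemma RF_poly: "\<phi> \<in> RF \<Longrightarrow> (\<lambda>P. poly p (\<phi> P)) \<in> RF"
  by (induction p) (auto intro: RF_mult RF_add)

lemmas RF_intros = RF_const RF_xc RF_yc RF_mult RF_add RF_uminus RF_diff RF_inverse RF_divide RF_power RF_poly

lemma RFN_const: "c \<noteq> 0 \<Longrightarrow> (\<lambda>_. c) \<in> RFN" "c \<noteq> 0 \<Longrightarrow> ord (\<lambda>_. c) = 0"
  using RFN_I[OF rep_const[of c]] ord_rep[OF rep_const[of c]] by (auto simp: nrm_def)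

lemma RFN_xc: "xc \<in> RFN" "ord xc = - 2"
  using rep_xc RFN_I[OF rep_xc] ord_rep[OF rep_xc] by (auto simp: nrm_def)

lemma RFN_yc: "yc \<in> RFN" "ord yc = - 3"
  using rep_yc RFN_I[OF rep_yc] ord_rep[OF rep_yc] by (auto simp: nrm_def)

lemma RFN_mult:
  assumes "\<phi> \<in> RFN" "\<psi> \<in> RFN"
  shows "(\<lambda>P. \<phi> P * \<psi> P) \<in> RFN" "ord (\<lambda>P. \<phi> P * \<psi> P) = ord \<phi> + ord \<psi>"
proof -
  from assms(1) obtain a b d where r: "rep \<phi> a b d" "a \<noteq> 0 \<or> b \<noteq> 0" by (rule RFN_E)
  from assms(2) obtain a' b' d' where r': "rep \<psi> a' b' d'" "a' \<noteq> 0 \<or> b' \<noteq> 0" by (rule RFN_E)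
  let ?a = "a * a' + b * b' * cp" and ?b = "a * b' + a' * b"
  have n: "nrm a b \<noteq> 0" "nrm a' b' \<noteq> 0" using degree_nrm(1) r r' by blast+
  hence "nrm ?a ?b \<noteq> 0" unfolding nrm_mult by simp
  hence nz: "?a \<noteq> 0 \<or> ?b \<noteq> 0" using nrm_0_0 by metis
  show "(\<lambda>P. \<phi> P * \<psi> P) \<in> RFN" using RFN_I[OF rep_mult[OF r(1) r'(1)] nz] .
  have "d \<noteq> 0" "d' \<noteq> 0" using r r' by (auto simp: rep_def)
  thus "ord (\<lambda>P. \<phi> P * \<psi> P) = ord \<phi> + ord \<psi>"
    unfolding ord_rep[OF rep_mult[OF r(1) r'(1)] nz] ord_rep[OF r] ord_rep[OF r'] nrm_mult
    using n by (simp add: degree_mult_eq)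
qed

lemma RFN_inverse:
  assumes "\<phi> \<in> RFN"
  shows "(\<lambda>P. inverse (\<phi> P)) \<in> RFN" "ord (\<lambda>P. inverse (\<phi> P)) = - ord \<phi>"
proof -
  from assms obtain a b d where r: "rep \<phi> a b d" "a \<noteq> 0 \<or> b \<noteq> 0" by (rule RFN_E)
  have d: "d \<noteq> 0" using r by (simp add: rep_def)
  hence nz: "a * d \<noteq> 0 \<or> - b * d \<noteq> 0" using r by auto
  show *: "(\<lambda>P. inverse (\<phi> P)) \<in> RFN" using RFN_I[OF rep_inverse[OF r] nz] .
  have "\<forall>\<^sub>F P in ecf. \<phi> P * inverse (\<phi> P) = 1"
    using RFN_nonzero[OF assms] by eventually_elim simp
  from ord_cong[OF RFN_mult(1)[OF assms *] this] have "ord \<phi> + ord (\<lambda>P. inverse (\<phi> P)) = 0"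
    using RFN_mult(2)[OF assms *] RFN_const(2)[of 1] by simp
  thus "ord (\<lambda>P. inverse (\<phi> P)) = - ord \<phi>" by simp
qed

lemma RFN_divide:
  assumes "\<phi> \<in> RFN" "\<psi> \<in> RFN"
  shows "(\<lambda>P. \<phi> P / \<psi> P) \<in> RFN" "ord (\<lambda>P. \<phi> P / \<psi> P) = ord \<phi> - ord \<psi>"
  using RFN_mult[OF assms(1) RFN_inverse(1)[OF assms(2)]] RFN_inverse(2)[OF assms(2)]
  by (simp_all add: divide_inverse)

lemma RFN_cmult:
  assumes "\<phi> \<in> RFN" "c \<noteq> 0"
  shows "(\<lambda>P. c * \<phi> P) \<in> RFN" "ord (\<lambda>P. c * \<phi> P) = ord \<phi>"
  using RFN_mult[OF RFN_const(1)[OF assms(2)] assms(1)] RFN_const(2)[OF assms(2)] by simp_all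

text \<open>\<open>ord\<close> is meaningless for the zero function, which here satisfies every
  bound; sums and differences can then be estimated without asking whether they vanish.\<close>

definition ord_ge :: "('a point \<Rightarrow> 'a) \<Rightarrow> int \<Rightarrow> bool" where
  "ord_ge \<phi> k \<longleftrightarrow> \<phi> \<in> RF \<and> (\<phi> \<in> RFN \<longrightarrow> ord \<phi> \<ge> k)"

text \<open>The degree of the norm is a maximum, so a bound on the order splits into separate bounds
  on a and b. This reduces the ultrametric inequality to the degree bound for sums of
  polynomials.\<close>

lemma ord_ge_rep:
  assumes "rep \<phi> a b d"
  shows "ord_ge \<phi> k \<longleftrightarrow> (a \<noteq> 0 \<longrightarrow> 2 * int (degree a) + k \<le> 2 * int (degree d)) \<and>
           (b \<noteq> 0 \<longrightarrow> 2 * int (degree b) + 3 + k \<le> 2 * int (degree d))"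
proof (cases "a \<noteq> 0 \<or> b \<noteq> 0")
  case True
  hence "ord_ge \<phi> k \<longleftrightarrow> int (degree (nrm a b)) + k \<le> 2 * int (degree d)"
    using ord_rep[OF assms] RFN_I[OF assms] RF_I[OF assms] unfolding ord_ge_def by auto
  thus ?thesis using True by (cases "a = 0"; cases "b = 0") (auto simp: degree_nrm max_def)
next
  case False
  have "\<phi> \<notin> RFN"
  proof
    assume "\<phi> \<in> RFN"
    then obtain a' b' d' where r: "rep \<phi> a' b' d'" "a' \<noteq> 0 \<or> b' \<noteq> 0" by (rule RFN_E)
    have "d \<noteq> 0" using assms by (simp add: rep_def)
    thus False using rep_unique[OF assms r(1)] r(2) False by auto
  qed
  thus ?thesis using False RF_I[OF assms] by (auto simp: ord_ge_def)
qed

lemma ord_ge_add: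
  assumes "ord_ge \<phi> k" "ord_ge \<psi> k"
  shows "ord_ge (\<lambda>P. \<phi> P + \<psi> P) k"
proof -
  obtain a b d where r: "rep \<phi> a b d" using assms RF_E unfolding ord_ge_def by blast
  obtain a' b' d' where r': "rep \<psi> a' b' d'" using assms RF_E unfolding ord_ge_def by blast
  have d: "d \<noteq> 0" "d' \<noteq> 0" using r r' by (auto simp: rep_def)
  have bound: "2 * int (degree (u * d' + v * d)) + j \<le> 2 * int (degree (d * d'))"
    if nz: "u * d' + v * d \<noteq> 0" and u: "u \<noteq> 0 \<Longrightarrow> 2 * int (degree u) + j \<le> 2 * int (degree d)"
      and v: "v \<noteq> 0 \<Longrightarrow> 2 * int (degree v) + j \<le> 2 * int (degree d')" for u v j
  proof -
    have dd: "degree (d * d') = degree d + degree d'" using d by (simp add: degree_mult_eq)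
    consider "u = 0" "v \<noteq> 0" | "u \<noteq> 0" "v = 0" | "u \<noteq> 0" "v \<noteq> 0" using nz by fastforce
    thus ?thesis
    proof cases
      case 1 thus ?thesis using v d dd by (simp add: degree_mult_eq)
    next
      case 2 thus ?thesis using u d dd by (simp add: degree_mult_eq)
    next
      case 3
      have "degree (u * d' + v * d) \<le> max (degree (u * d')) (degree (v * d))"
        by (rule degree_add_le_max)
      moreover have "degree (u * d') = degree u + degree d'" "degree (v * d) = degree v + degree d"
        using 3 d by (simp_all add: degree_mult_eq)
      ultimately show ?thesis using u[OF 3(1)] v[OF 3(2)] dd by (simp add: max_def split: if_splits)
    qed
  qed
  have 1: "a \<noteq> 0 \<Longrightarrow> 2 * int (degree a) + k \<le> 2 * int (degree d)"
       "b \<noteq> 0 \<Longrightarrow> 2 * int (degree b) + (3 + k) \<le> 2 * int (degree d)"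
    using assms(1) unfolding ord_ge_rep[OF r] by auto
  have 2: "a' \<noteq> 0 \<Longrightarrow> 2 * int (degree a') + k \<le> 2 * int (degree d')"
       "b' \<noteq> 0 \<Longrightarrow> 2 * int (degree b') + (3 + k) \<le> 2 * int (degree d')"
    using assms(2) unfolding ord_ge_rep[OF r'] by auto
  have "2 * int (degree (a * d' + a' * d)) + k \<le> 2 * int (degree (d * d'))"
    if "a * d' + a' * d \<noteq> 0"
    by (rule bound[OF that 1(1) 2(1)])
  moreover have "2 * int (degree (b * d' + b' * d)) + (3 + k) \<le> 2 * int (degree (d * d'))"
    if "b * d' + b' * d \<noteq> 0"
    by (rule bound[OF that 1(2) 2(2)])
  ultimately show ?thesis
    unfolding ord_ge_rep[OF rep_add[OF r r']] add.assoc[symmetric] by blast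
qed

lemma ord_ge_cong: "ord_ge \<phi> k \<Longrightarrow> \<forall>\<^sub>F P in ecf. \<phi> P = \<psi> P \<Longrightarrow> ord_ge \<psi> k"
proof -
  assume *: "ord_ge \<phi> k" and e: "\<forall>\<^sub>F P in ecf. \<phi> P = \<psi> P"
  have e': "\<forall>\<^sub>F P in ecf. \<psi> P = \<phi> P" using e by (simp only: eq_commute)
  have "ord \<psi> \<ge> k" if "\<psi> \<in> RFN"
    using * RFN_cong[OF that e'] ord_cong[OF that e'] by (simp add: ord_ge_def)
  thus "ord_ge \<psi> k" using * RF_cong[OF _ e] by (simp add: ord_ge_def)
qed

lemma ord_ge_zero: "\<forall>\<^sub>F P in ecf. \<phi> P = 0 \<Longrightarrow> ord_ge \<phi> k"
proof -
  assume *: "\<forall>\<^sub>F P in ecf. \<phi> P = 0"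
  hence "\<forall>\<^sub>F P in ecf. 0 = \<phi> P" by (simp only: eq_commute)
  from RF_cong[OF RF_const this] not_RFN_zero[OF *] show "ord_ge \<phi> k"
    by (simp add: ord_ge_def)
qed

lemma ord_ge_mono: "ord_ge \<phi> k \<Longrightarrow> l \<le> k \<Longrightarrow> ord_ge \<phi> l"
  by (auto simp: ord_ge_def)

lemma ord_ge_self: "\<phi> \<in> RFN \<Longrightarrow> ord_ge \<phi> (ord \<phi>)"
  by (simp add: ord_ge_def RFN_imp_RF)

lemma ord_ge_mult:
  assumes "ord_ge \<phi> k" "ord_ge \<psi> l"
  shows "ord_ge (\<lambda>P. \<phi> P * \<psi> P) (k + l)"
proof (cases "\<phi> \<in> RFN \<and> \<psi> \<in> RFN")
  case True
  thus ?thesis using assms RFN_mult[of \<phi> \<psi>] RFN_imp_RF unfolding ord_ge_def by auto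
next
  case False
  hence "(\<forall>\<^sub>F P in ecf. \<phi> P = 0) \<or> (\<forall>\<^sub>F P in ecf. \<psi> P = 0)"
    using assms RF_cases unfolding ord_ge_def by blast
  hence "\<forall>\<^sub>F P in ecf. \<phi> P * \<psi> P = 0"
    by (auto elim: eventually_mono)
  thus ?thesis by (rule ord_ge_zero)
qed

lemma ord_ge_const [simp]: "ord_ge (\<lambda>_. c) 0"
  unfolding ord_ge_rep[OF rep_const] by simp

lemma ord_ge_cmult: "ord_ge \<phi> k \<Longrightarrow> ord_ge (\<lambda>P. c * \<phi> P) k"
  using ord_ge_mult[OF ord_ge_const[of c], of \<phi> k] by simp

lemma ord_ge_uminus: "ord_ge \<phi> k \<Longrightarrow> ord_ge (\<lambda>P. - \<phi> P) k"
  using ord_ge_cmult[of \<phi> k "-1"] by simp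

lemma ord_ge_diff: "ord_ge \<phi> k \<Longrightarrow> ord_ge \<psi> k \<Longrightarrow> ord_ge (\<lambda>P. \<phi> P - \<psi> P) k"
  using ord_ge_add[of \<phi> k "\<lambda>P. - \<psi> P"] ord_ge_uminus[of \<psi> k] by simp

lemma ord_add_dominant:
  assumes "\<phi> \<in> RFN" "ord_ge \<psi> (ord \<phi> + 1)"
  shows "(\<lambda>P. \<phi> P + \<psi> P) \<in> RFN" "ord (\<lambda>P. \<phi> P + \<psi> P) = ord \<phi>"
proof -
  have ge: "ord_ge (\<lambda>P. \<phi> P + \<psi> P) (ord \<phi>)"
    using ord_ge_add[OF ord_ge_self[OF assms(1)] ord_ge_mono[OF assms(2)]] by simp
  have no: "\<not> ord_ge (\<lambda>P. \<phi> P + \<psi> P) (ord \<phi> + 1)"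
  proof
    assume "ord_ge (\<lambda>P. \<phi> P + \<psi> P) (ord \<phi> + 1)"
    from ord_ge_diff[OF this assms(2)] have "ord_ge \<phi> (ord \<phi> + 1)" by simp
    thus False using assms(1) by (simp add: ord_ge_def)
  qed
  thus "(\<lambda>P. \<phi> P + \<psi> P) \<in> RFN" "ord (\<lambda>P. \<phi> P + \<psi> P) = ord \<phi>"
    using ge by (auto simp: ord_ge_def)
qed

section \<open>Values of functions at infinity\<close>

definition lim_inf :: "('a point \<Rightarrow> 'a) \<Rightarrow> 'a \<Rightarrow> bool" where
  "lim_inf \<phi> c \<longleftrightarrow> ord_ge (\<lambda>P. \<phi> P - c) 1"

lemma lim_inf_exists:
  assumes "ord_ge \<phi> 0"
  shows "\<exists>c. lim_inf \<phi> c"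
proof -
  obtain a b d where r: "rep \<phi> a b d" using assms RF_E unfolding ord_ge_def by blast
  have d: "d \<noteq> 0" using r by (simp add: rep_def)
  \<comment> \<open>The value at infinity: a and d are compared in degree \<open>degree d\<close>,
    so that c is 0 when a has smaller degree.\<close>
  define c where "c = coeff a (degree d) / lead_coeff d"
  have "rep (\<lambda>P. \<phi> P + - c) (a * 1 + [:- c:] * d) (b * 1 + 0 * d) (d * 1)"
    by (rule rep_add[OF r rep_const])
  hence r': "rep (\<lambda>P. \<phi> P - c) (a - smult c d) b d" by (simp add: algebra_simps)
  have dega: "degree a \<le> degree d" using assms unfolding ord_ge_rep[OF r] by (cases "a = 0") auto
  have "degree (a - smult c d) < degree d" if "a - smult c d \<noteq> 0"
  proof -
    have "degree (a - smult c d) \<le> degree d"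
      using dega degree_diff_le[of a "degree d" "smult c d"] degree_smult_le[of c d] by simp
    moreover have "coeff (a - smult c d) (degree d) = 0" using d by (simp add: c_def)
    moreover have "coeff (a - smult c d) (degree (a - smult c d)) \<noteq> 0"
      using that by (rule leading_coeff_neq_0)
    ultimately show ?thesis by (cases "degree (a - smult c d) = degree d") auto
  qed
  \<comment> \<open>The term in y has odd order, so order at least 0 improves to at least 1: it does
    not contribute to the value at infinity.\<close>
  moreover have "2 * int (degree b) + 4 \<le> 2 * int (degree d)" if "b \<noteq> 0"
  proof -
    have "2 * int (degree b) + 3 \<le> 2 * int (degree d)"
      using assms that unfolding ord_ge_rep[OF r] by auto
    thus ?thesis by presburger
  qed
  ultimately have "ord_ge (\<lambda>P. \<phi> P - c) 1"
    unfolding ord_ge_rep[OF r'] by force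
  thus ?thesis by (auto simp: lim_inf_def)
qed

lemma lim_inf_ord_ge: "lim_inf \<phi> c \<Longrightarrow> ord_ge \<phi> 0"
  unfolding lim_inf_def using ord_ge_add[OF ord_ge_mono[of _ 1 0] ord_ge_const[of c], of "\<lambda>P. \<phi> P - c"] by simp

lemma lim_inf_RF: "lim_inf \<phi> c \<Longrightarrow> \<phi> \<in> RF"
  using lim_inf_ord_ge by (auto simp: ord_ge_def)

lemma lim_inf_cong: "lim_inf \<phi> c \<Longrightarrow> \<forall>\<^sub>F P in ecf. \<phi> P = \<psi> P \<Longrightarrow> lim_inf \<psi> c"
  unfolding lim_inf_def by (erule ord_ge_cong) (auto elim: eventually_mono)

lemma lim_inf_const: "lim_inf (\<lambda>_. c) c"
  unfolding lim_inf_def by (simp add: ord_ge_zero)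

lemma lim_inf_0: "lim_inf \<phi> 0 \<longleftrightarrow> ord_ge \<phi> 1"
  by (simp add: lim_inf_def)

lemma lim_inf_add: "lim_inf \<phi> c \<Longrightarrow> lim_inf \<psi> e \<Longrightarrow> lim_inf (\<lambda>P. \<phi> P + \<psi> P) (c + e)"
  unfolding lim_inf_def using ord_ge_add[of "\<lambda>P. \<phi> P - c" 1 "\<lambda>P. \<psi> P - e"]
  by (simp add: algebra_simps)

lemma lim_inf_mult:
  assumes "lim_inf \<phi> c" "lim_inf \<psi> e"
  shows "lim_inf (\<lambda>P. \<phi> P * \<psi> P) (c * e)"
proof -
  have "ord_ge (\<lambda>P. (\<phi> P - c) * \<psi> P) (1 + 0)"
    using ord_ge_mult assms lim_inf_ord_ge unfolding lim_inf_def by blast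
  moreover have "ord_ge (\<lambda>P. c * (\<psi> P - e)) 1"
    using ord_ge_cmult assms unfolding lim_inf_def by blast
  ultimately have "ord_ge (\<lambda>P. (\<phi> P - c) * \<psi> P + c * (\<psi> P - e)) 1"
    using ord_ge_add by simp
  thus ?thesis by (simp add: lim_inf_def algebra_simps)
qed

lemma lim_inf_uminus: "lim_inf \<phi> c \<Longrightarrow> lim_inf (\<lambda>P. - \<phi> P) (- c)"
  using lim_inf_mult[OF lim_inf_const[of "-1"], of \<phi> c] by simp

lemma lim_inf_diff: "lim_inf \<phi> c \<Longrightarrow> lim_inf \<psi> e \<Longrightarrow> lim_inf (\<lambda>P. \<phi> P - \<psi> P) (c - e)"
  using lim_inf_add[OF _ lim_inf_uminus, of \<phi> c \<psi> e] by simp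

lemma lim_inf_RFN:
  assumes "lim_inf \<phi> c" "c \<noteq> 0"
  shows "\<phi> \<in> RFN" "ord \<phi> = 0"
proof -
  have "(\<lambda>P. c + (\<phi> P - c)) \<in> RFN \<and> ord (\<lambda>P. c + (\<phi> P - c)) = ord (\<lambda>_. c)"
    using ord_add_dominant[OF RFN_const(1)[OF assms(2)], of "\<lambda>P. \<phi> P - c"] assms
    by (simp add: RFN_const lim_inf_def)
  thus "\<phi> \<in> RFN" "ord \<phi> = 0" using RFN_const(2)[OF assms(2)] by auto
qed

lemma lim_inf_inverse:
  assumes "lim_inf \<phi> c" "c \<noteq> 0"
  shows "lim_inf (\<lambda>P. inverse (\<phi> P)) (inverse c)"
proof -
  note R = lim_inf_RFN[OF assms]
  have "ord_ge (\<lambda>P. (\<phi> P - c) * inverse (\<phi> P)) (1 + 0)"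
    using assms(1) ord_ge_self[OF RFN_inverse(1)[OF R(1)]] RFN_inverse(2)[OF R(1)] R(2)
    by (intro ord_ge_mult) (auto simp: lim_inf_def)
  hence "ord_ge (\<lambda>P. - inverse c * ((\<phi> P - c) * inverse (\<phi> P))) 1"
    by (intro ord_ge_cmult) simp
  moreover have "\<forall>\<^sub>F P in ecf. - inverse c * ((\<phi> P - c) * inverse (\<phi> P)) = inverse (\<phi> P) - inverse c"
    using RFN_nonzero[OF R(1)] by eventually_elim (use assms in \<open>simp add: field_simps\<close>)
  ultimately show ?thesis unfolding lim_inf_def by (rule ord_ge_cong)
qed

lemma lim_inf_divide:
  "lim_inf \<phi> c \<Longrightarrow> lim_inf \<psi> e \<Longrightarrow> e \<noteq> 0 \<Longrightarrow> lim_inf (\<lambda>P. \<phi> P / \<psi> P) (c / e)"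
  using lim_inf_mult[OF _ lim_inf_inverse, of \<phi> c \<psi> e] by (simp add: divide_inverse)

lemma lim_inf_power: "lim_inf \<phi> c \<Longrightarrow> lim_inf (\<lambda>P. \<phi> P ^ n) (c ^ n)"
  by (induction n) (auto intro: lim_inf_mult lim_inf_const[of 1, simplified])

lemma lim_inf_poly: "lim_inf \<phi> c \<Longrightarrow> lim_inf (\<lambda>P. poly p (\<phi> P)) (poly p c)"
  by (induction p) (auto intro: lim_inf_mult lim_inf_add lim_inf_const)

lemmas lim_inf_intros = lim_inf_const lim_inf_add lim_inf_mult lim_inf_uminus lim_inf_diff
  lim_inf_divide lim_inf_power lim_inf_poly

end

section \<open>Translations and divisors\<close>

context monic_cubic_curve
begin

lemma xc_pneg [simp]: "xc (-\<^sub>E P) = xc P" and yc_pneg [simp]: "yc (-\<^sub>E P) = - yc P"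
  by (cases P; simp)+

lemma evp_pneg: "evp a b (-\<^sub>E P) = evp a (- b) P"
  by (simp add: evp_def)

lemma nrm_uminus [simp]: "nrm a (- b) = nrm a b"
  by (simp add: nrm_def)

lemma eventually_pneg: "eventually (\<lambda>P. \<Phi> (-\<^sub>E P)) ecf \<longleftrightarrow> eventually \<Phi> ecf"
  by (rule filtermap_bij_ecf[OF bij_betw_pneg])

lemma eventually_padd: "X \<in> EC \<Longrightarrow> eventually (\<lambda>P. \<Phi> (P +\<^sub>E X)) ecf \<longleftrightarrow> eventually \<Phi> ecf"
  by (rule filtermap_bij_ecf[OF bij_betw_padd])

lemma rep_pneg: "rep \<phi> a b d \<Longrightarrow> rep (\<lambda>P. \<phi> (-\<^sub>E P)) a (- b) d"
  using eventually_pneg[of "\<lambda>P. \<phi> P * poly d (xc P) = evp a b P"]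
  by (simp add: rep_def evp_pneg)

lemma RFN_pneg:
  assumes "\<phi> \<in> RFN"
  shows "(\<lambda>P. \<phi> (-\<^sub>E P)) \<in> RFN" "ord (\<lambda>P. \<phi> (-\<^sub>E P)) = ord \<phi>"
proof -
  from assms obtain a b d where r: "rep \<phi> a b d" "a \<noteq> 0 \<or> b \<noteq> 0" by (rule RFN_E)
  hence nz: "a \<noteq> 0 \<or> - b \<noteq> 0" by simp
  show "(\<lambda>P. \<phi> (-\<^sub>E P)) \<in> RFN" by (rule RFN_I[OF rep_pneg[OF r(1)] nz])
  show "ord (\<lambda>P. \<phi> (-\<^sub>E P)) = ord \<phi>"
    unfolding ord_rep[OF r] ord_rep[OF rep_pneg[OF r(1)] nz] by simp
qed

lemma poly_eq_neg_self: "(b :: 'a poly) = - b \<Longrightarrow> b = 0"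
proof -
  assume "b = - b"
  hence "coeff b n = - coeff b n" for n by (metis coeff_minus)
  hence "2 * coeff b n = 0" for n by (metis mult_2 add.right_inverse)
  thus "b = 0" by (intro poly_eqI) simp
qed

text \<open>An even function has b = 0, so it is a rational function of x, and the double pole of x
  makes its order even. An odd function is y times such a function, whence
  \<open>odd_ord\<close>.\<close>

lemma even_ord:
  assumes "\<phi> \<in> RFN" "\<forall>\<^sub>F P in ecf. \<phi> (-\<^sub>E P) = \<phi> P"
  shows "even (ord \<phi>)"
proof -
  from assms obtain a b d where r: "rep \<phi> a b d" "a \<noteq> 0 \<or> b \<noteq> 0" by (elim RFN_E)
  have "rep \<phi> a (- b) d" by (rule rep_cong[OF rep_pneg[OF r(1)] assms(2)])
  from rep_unique[OF r(1) this] have "b * d = - b * d" by simp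
  hence "b * d = - (b * d)" by simp
  hence "b * d = 0" by (rule poly_eq_neg_self)
  hence "b = 0" using r(1) by (simp add: rep_def)
  thus ?thesis using ord_rep[OF r] r(2) by (simp add: degree_nrm)
qed

lemma odd_ord:
  assumes "\<phi> \<in> RFN" "\<forall>\<^sub>F P in ecf. \<phi> (-\<^sub>E P) = - \<phi> P"
  shows "odd (ord \<phi>)"
proof -
  from assms obtain a b d where r: "rep \<phi> a b d" "a \<noteq> 0 \<or> b \<noteq> 0" by (elim RFN_E)
  have "rep (\<lambda>P. - \<phi> P) a (- b) d" by (rule rep_cong[OF rep_pneg[OF r(1)] assms(2)])
  moreover have "rep (\<lambda>P. - \<phi> P) (- a) (- b) d"
    using r(1) unfolding rep_def by (auto simp: evp_def elim!: eventually_mono)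
  ultimately have "a * d = - a * d" using rep_unique by blast
  hence "a * d = - (a * d)" by simp
  hence "a * d = 0" by (rule poly_eq_neg_self)
  hence "a = 0" using r(1) by (simp add: rep_def)
  thus ?thesis using ord_rep[OF r] r(2) by (simp add: degree_nrm)
qed

text \<open>Clearing the powers of x - r and eliminating y^2 with the curve equation leaves
  numerators that are linear in y and of low degree in x. The first one starts as \<open>cf x +
  s\<^sup>2 - (c2 + x + 2 * r) * (x - r)\<^sup>2 - 2 * s * y\<close>, in which the terms in x^3 and
  x^2 cancel and \<open>cf' r\<close> remains as the coefficient of x.\<close>

lemma translate_coords:
  assumes "Affine r s \<in> EC" "Affine x y \<in> EC" "x \<noteq> r"
  obtains x3 y3 where "Affine x y +\<^sub>E Affine r s = Affine x3 y3"
    "(x3 - r) * (x - r)\<^sup>2 = cf' r * x + (c0 + s\<^sup>2 - (c2 + 2 * r) * r\<^sup>2) - 2 * s * y"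
    "(y3 - s) * (x - r) ^ 3 =
       s * (cf' r * x + (c0 + s\<^sup>2 - (c2 + 2 * r) * r\<^sup>2))
       + 2 * s * ((c2 + 3 * r) * x\<^sup>2 + (c1 - 3 * r\<^sup>2) * x + (c0 + r ^ 3))
       - (cf' r * x + (c0 + s\<^sup>2 - (c2 + 2 * r) * r\<^sup>2) + 2 * s\<^sup>2) * y"
proof -
  define l where "l = (s - y) / (r - x)"
  define x3 where "x3 = l\<^sup>2 - c2 - x - r"
  define y3 where "y3 = - (l * (x3 - x) + y)"
  define q where "q = c0 + s\<^sup>2 - (c2 + 2 * r) * r\<^sup>2"
  have sum: "Affine x y +\<^sub>E Affine r s = Affine x3 y3"
    using assms by (simp add: padd.simps(3) Let_def l_def x3_def y3_def)
  have l: "l * (x - r) = y - s"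
    using assms(3) by (simp add: l_def field_simps)
  have y: "y\<^sup>2 = cf x" "s\<^sup>2 = cf r" using assms by auto
  have "(x3 - r) * (x - r)\<^sup>2 = (l * (x - r))\<^sup>2 - (c2 + x + 2 * r) * (x - r)\<^sup>2"
    by (simp add: x3_def power2_eq_square algebra_simps)
  also have "\<dots> = (y - s)\<^sup>2 - (c2 + x + 2 * r) * (x - r)\<^sup>2" by (simp only: l)
  also have "\<dots> = cf x + s\<^sup>2 - 2 * s * y - (c2 + x + 2 * r) * (x - r)\<^sup>2"
    unfolding y(1)[symmetric] by (simp add: power2_eq_square algebra_simps)
  also have "\<dots> = cf' r * x + q - 2 * s * y"
    by (simp add: cf_def cf'_def q_def power2_eq_square power3_eq_cube algebra_simps)
  finally have e1: "(x3 - r) * (x - r)\<^sup>2 = cf' r * x + q - 2 * s * y" .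
  have "y3 = - (l * (x3 - r) + (y - l * (x - r)))" by (simp add: y3_def algebra_simps)
  hence y3: "y3 = - (l * (x3 - r) + s)" by (simp only: l) simp
  have "(y3 - s) * (x - r) ^ 3 = - (l * (x - r)) * ((x3 - r) * (x - r)\<^sup>2) - 2 * s * (x - r) ^ 3"
    unfolding y3 by (simp add: power2_eq_square power3_eq_cube algebra_simps)
  also have "\<dots> = - (y - s) * (cf' r * x + q - 2 * s * y) - 2 * s * (x - r) ^ 3"
    by (simp only: l e1)
  also have "\<dots> = 2 * s * (y\<^sup>2 - (x - r) ^ 3) + s * (cf' r * x + q) - (cf' r * x + q + 2 * s\<^sup>2) * y"
    by (simp add: power2_eq_square algebra_simps)
  also have "y\<^sup>2 - (x - r) ^ 3 = (c2 + 3 * r) * x\<^sup>2 + (c1 - 3 * r\<^sup>2) * x + (c0 + r ^ 3)"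
    unfolding y(1) by (simp add: cf_def power2_eq_square power3_eq_cube algebra_simps)
  finally have e2: "(y3 - s) * (x - r) ^ 3 = s * (cf' r * x + q)
       + 2 * s * ((c2 + 3 * r) * x\<^sup>2 + (c1 - 3 * r\<^sup>2) * x + (c0 + r ^ 3))
       - (cf' r * x + q + 2 * s\<^sup>2) * y" by (simp only: add_ac)
  show ?thesis using that[OF sum] e1 e2 unfolding q_def by blast
qed

lemma rep_translate_xc:
  assumes "Affine r s \<in> EC"
  shows "rep (\<lambda>P. xc (P +\<^sub>E Affine r s) - r) [:c0 + s\<^sup>2 - (c2 + 2 * r) * r\<^sup>2, cf' r:] [:- 2 * s:] ([:- r, 1:] ^ 2)"
proof -
  have "\<forall>\<^sub>F P in ecf. (xc (P +\<^sub>E Affine r s) - r) * poly ([:- r, 1:] ^ 2) (xc P)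
      = evp [:c0 + s\<^sup>2 - (c2 + 2 * r) * r\<^sup>2, cf' r:] [:- 2 * s:] P"
    using eventually_ecf_neq[of Infinity] eventually_ecf_xc_neq[of r]
  proof eventually_elim
    case (elim P)
    then obtain x y where P: "P = Affine x y" "Affine x y \<in> EC" "x \<noteq> r" by (cases P) auto
    from translate_coords[OF assms P(2,3)] obtain x3 y3
      where *: "Affine x y +\<^sub>E Affine r s = Affine x3 y3"
      "(x3 - r) * (x - r)\<^sup>2 = cf' r * x + (c0 + s\<^sup>2 - (c2 + 2 * r) * r\<^sup>2) - 2 * s * y"
      by metis
    have "(xc (P +\<^sub>E Affine r s) - r) * poly ([:- r, 1:] ^ 2) (xc P) = (x3 - r) * (x - r)\<^sup>2"
      unfolding P(1) *(1) by simp
    thus ?case unfolding *(2) P(1) evp_def by (simp add: mult.commute)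
  qed
  thus ?thesis by (simp add: rep_def)
qed

lemma rep_translate_yc:
  assumes "Affine r s \<in> EC"
  defines "q \<equiv> c0 + s\<^sup>2 - (c2 + 2 * r) * r\<^sup>2"
  shows "rep (\<lambda>P. yc (P +\<^sub>E Affine r s) - s)
    [:s * q + 2 * s * (c0 + r ^ 3), s * cf' r + 2 * s * (c1 - 3 * r\<^sup>2), 2 * s * (c2 + 3 * r):]
    [:- (q + 2 * s\<^sup>2), - cf' r:] ([:- r, 1:] ^ 3)"
proof -
  have "\<forall>\<^sub>F P in ecf. (yc (P +\<^sub>E Affine r s) - s) * poly ([:- r, 1:] ^ 3) (xc P)
      = evp [:s * q + 2 * s * (c0 + r ^ 3), s * cf' r + 2 * s * (c1 - 3 * r\<^sup>2), 2 * s * (c2 + 3 * r):]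
          [:- (q + 2 * s\<^sup>2), - cf' r:] P"
    using eventually_ecf_neq[of Infinity] eventually_ecf_xc_neq[of r]
  proof eventually_elim
    case (elim P)
    then obtain x y where P: "P = Affine x y" "Affine x y \<in> EC" "x \<noteq> r" by (cases P) auto
    from translate_coords[OF assms(1) P(2,3)] obtain x3 y3
      where *: "Affine x y +\<^sub>E Affine r s = Affine x3 y3"
      "(y3 - s) * (x - r) ^ 3 = s * (cf' r * x + q)
       + 2 * s * ((c2 + 3 * r) * x\<^sup>2 + (c1 - 3 * r\<^sup>2) * x + (c0 + r ^ 3))
       - (cf' r * x + q + 2 * s\<^sup>2) * y"
      unfolding q_def by metis
    have "(yc (P +\<^sub>E Affine r s) - s) * poly ([:- r, 1:] ^ 3) (xc P) = (y3 - s) * (x - r) ^ 3"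
      unfolding P(1) *(1) by simp
    also have "\<dots> = evp [:s * q + 2 * s * (c0 + r ^ 3), s * cf' r + 2 * s * (c1 - 3 * r\<^sup>2), 2 * s * (c2 + 3 * r):]
          [:- (q + 2 * s\<^sup>2), - cf' r:] P"
      unfolding *(2) P(1) evp_def by (simp add: power2_eq_square algebra_simps)
    finally show ?case .
  qed
  thus ?thesis by (simp add: rep_def)
qed

text \<open>The translate of a point near infinity is near (r, s), because the numerator for x - r
  has a smaller pole than (x - r)^2. With \<open>lim_translate_yc\<close> this turns values at (r,
  s) into values at infinity.\<close>

lemma lim_translate_xc:
  assumes "Affine r s \<in> EC"
  shows "lim_inf (\<lambda>P. xc (P +\<^sub>E Affine r s)) r"
proof -
  have "degree [:c0 + s\<^sup>2 - (c2 + 2 * r) * r\<^sup>2, cf' r:] \<le> 1" "degree [:- 2 * s:] = 0" by simp_all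
  thus ?thesis
    unfolding lim_inf_def ord_ge_rep[OF rep_translate_xc[OF assms]] degree_linear_power
    by (simp del: degree_pCons_eq_if)
qed

lemma lim_translate_yc:
  assumes "Affine r s \<in> EC"
  shows "lim_inf (\<lambda>P. yc (P +\<^sub>E Affine r s)) s"
proof -
  have 1: "degree [:u, v, w:] \<le> 2" for u v w :: 'a by simp
  have 2: "degree [:u, v:] \<le> 1" for u v :: 'a by simp
  have "2 * int (degree [:u, v, w:]) + 1 \<le> 2 * int 3" for u v w :: 'a
    using 1[of u v w] by linarith
  moreover have "2 * int (degree [:u, v:]) + 3 + 1 \<le> 2 * int 3" for u v :: 'a
    using 2[of u v] by linarith
  ultimately show ?thesis
    unfolding lim_inf_def ord_ge_rep[OF rep_translate_yc[OF assms]] degree_linear_power by blast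
qed

lemma RF_translate:
  assumes "\<phi> \<in> RF" "X \<in> EC"
  shows "(\<lambda>P. \<phi> (P +\<^sub>E X)) \<in> RF"
proof (cases X)
  case Infinity
  thus ?thesis using assms by simp
next
  case (Affine r s)
  obtain a b d where r: "rep \<phi> a b d" using assms(1) by (rule RF_E)
  hence "\<forall>\<^sub>F P in ecf. \<phi> P * poly d (xc P) = evp a b P" by (simp add: rep_def)
  hence 1: "\<forall>\<^sub>F P in ecf. \<phi> (P +\<^sub>E X) * poly d (xc (P +\<^sub>E X)) = evp a b (P +\<^sub>E X)"
    by (subst eventually_padd[OF assms(2), of "\<lambda>P. \<phi> P * poly d (xc P) = evp a b P"])
  have "\<forall>\<^sub>F P in ecf. poly d (xc P) \<noteq> 0" using r by (intro eventually_poly_xc_nonzero) (simp add: rep_def)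
  hence 2: "\<forall>\<^sub>F P in ecf. poly d (xc (P +\<^sub>E X)) \<noteq> 0"
    by (subst eventually_padd[OF assms(2), of "\<lambda>P. poly d (xc P) \<noteq> 0"])
  have x: "(\<lambda>P. xc (P +\<^sub>E X)) \<in> RF" and y: "(\<lambda>P. yc (P +\<^sub>E X)) \<in> RF"
    using lim_inf_RF[OF lim_translate_xc[of r s]] lim_inf_RF[OF lim_translate_yc[of r s]] assms(2) Affine
    by auto
  have "(\<lambda>P. evp a b (P +\<^sub>E X) / poly d (xc (P +\<^sub>E X))) \<in> RF"
    unfolding evp_def by (intro RF_intros x y)
  moreover from 1 2 have "\<forall>\<^sub>F P in ecf. evp a b (P +\<^sub>E X) / poly d (xc (P +\<^sub>E X)) = \<phi> (P +\<^sub>E X)"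
    by eventually_elim (simp add: divide_eq_eq)
  ultimately show ?thesis by (rule RF_cong)
qed

lemma RFN_iff: "\<phi> \<in> RFN \<longleftrightarrow> \<phi> \<in> RF \<and> \<not> (\<forall>\<^sub>F P in ecf. \<phi> P = 0)"
  using RF_cases not_RFN_zero RFN_imp_RF by blast

lemma RFN_translate:
  assumes "\<phi> \<in> RFN" "X \<in> EC"
  shows "(\<lambda>P. \<phi> (P +\<^sub>E X)) \<in> RFN"
  using assms RF_translate[OF RFN_imp_RF] unfolding RFN_iff[of "\<lambda>P. \<phi> (P +\<^sub>E X)"]
  by (simp add: eventually_padd[of X "\<lambda>P. \<phi> P = 0"] RFN_iff)

text \<open>
  The order at \<open>X\<close> is read off at infinity after a translation, so no local parameters at other
  points are needed.
\<close>

definition dv :: "('a point \<Rightarrow> 'a) \<Rightarrow> 'a point \<Rightarrow> int" where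
  "dv \<phi> X = ord (\<lambda>P. \<phi> (P +\<^sub>E X))"

lemma dv_Infinity [simp]: "dv \<phi> Infinity = ord \<phi>"
  by (simp add: dv_def)

lemma dv_cong:
  assumes "\<phi> \<in> RFN" "\<forall>\<^sub>F P in ecf. \<phi> P = \<psi> P" "X \<in> EC"
  shows "dv \<phi> X = dv \<psi> X"
  unfolding dv_def
  by (rule ord_cong[OF RFN_translate[OF assms(1,3)]])
     (subst eventually_padd[OF assms(3), of "\<lambda>P. \<phi> P = \<psi> P"], rule assms(2))

lemma dv_const: "c \<noteq> 0 \<Longrightarrow> dv (\<lambda>_. c) X = 0"
  by (simp add: dv_def RFN_const)

lemma dv_mult: "\<phi> \<in> RFN \<Longrightarrow> \<psi> \<in> RFN \<Longrightarrow> X \<in> EC \<Longrightarrow> dv (\<lambda>P. \<phi> P * \<psi> P) X = dv \<phi> X + dv \<psi> X"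
  unfolding dv_def by (intro RFN_mult RFN_translate)

lemma dv_cmult: "\<phi> \<in> RFN \<Longrightarrow> c \<noteq> 0 \<Longrightarrow> X \<in> EC \<Longrightarrow> dv (\<lambda>P. c * \<phi> P) X = dv \<phi> X"
  unfolding dv_def by (intro RFN_cmult RFN_translate)

lemma dv_inverse: "\<phi> \<in> RFN \<Longrightarrow> X \<in> EC \<Longrightarrow> dv (\<lambda>P. inverse (\<phi> P)) X = - dv \<phi> X"
  unfolding dv_def by (intro RFN_inverse RFN_translate)

lemma dv_divide: "\<phi> \<in> RFN \<Longrightarrow> \<psi> \<in> RFN \<Longrightarrow> X \<in> EC \<Longrightarrow> dv (\<lambda>P. \<phi> P / \<psi> P) X = dv \<phi> X - dv \<psi> X"
  unfolding dv_def by (intro RFN_divide RFN_translate)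

lemma dv_pneg:
  assumes "\<phi> \<in> RFN" "X \<in> EC"
  shows "dv (\<lambda>P. \<phi> (-\<^sub>E P)) X = dv \<phi> (-\<^sub>E X)"
proof -
  have R: "(\<lambda>P. \<phi> (P +\<^sub>E (-\<^sub>E X))) \<in> RFN" using assms by (intro RFN_translate) auto
  have e: "\<forall>\<^sub>F P in ecf. \<phi> ((-\<^sub>E P) +\<^sub>E (-\<^sub>E X)) = \<phi> (-\<^sub>E (P +\<^sub>E X))"
    using eventually_ecf_neq[of Infinity] by eventually_elim (simp add: pneg_padd assms)
  show ?thesis
    unfolding dv_def using ord_cong[OF RFN_pneg(1)[OF R] e] RFN_pneg(2)[OF R] by simp
qed

definition regular :: "('a point \<Rightarrow> 'a) \<Rightarrow> 'a point \<Rightarrow> bool" where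
  "regular \<phi> X \<longleftrightarrow> ord_ge (\<lambda>P. \<phi> (P +\<^sub>E X)) 0"

lemma regular_dv: "\<phi> \<in> RFN \<Longrightarrow> X \<in> EC \<Longrightarrow> regular \<phi> X \<longleftrightarrow> dv \<phi> X \<ge> 0"
  unfolding regular_def dv_def ord_ge_def using RFN_translate RFN_imp_RF by blast

lemma regular_const: "regular (\<lambda>_. c) X"
  by (simp add: regular_def)

lemma regular_diff: "regular \<phi> X \<Longrightarrow> regular \<psi> X \<Longrightarrow> regular (\<lambda>P. \<phi> P - \<psi> P) X"
  unfolding regular_def by (rule ord_ge_diff)

lemma lim_translate_evp:
  assumes "X \<in> EC" "X \<noteq> Infinity"
  shows "lim_inf (\<lambda>P. evp a b (P +\<^sub>E X)) (evp a b X)"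
proof -
  from assms obtain r s where X: "X = Affine r s" by (cases X) auto
  show ?thesis unfolding evp_def X
    using lim_translate_xc[of r s] lim_translate_yc[of r s] assms X
    by (auto intro!: lim_inf_intros)
qed

lemma rep_evp: "rep (evp a b) a b 1"
  by (simp add: rep_def)

lemma RFN_evp: "a \<noteq> 0 \<or> b \<noteq> 0 \<Longrightarrow> evp a b \<in> RFN"
  by (rule RFN_I[OF rep_evp])

lemma dv_evp_nonneg:
  assumes "a \<noteq> 0 \<or> b \<noteq> 0" "X \<in> EC" "X \<noteq> Infinity"
  shows "dv (evp a b) X \<ge> 0"
  using lim_inf_ord_ge[OF lim_translate_evp[OF assms(2,3), of a b]]
    RFN_translate[OF RFN_evp[OF assms(1)] assms(2)] by (simp add: dv_def ord_ge_def)

lemma dv_evp_eq_0: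
  assumes "X \<in> EC" "X \<noteq> Infinity" "evp a b X \<noteq> 0"
  shows "dv (evp a b) X = 0"
  unfolding dv_def by (rule lim_inf_RFN[OF lim_translate_evp[OF assms(1,2)] assms(3)])

lemma evp_linear: "evp [:- r, 1:] 0 = (\<lambda>P. xc P - r)"
  by (auto simp: evp_def)

lemma RFN_xc_minus: "(\<lambda>P. xc P - r) \<in> RFN" "ord (\<lambda>P. xc P - r) = - 2"
proof -
  have "rep (\<lambda>P. xc P - r) [:- r, 1:] 0 1"
    using rep_evp[of "[:- r, 1:]" 0] by (simp add: evp_linear)
  from RFN_I[OF this] ord_rep[OF this] show "(\<lambda>P. xc P - r) \<in> RFN" "ord (\<lambda>P. xc P - r) = - 2"
    by (simp_all add: degree_nrm)
qed

text \<open>After translation the denominator has degree two in x. For s = 0 the numerator is linear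
  in x with leading coefficient \<open>cf' r\<close>, nonzero by nonsingularity, which gives 4 - 2 =
  2; otherwise its term in y dominates and gives 4 - 3 = 1.\<close>

lemma dv_xc_minus:
  assumes "Affine r' s \<in> EC"
  shows "dv (\<lambda>P. xc P - r) (Affine r' s) = (if r' = r then if s = 0 then 2 else 1 else 0)"
proof (cases "r' = r")
  case False
  thus ?thesis using dv_evp_eq_0[OF assms, of "[:- r, 1:]" 0]
    by (simp add: evp_linear)
next
  case True
  have r: "rep (\<lambda>P. xc (P +\<^sub>E Affine r s) - r) [:c0 + s\<^sup>2 - (c2 + 2 * r) * r\<^sup>2, cf' r:] [:- 2 * s:] ([:- r, 1:] ^ 2)"
    using rep_translate_xc assms True by blast
  show ?thesis
  proof (cases "s = 0")
    case s: True
    hence "cf' r \<noteq> 0" using assms True cf'_nonzero by auto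
    hence "ord (\<lambda>P. xc (P +\<^sub>E Affine r s) - r) = 2"
      using ord_rep[OF r] s unfolding degree_linear_power by (simp add: degree_nrm)
    thus ?thesis using s True by (simp add: dv_def)
  next
    case s: False
    have "degree [:c0 + s\<^sup>2 - (c2 + 2 * r) * r\<^sup>2, cf' r:] \<le> 1" "degree [:- 2 * s:] = 0" by simp_all
    hence "degree (nrm [:c0 + s\<^sup>2 - (c2 + 2 * r) * r\<^sup>2, cf' r:] [:- 2 * s:]) = 3"
      using s by (subst degree_nrm(2)) (simp_all add: max_def del: degree_pCons_eq_if)
    hence "ord (\<lambda>P. xc (P +\<^sub>E Affine r s) - r) = 1"
      using ord_rep[OF r] s unfolding degree_linear_power by simp
    thus ?thesis using s True by (simp add: dv_def)
  qed
qed

section \<open>Principal divisors have degree zero\<close>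

definition deg0 :: "('a point \<Rightarrow> 'a) \<Rightarrow> bool" where
  "deg0 \<phi> \<longleftrightarrow> (\<exists>S. finite S \<and> S \<subseteq> EC \<and> (\<forall>X\<in>EC - S. dv \<phi> X = 0) \<and> (\<Sum>X\<in>S. dv \<phi> X) = 0)"

lemma deg0_superset:
  assumes "finite S" "S \<subseteq> EC" "\<forall>X\<in>EC - S. dv \<phi> X = 0" "(\<Sum>X\<in>S. dv \<phi> X) = 0"
    "finite T" "S \<subseteq> T" "T \<subseteq> EC"
  shows "(\<Sum>X\<in>T. dv \<phi> X) = 0"
proof -
  have "(\<Sum>X\<in>S. dv \<phi> X) = (\<Sum>X\<in>T. dv \<phi> X)"
    using assms by (intro sum.mono_neutral_left) auto
  thus ?thesis using assms by simp
qed

lemma deg0_cong: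
  assumes "deg0 \<phi>" "\<phi> \<in> RFN" "\<forall>\<^sub>F P in ecf. \<phi> P = \<psi> P"
  shows "deg0 \<psi>"
proof -
  from assms obtain S where S: "finite S" "S \<subseteq> EC" "\<forall>X\<in>EC - S. dv \<phi> X = 0" "(\<Sum>X\<in>S. dv \<phi> X) = 0"
    by (auto simp: deg0_def)
  have "dv \<psi> X = dv \<phi> X" if "X \<in> EC" for X using dv_cong[OF assms(2,3) that] by simp
  moreover from this have "(\<Sum>X\<in>S. dv \<psi> X) = (\<Sum>X\<in>S. dv \<phi> X)" using S(2) by (intro sum.cong) auto
  ultimately show ?thesis unfolding deg0_def using S by (intro exI[of _ S]) auto
qed

lemma deg0_mult:
  assumes "deg0 \<phi>" "deg0 \<psi>" "\<phi> \<in> RFN" "\<psi> \<in> RFN"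
  shows "deg0 (\<lambda>P. \<phi> P * \<psi> P)"
proof -
  from assms(1) obtain S where S: "finite S" "S \<subseteq> EC" "\<forall>X\<in>EC - S. dv \<phi> X = 0" "(\<Sum>X\<in>S. dv \<phi> X) = 0"
    by (auto simp: deg0_def)
  from assms(2) obtain T where T: "finite T" "T \<subseteq> EC" "\<forall>X\<in>EC - T. dv \<psi> X = 0" "(\<Sum>X\<in>T. dv \<psi> X) = 0"
    by (auto simp: deg0_def)
  have "(\<Sum>X\<in>S \<union> T. dv (\<lambda>P. \<phi> P * \<psi> P) X) = (\<Sum>X\<in>S \<union> T. dv \<phi> X + dv \<psi> X)"
    using S(2) T(2) assms by (intro sum.cong dv_mult) auto
  also have "\<dots> = 0"
    using deg0_superset[OF S, of "S \<union> T"] deg0_superset[OF T, of "S \<union> T"] S T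
    by (simp add: sum.distrib)
  finally show ?thesis
    unfolding deg0_def using S T assms by (intro exI[of _ "S \<union> T"]) (auto simp: dv_mult)
qed

lemma deg0_inverse:
  assumes "deg0 \<phi>" "\<phi> \<in> RFN"
  shows "deg0 (\<lambda>P. inverse (\<phi> P))"
proof -
  from assms obtain S where S: "finite S" "S \<subseteq> EC" "\<forall>X\<in>EC - S. dv \<phi> X = 0" "(\<Sum>X\<in>S. dv \<phi> X) = 0"
    by (auto simp: deg0_def)
  have "(\<Sum>X\<in>S. dv (\<lambda>P. inverse (\<phi> P)) X) = (\<Sum>X\<in>S. - dv \<phi> X)"
    using S(2) assms by (intro sum.cong dv_inverse) auto
  thus ?thesis
    unfolding deg0_def using S assms by (intro exI[of _ S]) (auto simp: dv_inverse sum_negf)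
qed

lemma deg0_const: "c \<noteq> 0 \<Longrightarrow> deg0 (\<lambda>_. c)"
  unfolding deg0_def by (intro exI[of _ "{}"]) (auto simp: dv_const)

lemma deg0_xc_minus: "deg0 (\<lambda>P. xc P - r)"
proof -
  obtain s where s: "s\<^sup>2 = cf r" using exists_point_over[of r] by auto
  define S where "S = {Infinity, Affine r s, Affine r (- s)}"
  have "dv (\<lambda>P. xc P - r) X = 0" if "X \<in> EC - S" for X
  proof -
    from that obtain x y where X: "X = Affine x y" "Affine x y \<in> EC" unfolding S_def by (cases X) auto
    have "x \<noteq> r"
    proof
      assume "x = r"
      hence "y\<^sup>2 = s\<^sup>2" using X s by simp
      hence "y = s \<or> y = - s" by (simp add: power2_eq_iff)
      thus False using that X \<open>x = r\<close> by (auto simp: S_def)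
    qed
    thus ?thesis using dv_xc_minus[OF X(2)] X(1) by simp
  qed
  moreover have "(\<Sum>X\<in>S. dv (\<lambda>P. xc P - r) X) = 0"
  proof (cases "s = 0")
    case True
    thus ?thesis using dv_xc_minus[of r s r] s by (simp add: S_def RFN_xc_minus)
  next
    case False
    hence "s + s \<noteq> 0" by (simp flip: mult_2)
    hence "s \<noteq> - s" by (simp add: eq_neg_iff_add_eq_0)
    thus ?thesis using dv_xc_minus[of r s r] dv_xc_minus[of r "- s" r] s False
      by (simp add: S_def RFN_xc_minus)
  qed
  ultimately show ?thesis unfolding deg0_def
    by (intro exI[of _ S]) (use s in \<open>auto simp: S_def\<close>)
qed

lemma RFN_poly_xc: "p \<noteq> 0 \<Longrightarrow> (\<lambda>P. poly p (xc P)) \<in> RFN"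
  using RFN_evp[of p 0] by (simp add: evp_def[abs_def])

lemma deg0_poly_xc: "p \<noteq> 0 \<Longrightarrow> deg0 (\<lambda>P. poly p (xc P))"
proof (induction "degree p" arbitrary: p)
  case 0
  then obtain c where "p = [:c:]" "c \<noteq> 0" by (metis degree_eq_zeroE pCons_0_0)
  thus ?case by (simp add: deg0_const)
next
  case (Suc n)
  hence "degree p > 0" by simp
  then obtain r where "poly p r = 0" using alg_closed_imp_poly_has_root by blast
  then obtain q where p: "p = [:- r, 1:] * q" by (auto simp: poly_eq_0_iff_dvd dvd_def)
  hence q: "q \<noteq> 0" using Suc by auto
  hence "degree p = Suc (degree q)" unfolding p by (subst degree_mult_eq) auto
  hence "deg0 (\<lambda>P. poly q (xc P))" using Suc q by auto
  from deg0_mult[OF deg0_xc_minus[of r] this RFN_xc_minus(1) RFN_poly_xc[OF q]]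
  show ?case unfolding p poly_mult by (simp add: algebra_simps)
qed

text \<open>Negation permutes the points, so f and its conjugate have the same degree, and their
  product is a polynomial in x, already known to have degree zero. Away from infinity both orders
  are nonnegative, so they vanish wherever their sum does; this bounds the support of f.\<close>

lemma deg0_evp:
  assumes "a \<noteq> 0 \<or> b \<noteq> 0"
  shows "deg0 (evp a b)"
proof -
  let ?f = "evp a b" and ?n = "\<lambda>P. poly (nrm a b) (xc P)"
  have nz: "nrm a b \<noteq> 0" using degree_nrm(1)[OF assms] .
  have f: "?f \<in> RFN" using RFN_evp[OF assms] .
  have norm: "dv ?n X = dv ?f X + dv ?f (-\<^sub>E X)" if X: "X \<in> EC" for X
  proof -
    have "\<forall>\<^sub>F P in ecf. ?n P = ?f P * ?f (-\<^sub>E P)"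
      using eventually_ecf_neq[of Infinity] by eventually_elim (simp add: evp_nrm evp_pneg)
    from dv_cong[OF RFN_poly_xc[OF nz] this X] show ?thesis
      using dv_mult[OF f RFN_pneg(1)[OF f] X] dv_pneg[OF f X] by simp
  qed
  from deg0_poly_xc[OF nz] obtain S0 where S0: "finite S0" "S0 \<subseteq> EC" "\<forall>X\<in>EC - S0. dv ?n X = 0"
    "(\<Sum>X\<in>S0. dv ?n X) = 0" by (auto simp: deg0_def)
  define S where "S = insert Infinity (S0 \<union> pneg ` S0)"
  have S: "finite S" "S \<subseteq> EC" "S0 \<subseteq> S" using S0 by (auto simp: S_def)
  have inv: "pneg ` S = S" unfolding S_def by (auto simp: image_Un image_image)
  have "dv ?f X = 0" if "X \<in> EC - S" for X
  proof -
    have X: "X \<in> EC" "X \<noteq> Infinity" "X \<notin> S0" using that by (auto simp: S_def)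
    hence "dv ?f X \<ge> 0" "dv ?f (-\<^sub>E X) \<ge> 0" using dv_evp_nonneg[OF assms] by auto
    moreover have "dv ?f X + dv ?f (-\<^sub>E X) = 0" using norm[OF X(1)] S0(3) X by auto
    ultimately show ?thesis by simp
  qed
  moreover have "(\<Sum>X\<in>S. dv ?f X) = 0"
  proof -
    have "(\<Sum>X\<in>S. dv ?f X) = (\<Sum>X\<in>pneg ` S. dv ?f X)" by (simp add: inv)
    also have "\<dots> = (\<Sum>X\<in>S. dv ?f (-\<^sub>E X))" by (subst sum.reindex) (auto simp: inj_on_def)
    finally have "2 * (\<Sum>X\<in>S. dv ?f X) = (\<Sum>X\<in>S. dv ?f X) + (\<Sum>X\<in>S. dv ?f (-\<^sub>E X))" by simp
    also have "\<dots> = (\<Sum>X\<in>S. dv ?f X + dv ?f (-\<^sub>E X))" by (simp add: sum.distrib)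
    also have "\<dots> = (\<Sum>X\<in>S. dv ?n X)" using S(2) by (intro sum.cong) (auto simp: norm)
    also have "\<dots> = 0" using deg0_superset[OF S0 S(1,3,2)] .
    finally show ?thesis by simp
  qed
  ultimately show ?thesis unfolding deg0_def using S by blast
qed

lemma deg0_RFN:
  assumes "\<phi> \<in> RFN"
  shows "deg0 \<phi>"
proof -
  from assms obtain a b d where r: "rep \<phi> a b d" "a \<noteq> 0 \<or> b \<noteq> 0" by (rule RFN_E)
  have d: "d \<noteq> 0" and e: "\<forall>\<^sub>F P in ecf. \<phi> P * poly d (xc P) = evp a b P" using r by (auto simp: rep_def)
  note R = RFN_evp[OF r(2)] RFN_poly_xc[OF d]
  have "deg0 (\<lambda>P. evp a b P * inverse (poly d (xc P)))"
    by (intro deg0_mult deg0_inverse deg0_evp deg0_poly_xc r d R RFN_inverse)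
  moreover have "(\<lambda>P. evp a b P * inverse (poly d (xc P))) \<in> RFN"
    by (intro RFN_mult RFN_inverse R)
  moreover from e eventually_poly_xc_nonzero[OF d]
  have "\<forall>\<^sub>F P in ecf. evp a b P * inverse (poly d (xc P)) = \<phi> P"
  proof eventually_elim
    case (elim P)
    show ?case unfolding elim(1)[symmetric] using elim(2) by simp
  qed
  ultimately show ?thesis by (rule deg0_cong)
qed

theorem degree_zero:
  assumes "\<phi> \<in> RFN"
  shows "finite {X \<in> EC. dv \<phi> X \<noteq> 0}"
    and "finite T \<Longrightarrow> {X \<in> EC. dv \<phi> X \<noteq> 0} \<subseteq> T \<Longrightarrow> T \<subseteq> EC \<Longrightarrow> (\<Sum>X\<in>T. dv \<phi> X) = 0"
proof -
  from deg0_RFN[OF assms] obtain S where S: "finite S" "S \<subseteq> EC" "\<forall>X\<in>EC - S. dv \<phi> X = 0"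
    "(\<Sum>X\<in>S. dv \<phi> X) = 0" by (auto simp: deg0_def)
  have "{X \<in> EC. dv \<phi> X \<noteq> 0} \<subseteq> S" using S by blast
  thus fin: "finite {X \<in> EC. dv \<phi> X \<noteq> 0}" using S finite_subset by blast
  assume T: "finite T" "{X \<in> EC. dv \<phi> X \<noteq> 0} \<subseteq> T" "T \<subseteq> EC"
  have "(\<Sum>X\<in>T. dv \<phi> X) = (\<Sum>X\<in>S \<union> T. dv \<phi> X)"
    using S T by (intro sum.mono_neutral_left) auto
  thus "(\<Sum>X\<in>T. dv \<phi> X) = 0" using deg0_superset[OF S, of "S \<union> T"] S T by simp
qed

text \<open>All poles lie in T, and any zeros outside it can only make the sum over T negative. This
  is the form in which zeros are counted against poles.\<close>

lemma dv_sum_bound: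
  assumes "\<phi> \<in> RFN" "finite T" "T \<subseteq> EC" "\<And>X. X \<in> EC - T \<Longrightarrow> dv \<phi> X \<ge> 0"
  shows "(\<Sum>X\<in>T. dv \<phi> X) \<le> 0"
proof -
  let ?U = "T \<union> {X \<in> EC. dv \<phi> X \<noteq> 0}"
  have "(\<Sum>X\<in>T. dv \<phi> X) \<le> (\<Sum>X\<in>?U. dv \<phi> X)"
    using degree_zero(1)[OF assms(1)] assms by (intro sum_mono2) auto
  also have "\<dots> = 0" using degree_zero(1)[OF assms(1)] assms by (intro degree_zero(2)) auto
  finally show ?thesis .
qed

lemma dv_pos_exists:
  assumes "\<phi> \<in> RFN" "X \<in> EC" "dv \<phi> X < 0"
  shows "\<exists>Y\<in>EC. dv \<phi> Y > 0"
proof (rule ccontr)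
  assume "\<not> ?thesis"
  hence *: "\<And>Y. Y \<in> EC \<Longrightarrow> dv \<phi> Y \<le> 0" by force
  let ?U = "{X \<in> EC. dv \<phi> X \<noteq> 0}"
  have "(\<Sum>Y\<in>?U. dv \<phi> Y) < (\<Sum>Y\<in>?U. 0)"
    using degree_zero(1)[OF assms(1)] assms * by (intro sum_strict_mono_ex1) auto
  thus False using degree_zero(2)[OF assms(1) degree_zero(1)[OF assms(1)]] by auto
qed

text \<open>Subtracting the value at infinity leaves a function without poles that vanishes at
  infinity; unless it is zero, its degree would be positive.\<close>

lemma liouville:
  assumes "\<phi> \<in> RF" "\<And>X. X \<in> EC \<Longrightarrow> regular \<phi> X"
  shows "\<exists>c. \<forall>\<^sub>F P in ecf. \<phi> P = c"
proof -
  have "ord_ge \<phi> 0" using assms(2)[of Infinity] by (simp add: regular_def)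
  then obtain c where c: "lim_inf \<phi> c" using lim_inf_exists by blast
  let ?\<psi> = "\<lambda>P. \<phi> P - c"
  have "?\<psi> \<in> RF" using assms(1) by (intro RF_diff RF_const)
  moreover have "?\<psi> \<notin> RFN"
  proof
    assume R: "?\<psi> \<in> RFN"
    have "dv ?\<psi> X \<ge> 0" if "X \<in> EC" for X
      using regular_dv[OF R that] regular_diff[OF assms(2)[OF that] regular_const] by blast
    hence "(\<Sum>X\<in>{Infinity}. dv ?\<psi> X) \<le> 0" by (intro dv_sum_bound[OF R]) auto
    moreover have "dv ?\<psi> Infinity \<ge> 1" using c R by (simp add: lim_inf_def ord_ge_def)
    ultimately show False by simp
  qed
  ultimately have "\<forall>\<^sub>F P in ecf. ?\<psi> P = 0" using RF_cases by blast
  thus ?thesis by auto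
qed

end

section \<open>Associativity of the group law\<close>

context monic_cubic_curve
begin

lemma cf_roots:
  obtains e1 e2 e3 where "\<forall>x. cf x = (x - e1) * (x - e2) * (x - e3)" "e1 \<noteq> e2" "e1 \<noteq> e3" "e2 \<noteq> e3"
proof -
  obtain e1 where "poly cp e1 = 0" using alg_closed_imp_poly_has_root[of cp] by auto
  then obtain q where q: "cp = [:- e1, 1:] * q" unfolding poly_eq_0_iff_dvd dvd_def by blast
  hence "q \<noteq> 0" using cp_nonzero by force
  hence dq: "degree q = 2" using degree_cp unfolding q by (subst (asm) degree_mult_eq) auto
  then obtain e2 where "poly q e2 = 0" using alg_closed_imp_poly_has_root[of q] by auto
  then obtain q' where q': "q = [:- e2, 1:] * q'" unfolding poly_eq_0_iff_dvd dvd_def by blast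
  have "q' \<noteq> 0" using \<open>q \<noteq> 0\<close> q' by force
  hence "degree q' = 1" using dq unfolding q' by (subst (asm) degree_mult_eq) auto
  then obtain u v where uv: "q' = [:u, v:]" using degree1_coeffs by blast
  have "lead_coeff cp = lead_coeff q'" unfolding q q' lead_coeff_mult by simp
  moreover have "lead_coeff cp = 1" by (simp add: cp_def)
  ultimately have "v = 1" using \<open>degree q' = 1\<close> by (simp add: uv split: if_splits)
  hence "poly cp x = (x - e1) * (x - e2) * (x - (- u))" for x
    unfolding q q' uv by (simp only: poly_mult) simp
  hence cf: "cf x = (x - e1) * (x - e2) * (x - (- u))" for x by simp
  \<comment> \<open>A double root b makes the x-axis, the line with l = m = 0, tangent at b, so
    \<open>cf' b = 0\<close>.\<close>
  have ne: False if "\<And>x. cf x = (x - a) * (x - b) * (x - b)" for a b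
  proof -
    have "meets 0 0 a b b" using that by (simp add: meets_def)
    from meets_deriv[OF this] have "cf' b = 0" by simp
    thus False using cf'_nonzero[of b] that[of b] by simp
  qed
  show ?thesis
  proof (rule that)
    show "\<forall>x. cf x = (x - e1) * (x - e2) * (x - (- u))" using cf by blast
    show "e1 \<noteq> e2"
    proof
      assume "e1 = e2"
      hence "cf x = (x - (- u)) * (x - e2) * (x - e2)" for x using cf[of x] by (simp add: mult_ac)
      thus False using ne by blast
    qed
    show "e1 \<noteq> - u"
    proof
      assume "e1 = - u"
      hence "cf x = (x - e2) * (x - e1) * (x - e1)" for x using cf[of x] by (simp add: mult_ac)
      thus False using ne by blast
    qed
    show "e2 \<noteq> - u"
    proof
      assume "e2 = - u"
      hence "cf x = (x - e1) * (x - e2) * (x - e2)" for x using cf[of x] by simp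
      thus False using ne by blast
    qed
  qed
qed

text \<open>
  The odd part of a function with only a simple pole, at infinity, vanishes at the points of
  order two, which is too many zeros.
\<close>

lemma no_simple_pole:
  assumes u: "u \<in> RFN" "ord u = - 1" and reg: "\<And>X. X \<in> EC \<Longrightarrow> X \<noteq> Infinity \<Longrightarrow> dv u X \<ge> 0"
  shows False
proof -
  define v where "v = (\<lambda>P. u P - u (-\<^sub>E P))"
  define w where "w = (\<lambda>P. u P + u (-\<^sub>E P))"
  note un = RFN_pneg[OF u(1)]
  \<comment> \<open>The even part \<open>w\<close> has even order at least -1, hence at least 0, so
    the simple pole of \<open>u\<close> survives in the odd part
    \<open>v = 2 * u - w\<close>.\<close>
  have "ord_ge w (- 1)" unfolding w_def
    by (rule ord_ge_add) (use ord_ge_self[OF u(1)] ord_ge_self[OF un(1)] u(2) un(2) in auto)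
  moreover have "even (ord w)" if "w \<in> RFN" using that by (rule even_ord) (simp add: w_def)
  moreover have "k \<ge> 0" if "even k" "k \<ge> - 1" for k :: int using that by presburger
  ultimately have w: "ord_ge w 0" unfolding ord_ge_def by blast
  have "(\<lambda>P. 2 * u P + - w P) \<in> RFN \<and> ord (\<lambda>P. 2 * u P + - w P) = ord (\<lambda>P. 2 * u P)"
    using RFN_cmult[OF u(1), of 2] u(2) ord_ge_uminus[OF w]
    by (intro conjI ord_add_dominant) auto
  moreover have "(\<lambda>P. 2 * u P + - w P) = v" by (auto simp: v_def w_def)
  ultimately have v: "v \<in> RFN" "ord v = - 1" using RFN_cmult(2)[OF u(1), of 2] u(2) by auto
  have rv: "dv v X \<ge> 0" if "X \<in> EC" "X \<noteq> Infinity" for X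
  proof -
    have "regular u X" "regular (\<lambda>P. u (-\<^sub>E P)) X"
      using that reg[of X] reg[of "-\<^sub>E X"] regular_dv u(1) un(1) dv_pneg[OF u(1)] by auto
    hence "regular v X" unfolding v_def by (rule regular_diff)
    thus ?thesis using regular_dv v(1) that by blast
  qed
  \<comment> \<open>A point of order two equals its negative, so \<open>v\<close> translated to it
    is still odd; its order there is odd and nonnegative.\<close>
  have tors: "dv v (Affine e 0) \<ge> 1" if "cf e = 0" for e
  proof -
    let ?X = "Affine e 0"
    have X: "?X \<in> EC" using that by simp
    have "\<forall>\<^sub>F P in ecf. v ((-\<^sub>E P) +\<^sub>E ?X) = - v (P +\<^sub>E ?X)"
      using eventually_ecf_neq[of Infinity]
    proof eventually_elim
      case (elim P)
      hence "-\<^sub>E (P +\<^sub>E ?X) = (-\<^sub>E P) +\<^sub>E ?X" using pneg_padd[of P ?X] X by simp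
      thus ?case by (metis minus_diff_eq pneg_pneg v_def)
    qed
    from odd_ord[OF RFN_translate[OF v(1) X] this] have "odd (dv v ?X)" by (simp add: dv_def)
    thus ?thesis using rv[OF X] by (cases "dv v ?X = 0") auto
  qed
  obtain e1 e2 e3 where e: "\<forall>x. cf x = (x - e1) * (x - e2) * (x - e3)" "e1 \<noteq> e2" "e1 \<noteq> e3" "e2 \<noteq> e3"
    by (rule cf_roots)
  have ez: "cf e1 = 0" "cf e2 = 0" using e(1) by simp_all
  have "(\<Sum>X\<in>{Infinity, Affine e1 0, Affine e2 0}. dv v X) \<le> 0"
    using rv ez by (intro dv_sum_bound[OF v(1)]) auto
  thus False using tors[OF ez(1)] tors[OF ez(2)] v(2) e(2) by simp
qed

text \<open>For S at infinity this is \<open>no_simple_pole\<close>. Otherwise the value at infinity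
  is subtracted: the result has its only pole at S and vanishes at infinity, and degree zero makes
  this zero simple and unique, so the inverse has a lone simple pole at infinity. Thus distinct
  points are never linearly equivalent.\<close>

lemma no_degree_one:
  assumes \<phi>: "\<phi> \<in> RFN" and S: "S \<in> EC" "S' \<in> EC"
    and dv: "\<And>X. X \<in> EC \<Longrightarrow> dv \<phi> X = of_bool (X = S') - of_bool (X = S)"
  shows "S = S'"
proof (rule ccontr)
  assume ne: "S \<noteq> S'"
  show False
  proof (cases "S = Infinity")
    case True
    hence "ord \<phi> = - 1" using dv[of Infinity] ne by simp
    moreover have "dv \<phi> X \<ge> 0" if "X \<in> EC" "X \<noteq> Infinity" for X using dv[OF that(1)] that True by simp
    ultimately show False using no_simple_pole[OF \<phi>] by blast
  next
    case False
    hence "ord_ge \<phi> 0" using dv[of Infinity] ord_ge_self[OF \<phi>] ord_ge_mono by auto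
    then obtain c where c: "lim_inf \<phi> c" using lim_inf_exists by blast
    define \<psi> where "\<psi> = (\<lambda>P. \<phi> P - c)"
    have dS: "ord (\<lambda>P. \<phi> (P +\<^sub>E S)) = - 1" using dv[OF S(1)] ne by (simp add: dv_def)
    have "(\<lambda>P. \<phi> (P +\<^sub>E S) + - c) \<in> RFN \<and> ord (\<lambda>P. \<phi> (P +\<^sub>E S) + - c) = ord (\<lambda>P. \<phi> (P +\<^sub>E S))"
      using dS by (intro conjI ord_add_dominant RFN_translate \<phi> S) simp_all
    hence RS: "(\<lambda>P. \<psi> (P +\<^sub>E S)) \<in> RFN" and "dv \<psi> S = - 1" using dS by (simp_all add: \<psi>_def dv_def)
    have "\<psi> \<in> RF" unfolding \<psi>_def by (intro RF_diff RF_const RFN_imp_RF \<phi>)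
    moreover have "\<not> (\<forall>\<^sub>F P in ecf. \<psi> P = 0)"
      using not_RFN_zero[of "\<lambda>P. \<psi> (P +\<^sub>E S)"] RS eventually_padd[OF S(1), of "\<lambda>P. \<psi> P = 0"] by blast
    ultimately have \<psi>: "\<psi> \<in> RFN" by (simp add: RFN_iff)
    have O: "ord \<psi> \<ge> 1" using c \<psi> by (simp add: lim_inf_def ord_ge_def \<psi>_def)
    have reg: "dv \<psi> X \<ge> 0" if "X \<in> EC" "X \<noteq> S" for X
    proof -
      have "regular \<phi> X" using dv that regular_dv[OF \<phi>] by auto
      hence "regular \<psi> X" unfolding \<psi>_def by (intro regular_diff regular_const)
      thus ?thesis using regular_dv[OF \<psi>] that by blast
    qed
    have "(\<Sum>X\<in>{Infinity, S}. dv \<psi> X) \<le> 0"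
      using reg S by (intro dv_sum_bound[OF \<psi>]) auto
    hence O1: "ord \<psi> = 1" using O \<open>dv \<psi> S = - 1\<close> False by simp
    have "dv \<psi> X \<le> 0" if "X \<in> EC" "X \<noteq> Infinity" for X
    proof (cases "X = S")
      case F: False
      have "(\<Sum>Y\<in>{Infinity, S, X}. dv \<psi> Y) \<le> 0"
        using reg S that by (intro dv_sum_bound[OF \<psi>]) auto
      thus ?thesis using O1 \<open>dv \<psi> S = - 1\<close> False F that by auto
    qed (use \<open>dv \<psi> S = - 1\<close> in simp)
    thus False
      using no_simple_pole[OF RFN_inverse(1)[OF \<psi>]] RFN_inverse(2)[OF \<psi>] O1 dv_inverse[OF \<psi>] by simp
  qed
qed

lemma dv_vertical:
  assumes "R \<in> EC" "R \<noteq> Infinity" "X \<in> EC"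
  shows "dv (\<lambda>P. xc P - xc R) X = of_bool (X = R) + of_bool (X = -\<^sub>E R) - 2 * of_bool (X = Infinity)"
proof (cases X)
  case Infinity
  thus ?thesis using assms by (cases R) (auto simp: RFN_xc_minus)
next
  case (Affine r s)
  from assms obtain x y where R: "R = Affine x y" by (cases R) auto
  show ?thesis
  proof (cases "r = x")
    case False
    thus ?thesis using dv_xc_minus[of r s x] assms by (simp add: R Affine)
  next
    case True
    hence "s\<^sup>2 = y\<^sup>2" using assms R Affine by simp
    hence s: "s = y \<or> s = - y" by (simp add: power2_eq_iff)
    have ne: "y \<noteq> - y" if "y \<noteq> 0"
    proof -
      have "y + y \<noteq> 0" using that by (simp flip: mult_2)
      thus ?thesis by (simp add: eq_neg_iff_add_eq_0)
    qed
    show ?thesis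
    proof (cases "y = 0")
      case y: True
      thus ?thesis using dv_xc_minus[of r s x] assms s True by (simp add: R Affine)
    next
      case y: False
      from s consider "s = y" | "s = - y" by blast
      thus ?thesis
      proof cases
        case 1
        thus ?thesis using dv_xc_minus[of r s x] assms True y ne[OF y] by (simp add: R Affine)
      next
        case 2
        thus ?thesis using dv_xc_minus[of r s x] assms True y ne[OF y] by (simp add: R Affine eq_commute[of "- y"])
      qed
    qed
  qed
qed

lemma dv_norm:
  assumes "a \<noteq> 0 \<or> b \<noteq> 0" "X \<in> EC"
  shows "dv (\<lambda>P. poly (nrm a b) (xc P)) X = dv (evp a b) X + dv (evp a b) (-\<^sub>E X)"
proof -
  have nz: "nrm a b \<noteq> 0" using degree_nrm(1)[OF assms(1)] .
  have f: "evp a b \<in> RFN" using RFN_evp[OF assms(1)] .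
  have "\<forall>\<^sub>F P in ecf. poly (nrm a b) (xc P) = evp a b P * evp a b (-\<^sub>E P)"
    using eventually_ecf_neq[of Infinity] by eventually_elim (simp add: evp_nrm evp_pneg)
  from dv_cong[OF RFN_poly_xc[OF nz] this assms(2)] show ?thesis
    using dv_mult[OF f RFN_pneg(1)[OF f] assms(2)] dv_pneg[OF f assms(2)] by simp
qed

text \<open>The norm of y - (l x + m) is minus the cubic that \<open>meets\<close> factors, so it
  gives the sum of the orders at X and -X. A point off the line has order 0, which isolates one of
  the two; if y = 0 they coincide and the sum is halved.\<close>

lemma dv_line:
  assumes m: "meets l m x1 x2 x3" and X: "X \<in> EC"
  shows "dv (evp [:- m, - l:] [:1:]) X =
    of_bool (X = Affine x1 (l * x1 + m)) + of_bool (X = Affine x2 (l * x2 + m))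
    + of_bool (X = Affine x3 (l * x3 + m)) - 3 * of_bool (X = Infinity)"
proof (cases X)
  case Infinity
  have "degree [:- m, - l:] \<le> 1" "degree ([:1:] :: 'a poly) = 0" by simp_all
  hence "ord (evp [:- m, - l:] [:1:]) = - 3"
    using ord_rep[OF rep_evp[of "[:- m, - l:]" "[:1:]"]]
    by (simp add: degree_nrm max_def del: degree_pCons_eq_if)
  thus ?thesis using Infinity by simp
next
  case (Affine r s)
  let ?a = "[:- m, - l:]" and ?b = "[:1:] :: 'a poly"
  have nz: "?a \<noteq> 0 \<or> ?b \<noteq> 0" by simp
  have ev: "evp ?a ?b (Affine x y) = y - (l * x + m)" for x y by (simp add: evp_def)
  have RX: "Affine r s \<in> EC" using X Affine by simp
  have n: "poly (nrm ?a ?b) x = - 1 * ((x - x1) * ((x - x2) * (x - x3)))" for x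
  proof -
    have "poly (nrm ?a ?b) x = (l * x + m)\<^sup>2 - cf x"
      by (simp add: nrm_def power2_eq_square algebra_simps)
    also have "\<dots> = - (cf x - (l * x + m)\<^sup>2)" by simp
    also have "cf x - (l * x + m)\<^sup>2 = (x - x1) * (x - x2) * (x - x3)"
      using m unfolding meets_def by blast
    finally show ?thesis by (simp add: mult.assoc)
  qed
  have sum: "dv (evp ?a ?b) X + dv (evp ?a ?b) (-\<^sub>E X)
     = dv (\<lambda>P. xc P - x1) X + (dv (\<lambda>P. xc P - x2) X + dv (\<lambda>P. xc P - x3) X)"
    unfolding dv_norm[OF nz X, symmetric] n
    by (subst dv_cmult dv_mult; (intro RFN_mult RFN_xc_minus X)?; simp?)+
  show ?thesis
  proof (cases "s = l * r + m")
    case False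
    hence "dv (evp ?a ?b) X = 0" using dv_evp_eq_0[OF X, of ?a ?b] Affine ev by simp
    thus ?thesis using False Affine by auto
  next
    case True
    show ?thesis
    proof (cases "s = 0")
      case s: True
      have "-\<^sub>E X = X" using s Affine by simp
      hence "2 * dv (evp ?a ?b) X = 2 * (of_bool (r = x1) + of_bool (r = x2) + of_bool (r = x3))"
        using sum dv_xc_minus[OF RX] s Affine by auto
      thus ?thesis using True Affine by (auto simp: of_bool_def)
    next
      case s: False
      have "s + s \<noteq> 0" using s by (simp flip: mult_2)
      hence "- s \<noteq> l * r + m" using True by (metis add.right_inverse)
      hence "dv (evp ?a ?b) (-\<^sub>E X) = 0"
        using dv_evp_eq_0[of "-\<^sub>E X" ?a ?b] Affine ev X by simp
      hence "dv (evp ?a ?b) X = of_bool (r = x1) + of_bool (r = x2) + of_bool (r = x3)"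
        using sum dv_xc_minus[OF RX] s Affine by auto
      thus ?thesis using True Affine by (auto simp: of_bool_def)
    qed
  qed
qed

text \<open>In the generic case, the line through P and Q divided by the vertical line through P +
  Q. It is the linear equivalence (P) + (Q) ~ (P + Q) + (\<infinity>), by which the chord-tangent
  law becomes addition of divisor classes.\<close>

lemma exists_chord_function:
  assumes "P \<in> EC" "Q \<in> EC"
  shows "\<exists>f\<in>RFN. \<forall>X\<in>EC. dv f X =
     of_bool (X = P) + of_bool (X = Q) - of_bool (X = P +\<^sub>E Q) - of_bool (X = Infinity)"
proof (cases "P = Infinity \<or> Q = Infinity")
  case True
  thus ?thesis
    by (intro bexI[of _ "\<lambda>_. 1"]) (auto simp: RFN_const dv_const)
next
  case False
  show ?thesis
  proof (cases "Q = -\<^sub>E P")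
    case True
    show ?thesis
    proof (rule bexI, rule ballI)
      show "(\<lambda>Z. xc Z - xc P) \<in> RFN" by (rule RFN_xc_minus)
    next
      fix X assume "X \<in> EC"
      from dv_vertical[OF assms(1) _ this] False
      show "dv (\<lambda>Z. xc Z - xc P) X = of_bool (X = P) + of_bool (X = Q) - of_bool (X = P +\<^sub>E Q) - of_bool (X = Infinity)"
        by (simp add: True)
    qed
  next
    case ne: False
    from False obtain x1 y1 x2 y2 where PQ: "P = Affine x1 y1" "Q = Affine x2 y2"
      by (metis point.exhaust)
    obtain l m x3 where *: "P +\<^sub>E Q = Affine x3 (- (l * x3 + m))"
      "y1 = l * x1 + m" "y2 = l * x2 + m" "meets l m x1 x2 x3"
      by (rule padd_line[of x1 y1 x2 y2]) (use assms ne PQ in simp_all)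
    let ?R = "P +\<^sub>E Q"
    let ?L = "evp [:- m, - l:] [:1:]" and ?V = "\<lambda>Z. xc Z - xc ?R"
    have R: "?R \<in> EC" "?R \<noteq> Infinity" using padd_in_EC[OF assms] unfolding *(1) by (blast, simp)
    have nR: "-\<^sub>E ?R = Affine x3 (l * x3 + m)" using *(1) by simp
    have L: "?L \<in> RFN" by (rule RFN_evp) simp
    show ?thesis
    proof (rule bexI, rule ballI)
      show "(\<lambda>Z. ?L Z / ?V Z) \<in> RFN" by (intro RFN_divide L RFN_xc_minus)
    next
      fix X assume X: "X \<in> EC"
      have "dv ?L X = of_bool (X = P) + of_bool (X = Q) + of_bool (X = -\<^sub>E ?R) - 3 * of_bool (X = Infinity)"
        using dv_line[OF *(4) X] unfolding nR unfolding PQ *(2,3) .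
      thus "dv (\<lambda>Z. ?L Z / ?V Z) X = of_bool (X = P) + of_bool (X = Q) - of_bool (X = ?R) - of_bool (X = Infinity)"
        using dv_divide[OF L RFN_xc_minus(1) X, of "xc ?R"] dv_vertical[OF R X] by simp
    qed
  qed
qed

text \<open>Both bracketings represent the class of (P) + (Q) + (R) - 2(\<infinity>). The quotient
  of the four chord functions has as divisor the difference of the two results, so they
  coincide.\<close>

theorem padd_assoc:
  assumes "P \<in> EC" "Q \<in> EC" "R \<in> EC"
  shows "(P +\<^sub>E Q) +\<^sub>E R = P +\<^sub>E (Q +\<^sub>E R)"
proof -
  obtain f1 where 1: "f1 \<in> RFN" "\<forall>X\<in>EC. dv f1 X =
     of_bool (X = P) + of_bool (X = Q) - of_bool (X = P +\<^sub>E Q) - of_bool (X = Infinity)"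
    using exists_chord_function[OF assms(1,2)] by blast
  obtain f2 where 2: "f2 \<in> RFN" "\<forall>X\<in>EC. dv f2 X =
     of_bool (X = P +\<^sub>E Q) + of_bool (X = R) - of_bool (X = (P +\<^sub>E Q) +\<^sub>E R) - of_bool (X = Infinity)"
    using exists_chord_function[of "P +\<^sub>E Q" R] assms by auto
  obtain f3 where 3: "f3 \<in> RFN" "\<forall>X\<in>EC. dv f3 X =
     of_bool (X = Q) + of_bool (X = R) - of_bool (X = Q +\<^sub>E R) - of_bool (X = Infinity)"
    using exists_chord_function[OF assms(2,3)] by blast
  obtain f4 where 4: "f4 \<in> RFN" "\<forall>X\<in>EC. dv f4 X =
     of_bool (X = P) + of_bool (X = Q +\<^sub>E R) - of_bool (X = P +\<^sub>E (Q +\<^sub>E R)) - of_bool (X = Infinity)"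
    using exists_chord_function[of P "Q +\<^sub>E R"] assms by auto
  have "(\<lambda>Z. (f1 Z * f2 Z) / (f3 Z * f4 Z)) \<in> RFN"
    by (intro RFN_divide RFN_mult 1 2 3 4)
  moreover have "dv (\<lambda>Z. (f1 Z * f2 Z) / (f3 Z * f4 Z)) X
     = of_bool (X = P +\<^sub>E (Q +\<^sub>E R)) - of_bool (X = (P +\<^sub>E Q) +\<^sub>E R)" if X: "X \<in> EC" for X
    using 1 2 3 4 X by (simp add: dv_divide dv_mult RFN_mult)
  ultimately show ?thesis using assms by (intro no_degree_one) auto
qed

definition EG :: "'a point monoid" where
  "EG = \<lparr>carrier = EC, monoid.mult = padd, one = Infinity\<rparr>"

lemma EG_simps [simp]: "carrier EG = EC" "x \<otimes>\<^bsub>EG\<^esub> y = x +\<^sub>E y" "\<one>\<^bsub>EG\<^esub> = Infinity"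
  by (simp_all add: EG_def)

sublocale EG: comm_group EG
proof (rule comm_groupI)
  fix x assume "x \<in> carrier EG"
  thus "\<exists>y\<in>carrier EG. y \<otimes>\<^bsub>EG\<^esub> x = \<one>\<^bsub>EG\<^esub>"
    by (intro bexI[of _ "-\<^sub>E x"]) (auto simp: padd_commute[of "-\<^sub>E x"])
qed (simp_all add: padd_assoc, simp add: padd_commute)

lemma EG_inv [simp]: "P \<in> EC \<Longrightarrow> inv\<^bsub>EG\<^esub> P = -\<^sub>E P"
  using EG.inv_equality[of "-\<^sub>E P" P] padd_commute[of "-\<^sub>E P" P] by simp

end

section \<open>The Weil pairing\<close>

text \<open>The polynomial X^n - c is separable: a double root would be a root of n X^(n-1), hence
  0, against c being nonzero.\<close>

lemma card_nth_roots_alg_closed: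
  fixes c :: "'a :: {alg_closed_field, field_char_0}"
  assumes "c \<noteq> 0" "n > 0"
  shows "card {x. x ^ n = c} = n"
proof -
  define p where "p = monom 1 n - [:c:]"
  have ev: "poly p x = x ^ n - c" for x by (simp add: p_def poly_monom)
  have cn: "coeff p n = 1" using assms by (cases n) (auto simp: p_def)
  have "degree p = n"
  proof (rule antisym)
    show "degree p \<le> n" unfolding p_def
      by (intro degree_diff_le) (auto simp: degree_monom_eq)
    show "n \<le> degree p" using cn by (intro le_degree) simp
  qed
  moreover have "p \<noteq> 0" using cn by auto
  ultimately obtain A where A: "size A = n" "p = smult (lead_coeff p) (\<Prod>x\<in>#A. [:-x, 1:])"
    using alg_closed_imp_factorization[of p] by auto
  have lc: "lead_coeff p = 1" using cn \<open>degree p = n\<close> by simp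
  have pA: "p = (\<Prod>x\<in>#A. [:-x, 1:])" using A(2) unfolding lc by simp
  have root: "x \<in># A \<longleftrightarrow> x ^ n = c" for x
  proof -
    have "poly (\<Prod>y\<in>#B. [:-y, 1:]) x = 0 \<longleftrightarrow> x \<in># B" for B
      by (induction B) auto
    hence "poly p x = 0 \<longleftrightarrow> x \<in># A" unfolding pA by blast
    thus ?thesis using ev by simp
  qed
  have "count A x = 1" if "x \<in># A" for x
  proof (rule ccontr)
    assume "count A x \<noteq> 1"
    moreover have "count A x > 0" using that by simp
    ultimately have "count A x \<ge> 2" by linarith
    hence "{#x, x#} \<subseteq># A" by (auto simp: subseteq_mset_def)
    then obtain B where "A = {#x, x#} + B" using mset_subset_eq_exists_conv by blast
    hence "p = [:-x, 1:] * ([:-x, 1:] * (\<Prod>x\<in>#B. [:-x, 1:]))" unfolding pA by simp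
    hence "poly (pderiv p) x = 0" by (simp only: pderiv_mult poly_add poly_mult) simp
    hence "of_nat n * x ^ (n - 1) = 0" by (simp add: p_def pderiv_diff pderiv_monom poly_monom)
    hence "x = 0" using assms by auto
    thus False using root[of x] that assms by (simp add: power_0_left)
  qed
  hence "size A = card (set_mset A)"
    by (simp add: size_multiset_overloaded_eq)
  moreover have "set_mset A = {x. x ^ n = c}" using root by auto
  ultimately show ?thesis using A(1) by simp
qed

context monic_cubic_curve
begin

abbreviation smul :: "nat \<Rightarrow> 'a point \<Rightarrow> 'a point" (infixr \<open>\<cdot>\<^sub>E\<close> 75) where
  "n \<cdot>\<^sub>E P \<equiv> P [^]\<^bsub>EG\<^esub> n"

lemma smul_0 [simp]: "0 \<cdot>\<^sub>E P = Infinity"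
  by simp

lemma smul_Suc: "Suc n \<cdot>\<^sub>E P = n \<cdot>\<^sub>E P +\<^sub>E P"
  using EG.nat_pow_Suc[of P n] by simp

lemma smul_in_EC [simp]: "P \<in> EC \<Longrightarrow> n \<cdot>\<^sub>E P \<in> EC"
  using EG.nat_pow_closed[of P n] by simp

lemma smul_1 [simp]: "P \<in> EC \<Longrightarrow> 1 \<cdot>\<^sub>E P = P" "P \<in> EC \<Longrightarrow> Suc 0 \<cdot>\<^sub>E P = P"
  by simp_all

lemma smul_Infinity [simp]: "n \<cdot>\<^sub>E Infinity = Infinity"
  using EG.nat_pow_one[of n] by simp

lemma smul_add: "P \<in> EC \<Longrightarrow> (m + n) \<cdot>\<^sub>E P = m \<cdot>\<^sub>E P +\<^sub>E n \<cdot>\<^sub>E P"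
  using EG.nat_pow_mult[of P m n] by simp

lemma smul_smul: "P \<in> EC \<Longrightarrow> m \<cdot>\<^sub>E n \<cdot>\<^sub>E P = (m * n) \<cdot>\<^sub>E P"
  using EG.nat_pow_pow[of P n m] by (simp add: mult.commute)

lemma smul_padd: "P \<in> EC \<Longrightarrow> Q \<in> EC \<Longrightarrow> n \<cdot>\<^sub>E (P +\<^sub>E Q) = n \<cdot>\<^sub>E P +\<^sub>E n \<cdot>\<^sub>E Q"
  using EG.nat_pow_distrib[of P Q n] by simp

lemma smul_pneg: "P \<in> EC \<Longrightarrow> n \<cdot>\<^sub>E (-\<^sub>E P) = -\<^sub>E (n \<cdot>\<^sub>E P)"
  using EG.nat_pow_inv[of P n] by simp

lemma padd_left_commute: "P \<in> EC \<Longrightarrow> Q \<in> EC \<Longrightarrow> R \<in> EC \<Longrightarrow> P +\<^sub>E (Q +\<^sub>E R) = Q +\<^sub>E (P +\<^sub>E R)"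
  using EG.m_lcomm[of P Q R] by simp

lemmas padd_ac = padd_assoc padd_commute padd_left_commute

lemma padd_right_commute: "P \<in> EC \<Longrightarrow> Q \<in> EC \<Longrightarrow> R \<in> EC \<Longrightarrow> P +\<^sub>E Q +\<^sub>E R = P +\<^sub>E R +\<^sub>E Q"
  by (simp add: padd_assoc padd_commute[of Q R])

lemma padd_pneg_eq_iff: "X \<in> EC \<Longrightarrow> P \<in> EC \<Longrightarrow> Q \<in> EC \<Longrightarrow> X +\<^sub>E (-\<^sub>E P) = Q \<longleftrightarrow> X = P +\<^sub>E Q"
  using padd_cancel[of Q P] padd_cancel'[of X P] by (auto simp: padd_commute[of P Q])

definition tors :: "nat \<Rightarrow> 'a point set" where
  "tors N = {P \<in> EC. N \<cdot>\<^sub>E P = Infinity}"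

lemma tors_in_EC: "P \<in> tors N \<Longrightarrow> P \<in> EC"
  by (simp add: tors_def)

lemma Infinity_in_tors [simp]: "Infinity \<in> tors N"
  by (simp add: tors_def)

lemma padd_in_tors: "P \<in> tors N \<Longrightarrow> Q \<in> tors N \<Longrightarrow> P +\<^sub>E Q \<in> tors N"
  by (simp add: tors_def smul_padd)

lemma smul_in_tors: "P \<in> tors N \<Longrightarrow> n \<cdot>\<^sub>E P \<in> tors N"
proof -
  assume P: "P \<in> tors N"
  hence E: "P \<in> EC" and N: "N \<cdot>\<^sub>E P = Infinity" by (auto simp: tors_def)
  have "N \<cdot>\<^sub>E n \<cdot>\<^sub>E P = n \<cdot>\<^sub>E N \<cdot>\<^sub>E P" unfolding smul_smul[OF E] by (simp only: mult.commute)
  thus ?thesis using E N by (simp add: tors_def)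
qed

lemma tors_dvd: "P \<in> tors M \<Longrightarrow> M dvd N \<Longrightarrow> P \<in> tors N"
proof -
  assume "P \<in> tors M" "M dvd N"
  then obtain k where "N = k * M" by (auto simp: dvd_def mult.commute)
  thus "P \<in> tors N" using \<open>P \<in> tors M\<close> by (simp add: tors_def flip: smul_smul)
qed

lemma dv_translate:
  assumes "\<phi> \<in> RFN" "X \<in> EC" "Y \<in> EC"
  shows "dv (\<lambda>P. \<phi> (P +\<^sub>E Y)) X = dv \<phi> (X +\<^sub>E Y)"
proof -
  have "\<forall>\<^sub>F P in ecf. \<phi> (P +\<^sub>E X +\<^sub>E Y) = \<phi> (P +\<^sub>E (X +\<^sub>E Y))"
    using eventually_ecf_neq[of Infinity] by eventually_elim (simp add: padd_assoc assms)
  from ord_cong[OF RFN_translate[OF RFN_translate[OF assms(1,3)] assms(2)] this]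
  show ?thesis by (simp add: dv_def)
qed

lemma same_divisor:
  assumes "f \<in> RFN" "g \<in> RFN" "\<And>X. X \<in> EC \<Longrightarrow> dv f X = dv g X"
  obtains c where "c \<noteq> 0" "\<forall>\<^sub>F Z in ecf. f Z = c * g Z"
proof -
  have R: "(\<lambda>Z. f Z / g Z) \<in> RFN" using assms by (intro RFN_divide)
  have "regular (\<lambda>Z. f Z / g Z) X" if "X \<in> EC" for X
    using regular_dv[OF R that] dv_divide[OF assms(1,2) that] assms(3)[OF that] by simp
  then obtain c where c: "\<forall>\<^sub>F Z in ecf. f Z / g Z = c" using liouville[OF RFN_imp_RF[OF R]] by blast
  have "c \<noteq> 0"
  proof
    assume "c = 0"
    thus False using not_RFN_zero[of "\<lambda>Z. f Z / g Z"] R c by simp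
  qed
  moreover from c RFN_nonzero[OF assms(2)] have "\<forall>\<^sub>F Z in ecf. f Z = c * g Z"
    by eventually_elim auto
  ultimately show ?thesis by (rule that)
qed

section \<open>Functions attached to torsion points\<close>

definition tdiv :: "nat \<Rightarrow> ('a point \<Rightarrow> 'a) \<Rightarrow> 'a point \<Rightarrow> bool" where
  "tdiv N f P \<longleftrightarrow> f \<in> RFN \<and> (\<forall>X\<in>EC. dv f X = int N * (of_bool (X = P) - of_bool (X = Infinity)))"

text \<open>Miller's recursion. A function with divisor n(P) - (nP) - (n - 1)(\<infinity>) is
  multiplied by the chord function of nP and P to pass to n + 1; at n = N the middle point is
  \<infinity>.\<close>

lemma exists_tdiv:
  assumes "P \<in> tors N"
  shows "\<exists>f. tdiv N f P"
proof -
  have P: "P \<in> EC" using assms by (rule tors_in_EC)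
  have "\<exists>f\<in>RFN. \<forall>X\<in>EC. dv f X = int n * of_bool (X = P) - of_bool (X = n \<cdot>\<^sub>E P) - (int n - 1) * of_bool (X = Infinity)" for n
  proof (induction n)
    case 0
    show ?case by (intro bexI[of _ "\<lambda>_. 1"]) (auto simp: RFN_const dv_const)
  next
    case (Suc n)
    then obtain f where f: "f \<in> RFN" "\<forall>X\<in>EC. dv f X = int n * of_bool (X = P) - of_bool (X = n \<cdot>\<^sub>E P) - (int n - 1) * of_bool (X = Infinity)"
      by blast
    obtain g where g: "g \<in> RFN" "\<forall>X\<in>EC. dv g X = of_bool (X = n \<cdot>\<^sub>E P) + of_bool (X = P) - of_bool (X = n \<cdot>\<^sub>E P +\<^sub>E P) - of_bool (X = Infinity)"
      using exists_chord_function[of "n \<cdot>\<^sub>E P" P] P by auto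
    show ?case
    proof (intro bexI[of _ "\<lambda>Z. f Z * g Z"] ballI)
      fix X assume X: "X \<in> EC"
      show "dv (\<lambda>Z. f Z * g Z) X = int (Suc n) * of_bool (X = P) - of_bool (X = Suc n \<cdot>\<^sub>E P) - (int (Suc n) - 1) * of_bool (X = Infinity)"
        unfolding dv_mult[OF f(1) g(1) X] bspec[OF f(2) X] bspec[OF g(2) X] smul_Suc of_nat_Suc ring_distribs
        by linarith
    qed (use f g in \<open>simp add: RFN_mult\<close>)
  qed
  from this[of N] obtain f where "f \<in> RFN" "\<forall>X\<in>EC. dv f X = int N * of_bool (X = P) - of_bool (X = N \<cdot>\<^sub>E P) - (int N - 1) * of_bool (X = Infinity)"
    by blast
  moreover have "N \<cdot>\<^sub>E P = Infinity" using assms by (simp add: tors_def)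
  ultimately show ?thesis unfolding tdiv_def by (intro exI[of _ f]) (simp add: algebra_simps)
qed

lemma tdiv_RFN: "tdiv N f P \<Longrightarrow> f \<in> RFN"
  by (simp add: tdiv_def)

text \<open>Multiplication by f followed by g translated is what arises when the operator "translate
  by -P, multiply by f" is composed with the one for Q and g. The resulting divisor is symmetric in
  P and Q, so the two orders of composition differ by a scalar.\<close>

lemma tdiv_mult_shift:
  assumes "tdiv N f P" "tdiv N g Q" "P \<in> EC" "Q \<in> EC"
  shows "tdiv N (\<lambda>Z. f Z * g (Z +\<^sub>E (-\<^sub>E P))) (P +\<^sub>E Q)"
proof -
  have R: "(\<lambda>Z. g (Z +\<^sub>E (-\<^sub>E P))) \<in> RFN" using assms by (intro RFN_translate tdiv_RFN) auto
  have "dv (\<lambda>Z. f Z * g (Z +\<^sub>E (-\<^sub>E P))) X = int N * (of_bool (X = P +\<^sub>E Q) - of_bool (X = Infinity))"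
    if X: "X \<in> EC" for X
  proof -
    have nP: "-\<^sub>E P \<in> EC" "X +\<^sub>E (-\<^sub>E P) \<in> EC" using assms X by simp_all
    have f: "dv f X = int N * (of_bool (X = P) - of_bool (X = Infinity))"
      using assms(1) X unfolding tdiv_def by blast
    have "dv g (X +\<^sub>E (-\<^sub>E P)) = int N * (of_bool (X +\<^sub>E (-\<^sub>E P) = Q) - of_bool (X +\<^sub>E (-\<^sub>E P) = Infinity))"
      using assms(2) nP unfolding tdiv_def by blast
    hence g: "dv g (X +\<^sub>E (-\<^sub>E P)) = int N * (of_bool (X = P +\<^sub>E Q) - of_bool (X = P))"
      using padd_pneg_eq_iff[OF X assms(3,4)] padd_pneg_eq_iff[OF X assms(3) Infinity_in_EC] by simp
    show ?thesis
      unfolding dv_mult[OF tdiv_RFN[OF assms(1)] R X] dv_translate[OF tdiv_RFN[OF assms(2)] X nP(1)] f g ring_distribs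
      by linarith
  qed
  thus ?thesis unfolding tdiv_def using assms R by (simp add: RFN_mult tdiv_RFN)
qed

lemma tdiv_unique:
  assumes "tdiv N f P" "tdiv N g P"
  obtains c where "c \<noteq> 0" "\<forall>\<^sub>F Z in ecf. f Z = c * g Z"
  using same_divisor[of f g] assms unfolding tdiv_def by auto

lemma tdiv_1: "tdiv N (\<lambda>_. 1) Infinity"
  by (simp add: tdiv_def RFN_const dv_const)

text \<open>
  With \<open>N(P) - N(\<infinity>)\<close> the divisor of \<open>f\<close>, put \<open>T\<^sub>P h = f \<cdot> (h \<circ> translation by -P)\<close>. The Weil pairing
  is the scalar by which \<open>T\<^sub>P\<close> and \<open>T\<^sub>Q\<close> fail to commute.
\<close>

definition weil :: "nat \<Rightarrow> 'a point \<Rightarrow> 'a point \<Rightarrow> 'a" where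
  "weil N P Q = (THE c. \<exists>f g. tdiv N f P \<and> tdiv N g Q \<and>
     (\<forall>\<^sub>F Z in ecf. f Z * g (Z +\<^sub>E (-\<^sub>E P)) = c * (g Z * f (Z +\<^sub>E (-\<^sub>E Q)))))"

text \<open>f and g occur once on each side, so rescaling them cancels, and by
  \<open>tdiv_unique\<close> rescaling is the only freedom. This makes the pairing well
  defined.\<close>

lemma commutator_unique:
  assumes "P \<in> EC" "Q \<in> EC"
    and f: "tdiv N f P" "tdiv N f' P" and g: "tdiv N g Q" "tdiv N g' Q"
    and c: "\<forall>\<^sub>F Z in ecf. f Z * g (Z +\<^sub>E (-\<^sub>E P)) = c * (g Z * f (Z +\<^sub>E (-\<^sub>E Q)))"
    and c': "\<forall>\<^sub>F Z in ecf. f' Z * g' (Z +\<^sub>E (-\<^sub>E P)) = c' * (g' Z * f' (Z +\<^sub>E (-\<^sub>E Q)))"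
  shows "c = c'"
proof -
  obtain u where u: "u \<noteq> 0" "\<forall>\<^sub>F Z in ecf. f Z = u * f' Z" using tdiv_unique[OF f] .
  obtain v where v: "v \<noteq> 0" "\<forall>\<^sub>F Z in ecf. g Z = v * g' Z" using tdiv_unique[OF g] .
  have uQ: "\<forall>\<^sub>F Z in ecf. f (Z +\<^sub>E (-\<^sub>E Q)) = u * f' (Z +\<^sub>E (-\<^sub>E Q))"
    using u(2) assms by (subst eventually_padd[of "-\<^sub>E Q" "\<lambda>Z. f Z = u * f' Z"]) auto
  have vP: "\<forall>\<^sub>F Z in ecf. g (Z +\<^sub>E (-\<^sub>E P)) = v * g' (Z +\<^sub>E (-\<^sub>E P))"
    using v(2) assms by (subst eventually_padd[of "-\<^sub>E P" "\<lambda>Z. g Z = v * g' Z"]) auto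
  have "(\<lambda>Z. g' Z * f' (Z +\<^sub>E (-\<^sub>E Q))) \<in> RFN"
    using assms by (intro RFN_mult RFN_translate) (auto simp: tdiv_RFN)
  from RFN_nonzero[OF this] u(2) v(2) uQ vP c c' have "\<forall>\<^sub>F Z in ecf. c = c'"
  proof eventually_elim
    case (elim Z)
    have "u * v * (c' * (g' Z * f' (Z +\<^sub>E (-\<^sub>E Q)))) = u * v * (c * (g' Z * f' (Z +\<^sub>E (-\<^sub>E Q))))"
      using elim(2-7) by (simp add: mult_ac)
    thus ?case using elim(1) u v by simp
  qed
  thus ?thesis using not_eventually_ecf_False by (cases "c = c'") simp_all
qed

lemma commutator_exists:
  assumes "tdiv N f P" "tdiv N g Q" "P \<in> EC" "Q \<in> EC"
  obtains c where "c \<noteq> 0" "\<forall>\<^sub>F Z in ecf. f Z * g (Z +\<^sub>E (-\<^sub>E P)) = c * (g Z * f (Z +\<^sub>E (-\<^sub>E Q)))"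
  using tdiv_unique[OF tdiv_mult_shift[OF assms] tdiv_mult_shift[OF assms(2,1,4,3), unfolded padd_commute[OF assms(4,3)]]]
  by blast

lemma weil_eqI:
  assumes "P \<in> EC" "Q \<in> EC" "tdiv N f P" "tdiv N g Q"
    "\<forall>\<^sub>F Z in ecf. f Z * g (Z +\<^sub>E (-\<^sub>E P)) = c * (g Z * f (Z +\<^sub>E (-\<^sub>E Q)))"
  shows "weil N P Q = c"
  unfolding weil_def
proof (rule the_equality)
  show "\<exists>f g. tdiv N f P \<and> tdiv N g Q \<and> (\<forall>\<^sub>F Z in ecf. f Z * g (Z +\<^sub>E (-\<^sub>E P)) = c * (g Z * f (Z +\<^sub>E (-\<^sub>E Q))))"
    using assms by blast
next
  fix c' assume "\<exists>f g. tdiv N f P \<and> tdiv N g Q \<and> (\<forall>\<^sub>F Z in ecf. f Z * g (Z +\<^sub>E (-\<^sub>E P)) = c' * (g Z * f (Z +\<^sub>E (-\<^sub>E Q))))"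
  then obtain f' g' where "tdiv N f' P" "tdiv N g' Q"
    "\<forall>\<^sub>F Z in ecf. f' Z * g' (Z +\<^sub>E (-\<^sub>E P)) = c' * (g' Z * f' (Z +\<^sub>E (-\<^sub>E Q)))" by blast
  from commutator_unique[OF assms(1,2) this(1) assms(3) this(2) assms(4) this(3) assms(5)]
  show "c' = c" .
qed

lemma weil_spec:
  assumes "P \<in> EC" "Q \<in> EC" "tdiv N f P" "tdiv N g Q"
  shows "weil N P Q \<noteq> 0" "\<forall>\<^sub>F Z in ecf. f Z * g (Z +\<^sub>E (-\<^sub>E P)) = weil N P Q * (g Z * f (Z +\<^sub>E (-\<^sub>E Q)))"
proof -
  obtain c where c: "c \<noteq> 0" "\<forall>\<^sub>F Z in ecf. f Z * g (Z +\<^sub>E (-\<^sub>E P)) = c * (g Z * f (Z +\<^sub>E (-\<^sub>E Q)))"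
    using commutator_exists[OF assms(3,4,1,2)] .
  have "weil N P Q = c" by (rule weil_eqI[OF assms c(2)])
  thus "weil N P Q \<noteq> 0" "\<forall>\<^sub>F Z in ecf. f Z * g (Z +\<^sub>E (-\<^sub>E P)) = weil N P Q * (g Z * f (Z +\<^sub>E (-\<^sub>E Q)))"
    using c by simp_all
qed

text \<open>The operator of P + P' is the product of those of P and P' up to a scalar; moving it
  past the operator of Q collects both commutators.\<close>

lemma weil_padd_left:
  assumes "P \<in> tors N" "P' \<in> tors N" "Q \<in> tors N"
  shows "weil N (P +\<^sub>E P') Q = weil N P Q * weil N P' Q"
proof -
  obtain f f' g where fg: "tdiv N f P" "tdiv N f' P'" "tdiv N g Q" using exists_tdiv assms by metis
  have E: "P \<in> EC" "P' \<in> EC" "Q \<in> EC" using assms tors_in_EC by auto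
  note 1 = weil_spec(2)[OF E(1,3) fg(1,3)]
  have 2: "\<forall>\<^sub>F Z in ecf. f' (Z +\<^sub>E (-\<^sub>E P)) * g (Z +\<^sub>E (-\<^sub>E P) +\<^sub>E (-\<^sub>E P'))
      = weil N P' Q * (g (Z +\<^sub>E (-\<^sub>E P)) * f' (Z +\<^sub>E (-\<^sub>E P) +\<^sub>E (-\<^sub>E Q)))"
    using weil_spec(2)[OF E(2,3) fg(2,3)] E
    by (subst eventually_padd[of "-\<^sub>E P" "\<lambda>Z. f' Z * g (Z +\<^sub>E (-\<^sub>E P')) = weil N P' Q * (g Z * f' (Z +\<^sub>E (-\<^sub>E Q)))"]) auto
  show ?thesis
  proof (rule weil_eqI[OF _ E(3) tdiv_mult_shift[OF fg(1,2) E(1,2)] fg(3)])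
    from 1 2 eventually_ecf_neq[of Infinity]
    show "\<forall>\<^sub>F Z in ecf. f Z * f' (Z +\<^sub>E (-\<^sub>E P)) * g (Z +\<^sub>E (-\<^sub>E (P +\<^sub>E P')))
        = weil N P Q * weil N P' Q * (g Z * (f (Z +\<^sub>E (-\<^sub>E Q)) * f' (Z +\<^sub>E (-\<^sub>E Q) +\<^sub>E (-\<^sub>E P))))"
    proof eventually_elim
      case (elim Z)
      have Z: "Z +\<^sub>E (-\<^sub>E (P +\<^sub>E P')) = Z +\<^sub>E (-\<^sub>E P) +\<^sub>E (-\<^sub>E P')"
        "Z +\<^sub>E (-\<^sub>E Q) +\<^sub>E (-\<^sub>E P) = Z +\<^sub>E (-\<^sub>E P) +\<^sub>E (-\<^sub>E Q)"
        using elim E by (simp_all add: pneg_padd padd_assoc padd_commute[of "-\<^sub>E Q" "-\<^sub>E P"])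
      have "f Z * f' (Z +\<^sub>E (-\<^sub>E P)) * g (Z +\<^sub>E (-\<^sub>E P) +\<^sub>E (-\<^sub>E P'))
         = f Z * (f' (Z +\<^sub>E (-\<^sub>E P)) * g (Z +\<^sub>E (-\<^sub>E P) +\<^sub>E (-\<^sub>E P')))" by (rule mult.assoc)
      also have "\<dots> = weil N P' Q * f' (Z +\<^sub>E (-\<^sub>E P) +\<^sub>E (-\<^sub>E Q)) * (f Z * g (Z +\<^sub>E (-\<^sub>E P)))"
        unfolding elim(2) by (simp only: mult_ac)
      also have "\<dots> = weil N P' Q * f' (Z +\<^sub>E (-\<^sub>E P) +\<^sub>E (-\<^sub>E Q)) * (weil N P Q * (g Z * f (Z +\<^sub>E (-\<^sub>E Q))))"
        unfolding elim(1) ..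
      finally show ?case unfolding Z by (simp only: mult_ac)
    qed
  qed (use E in simp)
qed

lemma weil_swap:
  assumes "P \<in> tors N" "Q \<in> tors N"
  shows "weil N P Q * weil N Q P = 1"
proof -
  obtain f g where fg: "tdiv N f P" "tdiv N g Q" using exists_tdiv assms by metis
  have E: "P \<in> EC" "Q \<in> EC" using assms tors_in_EC by auto
  have R: "(\<lambda>Z. f Z * g (Z +\<^sub>E (-\<^sub>E P))) \<in> RFN"
    using E fg by (intro RFN_mult RFN_translate) (auto simp: tdiv_RFN)
  from RFN_nonzero[OF R] weil_spec(2)[OF E fg] weil_spec(2)[OF E(2,1) fg(2,1)]
  have "\<forall>\<^sub>F Z in ecf. weil N P Q * weil N Q P = 1"
  proof eventually_elim
    case (elim Z)
    have "f Z * g (Z +\<^sub>E (-\<^sub>E P)) = weil N P Q * weil N Q P * (f Z * g (Z +\<^sub>E (-\<^sub>E P)))"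
      using elim(2,3) by (simp add: mult_ac)
    thus ?case using elim(1) by simp
  qed
  thus ?thesis using not_eventually_ecf_False by (cases "weil N P Q * weil N Q P = 1") simp_all
qed

lemma weil_self: "P \<in> tors N \<Longrightarrow> weil N P P = 1"
proof -
  assume P: "P \<in> tors N"
  then obtain f where f: "tdiv N f P" using exists_tdiv by blast
  show ?thesis using P tors_in_EC by (intro weil_eqI[OF _ _ f f]) (auto simp: mult.commute)
qed

lemma weil_Infinity_left: "Q \<in> tors N \<Longrightarrow> weil N Infinity Q = 1"
proof -
  assume Q: "Q \<in> tors N"
  then obtain g where g: "tdiv N g Q" using exists_tdiv by blast
  show ?thesis using Q tors_in_EC by (intro weil_eqI[OF _ _ tdiv_1 g]) auto
qed

lemma weil_smul_left: "P \<in> tors N \<Longrightarrow> Q \<in> tors N \<Longrightarrow> weil N (n \<cdot>\<^sub>E P) Q = weil N P Q ^ n"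
  by (induction n) (auto simp: weil_Infinity_left weil_padd_left smul_in_tors)

lemma weil_swap_inverse: "P \<in> tors N \<Longrightarrow> Q \<in> tors N \<Longrightarrow> weil N P Q = inverse (weil N Q P)"
  using weil_swap[of P N Q] by (metis inverse_unique mult.commute)

lemma weil_padd_right:
  assumes "P \<in> tors N" "Q \<in> tors N" "Q' \<in> tors N"
  shows "weil N P (Q +\<^sub>E Q') = weil N P Q * weil N P Q'"
  using assms weil_padd_left[of Q N Q' P]
  by (simp add: weil_swap_inverse[of P N "Q +\<^sub>E Q'"] weil_swap_inverse[of P N Q] weil_swap_inverse[of P N Q'] padd_in_tors)

lemma weil_smul_right: "P \<in> tors N \<Longrightarrow> Q \<in> tors N \<Longrightarrow> weil N P (n \<cdot>\<^sub>E Q) = weil N P Q ^ n"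
  using weil_smul_left[of Q N P n]
  by (simp add: weil_swap_inverse[of P N "n \<cdot>\<^sub>E Q"] weil_swap_inverse[of P N Q] smul_in_tors power_inverse)

lemma weil_power_N: "P \<in> tors N \<Longrightarrow> Q \<in> tors N \<Longrightarrow> weil N P Q ^ N = 1"
  using weil_smul_left[of P N Q N] by (simp add: tors_def weil_Infinity_left)

text \<open>The Riemann-Roch space L(N(\<infinity>)), on which the operators of N-torsion points
  act. The bound uses \<open>ord_ge\<close>, so that the zero function belongs to it and sums stay
  inside.\<close>

definition LN :: "nat \<Rightarrow> ('a point \<Rightarrow> 'a) \<Rightarrow> bool" where
  "LN N h \<longleftrightarrow> (\<forall>X\<in>EC. ord_ge (\<lambda>Z. h (Z +\<^sub>E X)) (- int N * of_bool (X = Infinity)))"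

lemma LN_RF: "LN N h \<Longrightarrow> h \<in> RF"
  unfolding LN_def by (drule bspec[of _ _ Infinity]) (auto simp: ord_ge_def)

lemma LN_dv: "LN N h \<Longrightarrow> h \<in> RFN \<Longrightarrow> X \<in> EC \<Longrightarrow> dv h X \<ge> - int N * of_bool (X = Infinity)"
  unfolding LN_def dv_def using RFN_translate by (force simp: ord_ge_def)

lemma LN_add: "LN N h \<Longrightarrow> LN N k \<Longrightarrow> LN N (\<lambda>Z. h Z + k Z)"
  unfolding LN_def by (auto intro!: ord_ge_add)

lemma LN_cmult: "LN N h \<Longrightarrow> LN N (\<lambda>Z. c * h Z)"
  unfolding LN_def by (auto intro!: ord_ge_cmult)

lemma LN_const: "LN N (\<lambda>_. c)"
  unfolding LN_def by (auto intro: ord_ge_mono[OF ord_ge_const])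

lemma LN_sum: "(\<And>i. i \<in> I \<Longrightarrow> LN N (h i)) \<Longrightarrow> LN N (\<lambda>Z. \<Sum>i\<in>I. h i Z)"
  by (induction I rule: infinite_finite_induct) (auto intro: LN_add LN_const)

text \<open>Translation moves the pole of h from \<infinity> to P, where the N-fold zero of f
  absorbs it, and f brings its own N-fold pole at \<infinity> instead.\<close>

lemma LN_shift:
  assumes f: "tdiv N f P" and P: "P \<in> EC" and h: "LN N h"
  shows "LN N (\<lambda>Z. f Z * h (Z +\<^sub>E (-\<^sub>E P)))"
  unfolding LN_def
proof
  fix X assume X: "X \<in> EC"
  let ?Y = "X +\<^sub>E (-\<^sub>E P)"
  have Y: "?Y \<in> EC" using X P by simp
  have "ord_ge (\<lambda>Z. f (Z +\<^sub>E X)) (int N * (of_bool (X = P) - of_bool (X = Infinity)))"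
    using f ord_ge_self[OF RFN_translate[OF tdiv_RFN[OF f] X]] X by (simp add: tdiv_def dv_def)
  moreover have "ord_ge (\<lambda>Z. h (Z +\<^sub>E ?Y)) (- int N * of_bool (?Y = Infinity))"
    using h Y unfolding LN_def by blast
  ultimately have "ord_ge (\<lambda>Z. f (Z +\<^sub>E X) * h (Z +\<^sub>E ?Y))
      (int N * (of_bool (X = P) - of_bool (X = Infinity)) + - int N * of_bool (?Y = Infinity))"
    by (rule ord_ge_mult)
  moreover have "?Y = Infinity \<longleftrightarrow> X = P" using padd_pneg_eq_iff[of X P Infinity] X P by simp
  ultimately have "ord_ge (\<lambda>Z. f (Z +\<^sub>E X) * h (Z +\<^sub>E ?Y)) (- int N * of_bool (X = Infinity))"
    by (simp add: algebra_simps)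
  moreover have "\<forall>\<^sub>F Z in ecf. f (Z +\<^sub>E X) * h (Z +\<^sub>E ?Y) = f (Z +\<^sub>E X) * h (Z +\<^sub>E X +\<^sub>E (-\<^sub>E P))"
    using eventually_ecf_neq[of Infinity] by eventually_elim (simp add: padd_assoc X P)
  ultimately show "ord_ge (\<lambda>Z. f (Z +\<^sub>E X) * h (Z +\<^sub>E X +\<^sub>E (-\<^sub>E P))) (- int N * of_bool (X = Infinity))"
    by (rule ord_ge_cong)
qed

text \<open>
  The operator \<open>h \<mapsto> f \<cdot> (h \<circ> translation by -P)\<close> has a scalar \<open>N\<close>-th power, so the components of
  \<open>u\<close> along its eigenspaces are given by a discrete Fourier transform; some component is nonzero.
\<close>

lemma theta_eigenvector:
  assumes f: "tdiv N f P" and P: "P \<in> tors N" and N: "N > 0"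
    and u: "u \<in> RFN" "LN N u" and Q: "Q \<in> EC"
    and comm: "\<forall>\<^sub>F Z in ecf. f Z * g (Z +\<^sub>E (-\<^sub>E P)) = g Z * f (Z +\<^sub>E (-\<^sub>E Q))"
    and eigQ: "\<forall>\<^sub>F Z in ecf. g Z * u (Z +\<^sub>E (-\<^sub>E Q)) = \<eta> * u Z"
  obtains h \<mu> where "h \<in> RFN" "LN N h" "\<mu> \<noteq> 0"
    "\<forall>\<^sub>F Z in ecf. f Z * h (Z +\<^sub>E (-\<^sub>E P)) = \<mu> * h Z" "\<forall>\<^sub>F Z in ecf. g Z * h (Z +\<^sub>E (-\<^sub>E Q)) = \<eta> * h Z"
proof -
  have PE: "P \<in> EC" using P by (rule tors_in_EC)
  define s where "s = (\<lambda>i. ((\<lambda>h Z. f Z * h (Z +\<^sub>E (-\<^sub>E P))) ^^ i) u)"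
  have s0: "s 0 = u" by (simp add: s_def)
  have sS: "s (Suc i) Z = f Z * s i (Z +\<^sub>E (-\<^sub>E P))" for i Z by (simp add: s_def)
  have sL: "LN N (s i)" for i
  proof (induction i)
    case (Suc i)
    have "s (Suc i) = (\<lambda>Z. f Z * s i (Z +\<^sub>E (-\<^sub>E P)))" using sS by blast
    thus ?case using LN_shift[OF f PE Suc] by simp
  qed (use s0 u in simp)
  have tr: "\<forall>\<^sub>F Z in ecf. \<Phi> (Z +\<^sub>E (-\<^sub>E P))" if "\<forall>\<^sub>F Z in ecf. \<Phi> Z" for \<Phi>
    using that PE eventually_padd[of "-\<^sub>E P" \<Phi>] by simp
  have sQ: "\<forall>\<^sub>F Z in ecf. g Z * s i (Z +\<^sub>E (-\<^sub>E Q)) = \<eta> * s i Z" for i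
  proof (induction i)
    case (Suc i)
    from tr[OF Suc] comm eventually_ecf_neq[of Infinity] show ?case
    proof eventually_elim
      case (elim Z)
      have Z: "Z +\<^sub>E (-\<^sub>E Q) +\<^sub>E (-\<^sub>E P) = Z +\<^sub>E (-\<^sub>E P) +\<^sub>E (-\<^sub>E Q)"
        using elim PE Q by (intro padd_right_commute) auto
      have "g Z * s (Suc i) (Z +\<^sub>E (-\<^sub>E Q)) = (g Z * f (Z +\<^sub>E (-\<^sub>E Q))) * s i (Z +\<^sub>E (-\<^sub>E P) +\<^sub>E (-\<^sub>E Q))"
        unfolding sS Z by (simp only: mult.assoc)
      also have "\<dots> = f Z * (g (Z +\<^sub>E (-\<^sub>E P)) * s i (Z +\<^sub>E (-\<^sub>E P) +\<^sub>E (-\<^sub>E Q)))"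
        unfolding elim(2)[symmetric] by (simp only: mult.assoc)
      also have "\<dots> = \<eta> * s (Suc i) Z" unfolding elim(1) sS by (simp only: mult_ac)
      finally show ?case .
    qed
  qed (use s0 eigQ in simp)
  \<comment> \<open>The i-th iterate is again of the same shape: a translation by -iP and a factor F
    with divisor N(iP) - N(\<infinity>). At i = N the translation is trivial and F is constant, so
    the N-th power of the operator is a scalar c.\<close>
  have "\<exists>F. tdiv N F (i \<cdot>\<^sub>E P) \<and> (\<forall>\<^sub>F Z in ecf. s i Z = F Z * u (Z +\<^sub>E (-\<^sub>E (i \<cdot>\<^sub>E P))))" for i
  proof (induction i)
    case 0
    show ?case by (intro exI[of _ "\<lambda>_. 1"]) (simp add: tdiv_1 s0)
  next
    case (Suc i)
    then obtain F where F: "tdiv N F (i \<cdot>\<^sub>E P)" "\<forall>\<^sub>F Z in ecf. s i Z = F Z * u (Z +\<^sub>E (-\<^sub>E (i \<cdot>\<^sub>E P)))" by blast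
    have Si: "Suc i \<cdot>\<^sub>E P = P +\<^sub>E i \<cdot>\<^sub>E P" using PE by (simp add: padd_commute)
    have "tdiv N (\<lambda>Z. f Z * F (Z +\<^sub>E (-\<^sub>E P))) (Suc i \<cdot>\<^sub>E P)"
      unfolding Si by (rule tdiv_mult_shift[OF f F(1)]) (use PE in auto)
    moreover from tr[OF F(2)] eventually_ecf_neq[of Infinity]
    have "\<forall>\<^sub>F Z in ecf. s (Suc i) Z = f Z * F (Z +\<^sub>E (-\<^sub>E P)) * u (Z +\<^sub>E (-\<^sub>E (Suc i \<cdot>\<^sub>E P)))"
    proof eventually_elim
      case (elim Z)
      have "Z +\<^sub>E (-\<^sub>E P) +\<^sub>E (-\<^sub>E (i \<cdot>\<^sub>E P)) = Z +\<^sub>E (-\<^sub>E (Suc i \<cdot>\<^sub>E P))"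
        unfolding Si using elim PE by (simp add: pneg_padd padd_assoc)
      thus ?case using elim(1) by (simp only: sS mult.assoc)
    qed
    ultimately show ?case by blast
  qed
  from this[of N] obtain F where F: "tdiv N F Infinity" "\<forall>\<^sub>F Z in ecf. s N Z = F Z * u Z"
    using P by (auto simp: tors_def)
  obtain c where c: "c \<noteq> 0" "\<forall>\<^sub>F Z in ecf. F Z = c * 1" using tdiv_unique[OF F(1) tdiv_1] .
  from F(2) c(2) have sN: "\<forall>\<^sub>F Z in ecf. s N Z = c * u Z" by eventually_elim simp
  \<comment> \<open>For such \<omega> the sum of \<omega>^i \<open>s i\<close> over i < N is an
    eigenvector with eigenvalue 1/\<omega>: shifting the index produces \<open>s N\<close>, which is
    c u, and c \<omega>^N = 1 closes the cycle.\<close>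
  define W where "W = {\<omega> :: 'a. \<omega> ^ N = inverse c}"
  have cW: "card W = N" unfolding W_def using c N by (intro card_nth_roots_alg_closed) auto
  hence fW: "finite W" using N by (metis card.infinite not_gr_zero)
  \<comment> \<open>At a generic point Z the values \<open>s i Z\<close> are the coefficients of a
    polynomial of degree below N with nonzero constant term u(Z); it cannot vanish at all N elements
    of \<open>W\<close>.\<close>
  have "\<exists>\<omega>\<in>W. \<not> (\<forall>\<^sub>F Z in ecf. (\<Sum>i<N. \<omega> ^ i * s i Z) = 0)"
  proof (rule ccontr)
    assume "\<not> ?thesis"
    hence "\<forall>\<^sub>F Z in ecf. \<forall>\<omega>\<in>W. (\<Sum>i<N. \<omega> ^ i * s i Z) = 0"
      by (intro eventually_ball_finite[OF fW]) blast
    with RFN_nonzero[OF u(1)] have "\<forall>\<^sub>F Z in ecf. False"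
    proof eventually_elim
      case (elim Z)
      define q where "q = (\<Sum>i<N. monom (s i Z) i)"
      have q: "poly q \<omega> = (\<Sum>i<N. \<omega> ^ i * s i Z)" for \<omega>
        by (simp add: q_def poly_sum poly_monom mult.commute)
      have "coeff q 0 = s 0 Z" using N by (simp add: q_def coeff_sum sum.delta)
      hence "q \<noteq> 0" using elim s0 by auto
      have "degree q < N"
      proof -
        have "degree q \<le> N - 1" unfolding q_def
        proof (intro degree_sum_le)
          fix i assume "i \<in> {..<N}"
          thus "degree (monom (s i Z) i) \<le> N - 1" using degree_monom_le[of "s i Z" i] by simp
        qed simp
        thus ?thesis using N by simp
      qed
      moreover have "card W \<le> card {x. poly q x = 0}"
        using poly_roots_finite[OF \<open>q \<noteq> 0\<close>] elim q by (intro card_mono) auto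
      moreover have "card {x. poly q x = 0} \<le> degree q" using card_poly_roots_bound[OF \<open>q \<noteq> 0\<close>] .
      ultimately show False using cW by simp
    qed
    thus False by simp
  qed
  then obtain \<omega> where \<omega>: "\<omega> ^ N = inverse c" "\<not> (\<forall>\<^sub>F Z in ecf. (\<Sum>i<N. \<omega> ^ i * s i Z) = 0)"
    by (auto simp: W_def)
  define h where "h = (\<lambda>Z. \<Sum>i<N. \<omega> ^ i * s i Z)"
  have hL: "LN N h" unfolding h_def by (intro LN_sum LN_cmult sL)
  have hR: "h \<in> RFN" using RFN_iff LN_RF[OF hL] \<omega>(2) unfolding h_def by blast
  have w0: "\<omega> \<noteq> 0" using \<omega>(1) c(1) N by (auto simp: power_0_left)
  have "\<forall>\<^sub>F Z in ecf. f Z * h (Z +\<^sub>E (-\<^sub>E P)) = inverse \<omega> * h Z"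
    using sN
  proof eventually_elim
    case (elim Z)
    have "\<omega> * (f Z * h (Z +\<^sub>E (-\<^sub>E P))) = (\<Sum>i<N. \<omega> ^ Suc i * s (Suc i) Z)"
      unfolding h_def sS sum_distrib_left by (intro sum.cong) (simp_all add: mult_ac)
    also have "\<dots> = (\<Sum>i<Suc N. \<omega> ^ i * s i Z) - s 0 Z"
      by (subst sum.lessThan_Suc_shift) simp
    also have "\<dots> = h Z"
      using elim \<omega>(1) c(1) by (simp add: h_def s0)
    finally show ?case using w0 by (simp add: field_simps)
  qed
  moreover have "\<forall>\<^sub>F Z in ecf. \<forall>i\<in>{..<N}. g Z * s i (Z +\<^sub>E (-\<^sub>E Q)) = \<eta> * s i Z"
    using sQ by (intro eventually_ball_finite) auto
  hence "\<forall>\<^sub>F Z in ecf. g Z * h (Z +\<^sub>E (-\<^sub>E Q)) = \<eta> * h Z"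
  proof eventually_elim
    case (elim Z)
    have "g Z * h (Z +\<^sub>E (-\<^sub>E Q)) = (\<Sum>i<N. \<omega> ^ i * (g Z * s i (Z +\<^sub>E (-\<^sub>E Q))))"
      unfolding h_def sum_distrib_left by (intro sum.cong) (simp_all add: mult_ac)
    also have "\<dots> = (\<Sum>i<N. \<omega> ^ i * (\<eta> * s i Z))" using elim by (intro sum.cong) auto
    also have "\<dots> = \<eta> * h Z" unfolding h_def sum_distrib_left by (intro sum.cong) (simp_all add: mult_ac)
    finally show ?case .
  qed
  ultimately show ?thesis using that[OF hR hL, of "inverse \<omega>"] w0 by simp
qed

text \<open>
  If the operators of \<open>P\<close> and \<open>Q\<close> commute, they have a common eigenvector in the space of
  functions with a pole of order at most \<open>N\<close> at infinity only; its \<open>N\<close> zeros are stable under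
  translation by \<open>P\<close> and \<open>Q\<close>.
\<close>

theorem weil_isotropic_bound:
  assumes P: "P \<in> tors N" and Q: "Q \<in> tors N" and N: "N > 0" and e: "weil N P Q = 1"
    and A: "finite A" "A \<subseteq> {i \<cdot>\<^sub>E P +\<^sub>E j \<cdot>\<^sub>E Q | i j. True}"
  shows "card A \<le> N"
proof -
  have E: "P \<in> EC" "Q \<in> EC" using P Q tors_in_EC by auto
  obtain f g where fg: "tdiv N f P" "tdiv N g Q" using exists_tdiv P Q by metis
  \<comment> \<open>With \<open>Infinity\<close>, the constant function 1 and eigenvalue 1 as second
    data, only the eigenvector equation for Q remains.\<close>
  obtain h1 \<eta> where h1: "h1 \<in> RFN" "LN N h1" "\<eta> \<noteq> 0" "\<forall>\<^sub>F Z in ecf. g Z * h1 (Z +\<^sub>E (-\<^sub>E Q)) = \<eta> * h1 Z"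
    by (rule theta_eigenvector[OF fg(2) Q N, of "\<lambda>_. 1" Infinity "\<lambda>_. 1" 1])
       (auto simp: RFN_const LN_const)
  have comm: "\<forall>\<^sub>F Z in ecf. f Z * g (Z +\<^sub>E (-\<^sub>E P)) = g Z * f (Z +\<^sub>E (-\<^sub>E Q))"
    using weil_spec(2)[OF E fg] e by simp
  obtain h \<mu> where h: "h \<in> RFN" "LN N h" "\<mu> \<noteq> 0" "\<forall>\<^sub>F Z in ecf. f Z * h (Z +\<^sub>E (-\<^sub>E P)) = \<mu> * h Z"
    "\<forall>\<^sub>F Z in ecf. g Z * h (Z +\<^sub>E (-\<^sub>E Q)) = \<eta> * h Z"
    by (rule theta_eigenvector[OF fg(1) P N h1(1,2) E(2) comm h1(4)])
  \<comment> \<open>The divisor of h as an element of L(N(\<infinity>)): effective and of degree N.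
    The eigenvector equations make it invariant under translation by P and Q.\<close>
  define D where "D = (\<lambda>X. dv h X + int N * of_bool (X = Infinity))"
  have D0: "D X \<ge> 0" if "X \<in> EC" for X using LN_dv[OF h(2,1) that] by (simp add: D_def)
  have Dinv: "D (X +\<^sub>E R) = D X" if "tdiv N k R" "R \<in> EC" "\<kappa> \<noteq> 0"
    "\<forall>\<^sub>F Z in ecf. k Z * h (Z +\<^sub>E (-\<^sub>E R)) = \<kappa> * h Z" "X \<in> EC" for k R \<kappa> X
  proof -
    have "D Y = D (Y +\<^sub>E (-\<^sub>E R))" if Y: "Y \<in> EC" for Y
    proof -
      have T: "(\<lambda>Z. h (Z +\<^sub>E (-\<^sub>E R))) \<in> RFN" using \<open>R \<in> EC\<close> by (intro RFN_translate h) auto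
      have "dv k Y + dv h (Y +\<^sub>E (-\<^sub>E R)) = dv h Y"
        using dv_cong[OF RFN_mult(1)[OF tdiv_RFN[OF \<open>tdiv N k R\<close>] T] \<open>\<forall>\<^sub>F Z in ecf. k Z * h (Z +\<^sub>E (-\<^sub>E R)) = \<kappa> * h Z\<close> Y]
          dv_mult[OF tdiv_RFN[OF \<open>tdiv N k R\<close>] T Y] dv_translate[OF h(1) Y, of "-\<^sub>E R"]
          dv_cmult[OF h(1) \<open>\<kappa> \<noteq> 0\<close> Y] \<open>R \<in> EC\<close> by simp
      moreover have "Y +\<^sub>E (-\<^sub>E R) = Infinity \<longleftrightarrow> Y = R"
        using padd_pneg_eq_iff[of Y R Infinity] Y \<open>R \<in> EC\<close> by simp
      moreover have "dv k Y = int N * (of_bool (Y = R) - of_bool (Y = Infinity))"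
        using \<open>tdiv N k R\<close> Y unfolding tdiv_def by blast
      ultimately show ?thesis unfolding D_def by (simp only: ring_distribs)
    qed
    from this[of "X +\<^sub>E R"] show ?thesis using that padd_cancel by simp
  qed
  have DP: "D (X +\<^sub>E P) = D X" if "X \<in> EC" for X
    by (rule Dinv[OF fg(1) E(1) h(3,4) that])
  have DQ: "D (X +\<^sub>E Q) = D X" if "X \<in> EC" for X
    by (rule Dinv[OF fg(2) E(2) h1(3) h(5) that])
  have DiP: "D (X +\<^sub>E i \<cdot>\<^sub>E P) = D X" if "X \<in> EC" for X i
    by (induction i) (use that E DP in \<open>simp_all flip: padd_assoc\<close>)
  have DjQ: "D (X +\<^sub>E j \<cdot>\<^sub>E Q) = D X" if "X \<in> EC" for X j
    by (induction j) (use that E DQ in \<open>simp_all flip: padd_assoc\<close>)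
  \<comment> \<open>If \<open>D\<close> were zero, h would have an N-fold pole at infinity and no
    zero to balance it.\<close>
  have "\<exists>X\<in>EC. D X > 0"
  proof (rule ccontr)
    assume "\<not> ?thesis"
    hence z: "D X = 0" if "X \<in> EC" for X using D0[OF that] that by force
    hence "dv h Infinity < 0" using z[of Infinity] N by (simp add: D_def)
    then obtain Y where "Y \<in> EC" "dv h Y > 0" using dv_pos_exists[OF h(1) Infinity_in_EC] by blast
    thus False using z[of Y] by (simp add: D_def of_bool_def split: if_splits)
  qed
  then obtain X where X: "X \<in> EC" "D X > 0" by blast
  have AE: "A \<subseteq> EC" using A(2) E by auto
  \<comment> \<open>The translates of X by A are distinct, and \<open>D\<close> is at least 1 on
    each; the degree N of \<open>D\<close> bounds their number.\<close>
  define B where "B = (\<lambda>Y. X +\<^sub>E Y) ` A"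
  have B: "finite B" "B \<subseteq> EC" using A(1) AE X by (auto simp: B_def)
  have "inj_on (\<lambda>Y. X +\<^sub>E Y) A"
  proof (rule inj_onI)
    fix Y Y' assume "Y \<in> A" "Y' \<in> A" "X +\<^sub>E Y = X +\<^sub>E Y'"
    thus "Y = Y'" using EG.l_cancel[of X Y Y'] AE X by auto
  qed
  hence cB: "card B = card A" by (simp add: B_def card_image)
  have DB: "D Y \<ge> 1" if Y: "Y \<in> B" for Y
  proof -
    from Y A(2) obtain i j where "Y = X +\<^sub>E (i \<cdot>\<^sub>E P +\<^sub>E j \<cdot>\<^sub>E Q)" unfolding B_def by auto
    hence "D Y = D X" using DiP[OF X(1), of i] DjQ[of "X +\<^sub>E i \<cdot>\<^sub>E P" j] X E by (simp flip: padd_assoc)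
    thus ?thesis using X by simp
  qed
  let ?C = "insert Infinity B"
  have "dv h Y \<ge> 0" if "Y \<in> EC - ?C" for Y using D0[of Y] that by (simp add: D_def)
  hence "(\<Sum>Y\<in>?C. dv h Y) \<le> 0" using B by (intro dv_sum_bound[OF h(1)]) auto
  moreover have "(\<Sum>Y\<in>?C. dv h Y) = (\<Sum>Y\<in>?C. D Y) - (\<Sum>Y\<in>?C. int N * of_bool (Y = Infinity))"
    by (simp add: D_def sum.distrib)
  moreover have "(\<Sum>Y\<in>?C. int N * of_bool (Y = Infinity)) = int N"
    using B by (simp add: sum.delta of_bool_def if_distrib cong: if_cong)
  moreover have "(\<Sum>Y\<in>B. 1) \<le> (\<Sum>Y\<in>?C. D Y)"
  proof -
    have "(\<Sum>Y\<in>B. 1) \<le> (\<Sum>Y\<in>B. D Y)" using DB by (intro sum_mono) auto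
    also have "\<dots> \<le> (\<Sum>Y\<in>?C. D Y)" using B D0 by (intro sum_mono2) auto
    finally show ?thesis .
  qed
  ultimately show ?thesis using cB by simp
qed

end

section \<open>The number of torsion points\<close>

text \<open>The group law of the cuspidal cubic y^2 = x^3, the limit of the curve at infinity: its
  points are (1/t^2, 1/t^3) with t additive, and \<kappa> is the slope of the chord through the
  parameters t and 1.\<close>

lemma multiplication_limit_identities:
  fixes t :: "'a :: field"
  assumes "t \<noteq> 0" "t + 1 \<noteq> 0" "t\<^sup>2 \<noteq> 1"
  defines "\<kappa> \<equiv> (1 - 1 / t ^ 3) / (1 - 1 / t\<^sup>2)"
  shows "\<kappa>\<^sup>2 - 1 / t\<^sup>2 - 1 = 1 / (t + 1)\<^sup>2"
    and "- (\<kappa> * (1 / (t + 1)\<^sup>2 - 1 / t\<^sup>2) + 1 / t ^ 3) = 1 / (t + 1) ^ 3"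
proof -
  have t2: "t\<^sup>2 - 1 \<noteq> 0" using assms by simp
  have "1 - 1 / t ^ 3 = (t ^ 3 - 1) / t ^ 3" "1 - 1 / t\<^sup>2 = (t\<^sup>2 - 1) / t\<^sup>2"
    using assms(1) by (simp_all add: field_simps)
  hence "\<kappa> = (t ^ 3 - 1) * t\<^sup>2 / (t ^ 3 * (t\<^sup>2 - 1))" by (simp add: \<kappa>_def)
  also have "\<dots> = ((t - 1) * t\<^sup>2 * (t\<^sup>2 + t + 1)) / ((t - 1) * t\<^sup>2 * (t * (t + 1)))"
    by (rule arg_cong2[of _ _ _ _ "(/)"]) (simp_all add: algebra_simps power2_eq_square power3_eq_cube)
  also have "\<dots> = (t\<^sup>2 + t + 1) / (t * (t + 1))"
  proof -
    have "t - 1 \<noteq> 0" using assms(3) by auto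
    hence "(t - 1) * t\<^sup>2 \<noteq> 0" using assms(1) by simp
    thus ?thesis by (rule mult_divide_mult_cancel_left)
  qed
  finally have \<kappa>: "\<kappa> = (t\<^sup>2 + t + 1) / (t * (t + 1))" .
  have "\<kappa>\<^sup>2 - 1 / t\<^sup>2 - 1 = ((t\<^sup>2 + t + 1)\<^sup>2 - (t + 1)\<^sup>2 - t\<^sup>2 * (t + 1)\<^sup>2) / (t\<^sup>2 * (t + 1)\<^sup>2)"
    using assms(1,2) unfolding \<kappa> by (simp add: power_divide power_mult_distrib diff_divide_distrib)
  also have "(t\<^sup>2 + t + 1)\<^sup>2 - (t + 1)\<^sup>2 - t\<^sup>2 * (t + 1)\<^sup>2 = t\<^sup>2"
    by (simp add: algebra_simps power2_eq_square)
  finally show "\<kappa>\<^sup>2 - 1 / t\<^sup>2 - 1 = 1 / (t + 1)\<^sup>2" using assms(1) by simp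
  have d: "1 / (t + 1)\<^sup>2 - 1 / t\<^sup>2 = (t\<^sup>2 - (t + 1)\<^sup>2) / (t\<^sup>2 * (t + 1)\<^sup>2)"
    using assms(1,2) by (simp add: field_simps)
  have "- (\<kappa> * (1 / (t + 1)\<^sup>2 - 1 / t\<^sup>2) + 1 / t ^ 3)
     = (- ((t\<^sup>2 + t + 1) * (t\<^sup>2 - (t + 1)\<^sup>2)) - (t + 1) ^ 3) / (t ^ 3 * (t + 1) ^ 3)"
  proof -
    have "\<kappa> * (1 / (t + 1)\<^sup>2 - 1 / t\<^sup>2) = ((t\<^sup>2 + t + 1) * (t\<^sup>2 - (t + 1)\<^sup>2)) / (t ^ 3 * (t + 1) ^ 3)"
      unfolding d \<kappa> by (simp add: power2_eq_square power3_eq_cube mult_ac)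
    moreover have "1 / t ^ 3 = (t + 1) ^ 3 / (t ^ 3 * (t + 1) ^ 3)" using assms(2) by simp
    ultimately show ?thesis by (simp only: add_divide_distrib diff_divide_distrib minus_divide_left minus_add_distrib) simp
  qed
  also have "- ((t\<^sup>2 + t + 1) * (t\<^sup>2 - (t + 1)\<^sup>2)) - (t + 1) ^ 3 = t ^ 3"
    by (simp add: algebra_simps power2_eq_square power3_eq_cube)
  finally show "- (\<kappa> * (1 / (t + 1)\<^sup>2 - 1 / t\<^sup>2) + 1 / t ^ 3) = 1 / (t + 1) ^ 3" using assms(1) by simp
qed

context monic_cubic_curve
begin

section \<open>Asymptotics of multiplication by m at infinity\<close>

lemma lim_inverse_xc: "lim_inf (\<lambda>Z. inverse (xc Z)) 0"
  using RFN_inverse[OF RFN_xc(1)] RFN_xc(2)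
  by (simp add: lim_inf_0 ord_ge_def RFN_imp_RF)

lemma lim_yc2_xc3: "lim_inf (\<lambda>Z. (yc Z)\<^sup>2 / xc Z ^ 3) 1"
proof -
  have "lim_inf (\<lambda>Z. 1 + c2 * inverse (xc Z) + c1 * inverse (xc Z) ^ 2 + c0 * inverse (xc Z) ^ 3)
      (1 + c2 * 0 + c1 * 0 ^ 2 + c0 * 0 ^ 3)"
    by (intro lim_inf_intros lim_inverse_xc)
  moreover have "\<forall>\<^sub>F Z in ecf. 1 + c2 * inverse (xc Z) + c1 * inverse (xc Z) ^ 2 + c0 * inverse (xc Z) ^ 3 = (yc Z)\<^sup>2 / xc Z ^ 3"
    using RFN_nonzero[OF RFN_xc(1)] eventually_ecf_neq[of Infinity]
  proof eventually_elim
    case (elim Z)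
    from elim(2) obtain x y where Z: "Z = Affine x y" "y\<^sup>2 = cf x" using EC_E by metis
    have "x \<noteq> 0" using elim Z by simp
    thus ?case unfolding Z(1) xc.simps yc.simps Z(2) cf_def
      by (simp add: field_simps power2_eq_square power3_eq_cube)
  qed
  ultimately show ?thesis using lim_inf_cong by simp
qed

lemma lim_cf'_xc2: "lim_inf (\<lambda>Z. cf' (xc Z) / (xc Z)\<^sup>2) 3"
proof -
  have "lim_inf (\<lambda>Z. 3 + 2 * c2 * inverse (xc Z) + c1 * inverse (xc Z) ^ 2)
      (3 + 2 * c2 * 0 + c1 * 0 ^ 2)"
    by (intro lim_inf_intros lim_inverse_xc)
  moreover have "\<forall>\<^sub>F Z in ecf. 3 + 2 * c2 * inverse (xc Z) + c1 * inverse (xc Z) ^ 2 = cf' (xc Z) / (xc Z)\<^sup>2"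
    using RFN_nonzero[OF RFN_xc(1)]
    by eventually_elim (simp add: cf'_def field_simps power2_eq_square)
  ultimately show ?thesis using lim_inf_cong by simp
qed

text \<open>
  To first order at infinity, multiplication by \<open>m\<close> scales the local parameter \<open>x / y\<close> by \<open>m\<close>, while
  \<open>x\<close> and \<open>y\<close> have poles of order two and three.
\<close>

definition mult_lim :: "nat \<Rightarrow> bool" where
  "mult_lim m \<longleftrightarrow> (\<forall>\<^sub>F Z in ecf. m \<cdot>\<^sub>E Z \<noteq> Infinity) \<and>
     lim_inf (\<lambda>Z. xc (m \<cdot>\<^sub>E Z) / xc Z) (1 / of_nat m ^ 2) \<and>
     lim_inf (\<lambda>Z. yc (m \<cdot>\<^sub>E Z) / yc Z) (1 / of_nat m ^ 3)"

lemma mult_lim_1: "mult_lim 1"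
proof -
  have "\<forall>\<^sub>F Z in ecf. 1 \<cdot>\<^sub>E Z \<noteq> Infinity"
    using eventually_ecf_neq[of Infinity] by eventually_elim simp
  moreover have "\<forall>\<^sub>F Z in ecf. 1 = xc (1 \<cdot>\<^sub>E Z) / xc Z"
    using eventually_ecf_neq[of Infinity] RFN_nonzero[OF RFN_xc(1)] by eventually_elim simp
  moreover have "\<forall>\<^sub>F Z in ecf. 1 = yc (1 \<cdot>\<^sub>E Z) / yc Z"
    using eventually_ecf_neq[of Infinity] RFN_nonzero[OF RFN_yc(1)] by eventually_elim simp
  ultimately show ?thesis
    unfolding mult_lim_def using lim_inf_cong[OF lim_inf_const[of 1]] by simp
qed

text \<open>The chord step from m to m + 1 divides by 1 - 1/m^2, which is 0 at m = 1; doubling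
  therefore uses the tangent. There 3/2 is the limit of the normalised slope l x / y, because
  \<open>cf' x\<close> grows like 3 x^2 and y^2 like x^3.\<close>

lemma mult_lim_2: "mult_lim 2"
proof -
  define k where "k = (\<lambda>Z. (cf' (xc Z) / (xc Z)\<^sup>2) / (2 * ((yc Z)\<^sup>2 / xc Z ^ 3)))"
  define \<alpha> where "\<alpha> = (\<lambda>Z. (k Z)\<^sup>2 * ((yc Z)\<^sup>2 / xc Z ^ 3) - c2 * inverse (xc Z) - 2)"
  define \<beta> where "\<beta> = (\<lambda>Z. - (k Z * (\<alpha> Z - 1) + 1))"
  have e: "\<forall>\<^sub>F Z in ecf. 2 \<cdot>\<^sub>E Z \<noteq> Infinity \<and> \<alpha> Z = xc (2 \<cdot>\<^sub>E Z) / xc Z \<and> \<beta> Z = yc (2 \<cdot>\<^sub>E Z) / yc Z"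
    using RFN_nonzero[OF RFN_xc(1)] RFN_nonzero[OF RFN_yc(1)] eventually_ecf_neq[of Infinity]
  proof eventually_elim
    case (elim Z)
    from elim(3) obtain x y where Z: "Z = Affine x y" "y\<^sup>2 = cf x" using EC_E by metis
    have nz: "x \<noteq> 0" "y \<noteq> 0" using elim Z by auto
    define l where "l = cf' x / (2 * y)"
    have "2 \<cdot>\<^sub>E Z = Z +\<^sub>E Z" using elim(3) by (simp add: numeral_2_eq_2)
    also have "\<dots> = Affine (l\<^sup>2 - c2 - x - x) (- (l * ((l\<^sup>2 - c2 - x - x) - x) + y))"
      unfolding Z(1) using nz by (simp add: padd.simps(3) Let_def l_def flip: mult_2)
    finally have sum: "2 \<cdot>\<^sub>E Z = Affine (l\<^sup>2 - c2 - x - x) (- (l * ((l\<^sup>2 - c2 - x - x) - x) + y))" .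
    have k: "k Z = l * x / y"
      unfolding k_def Z(1) using nz by (simp add: l_def power2_eq_square power3_eq_cube field_simps)
    have a: "\<alpha> Z = (l\<^sup>2 - c2 - x - x) / x"
      unfolding \<alpha>_def k unfolding Z(1) using nz by (simp add: power2_eq_square power3_eq_cube field_simps)
    have b: "\<beta> Z = (- (l * ((l\<^sup>2 - c2 - x - x) - x) + y)) / y"
      unfolding \<beta>_def k a using nz by (simp add: field_simps)
    show ?case unfolding sum a b by (simp add: Z(1))
  qed
  have "lim_inf k (3 / (2 * 1))" unfolding k_def
    by (intro lim_inf_intros lim_cf'_xc2 lim_yc2_xc3) simp
  hence k: "lim_inf k (3 / 2)" by simp
  have "lim_inf \<alpha> ((3 / 2)\<^sup>2 * 1 - c2 * 0 - 2)" unfolding \<alpha>_def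
    by (intro lim_inf_intros lim_yc2_xc3 lim_inverse_xc k)
  moreover have "(3 / 2)\<^sup>2 * 1 - c2 * 0 - 2 = (1 / 4 :: 'a)" by (simp add: power2_eq_square field_simps)
  ultimately have a: "lim_inf \<alpha> (1 / 4)" by (simp only:)
  have "lim_inf \<beta> (- (3 / 2 * (1 / 4 - 1) + 1))" unfolding \<beta>_def
    by (intro lim_inf_intros k a)
  moreover have "- (3 / 2 * (1 / 4 - 1) + 1) = (1 / 8 :: 'a)" by (simp add: field_simps)
  ultimately have b: "lim_inf \<beta> (1 / 8)" by (simp only:)
  have "\<forall>\<^sub>F Z in ecf. 2 \<cdot>\<^sub>E Z \<noteq> Infinity" using e by eventually_elim blast
  moreover have "\<forall>\<^sub>F Z in ecf. \<alpha> Z = xc (2 \<cdot>\<^sub>E Z) / xc Z" using e by eventually_elim blast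
  moreover have "\<forall>\<^sub>F Z in ecf. \<beta> Z = yc (2 \<cdot>\<^sub>E Z) / yc Z" using e by eventually_elim blast
  ultimately show ?thesis unfolding mult_lim_def
    using lim_inf_cong[OF a] lim_inf_cong[OF b] by simp
qed

text \<open>Dividing abscissae by x and ordinates by y writes the addition law in quantities that
  have limits at infinity. The lower coefficients of the cubic disappear in the limit, and the
  cuspidal identities remain.\<close>

lemma mult_lim_Suc:
  assumes "mult_lim m" "m \<ge> 2"
  shows "mult_lim (Suc m)"
proof -
  define t where "t = (of_nat m :: 'a)"
  have t: "t \<noteq> 0" "t + 1 \<noteq> 0" "t\<^sup>2 \<noteq> 1"
  proof -
    show "t \<noteq> 0" using assms(2) by (simp add: t_def)
    have "t + 1 = of_nat (Suc m)" by (simp add: t_def)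
    thus "t + 1 \<noteq> 0" by (simp only: of_nat_eq_0_iff)
    have "t\<^sup>2 = of_nat (m\<^sup>2)" by (simp add: t_def)
    moreover have "m\<^sup>2 \<noteq> 1" using assms(2) by simp
    ultimately show "t\<^sup>2 \<noteq> 1" by (metis of_nat_1 of_nat_eq_iff)
  qed
  define \<alpha>0 where "\<alpha>0 = (\<lambda>Z. xc (m \<cdot>\<^sub>E Z) / xc Z)"
  define \<beta>0 where "\<beta>0 = (\<lambda>Z. yc (m \<cdot>\<^sub>E Z) / yc Z)"
  have a0: "lim_inf \<alpha>0 (1 / t\<^sup>2)" and b0: "lim_inf \<beta>0 (1 / t ^ 3)"
    using assms(1) by (simp_all add: mult_lim_def \<alpha>0_def \<beta>0_def t_def)
  define \<kappa> where "\<kappa> = (1 - 1 / t ^ 3) / (1 - 1 / t\<^sup>2)"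
  define k where "k = (\<lambda>Z. (1 - \<beta>0 Z) / (1 - \<alpha>0 Z))"
  define \<alpha> where "\<alpha> = (\<lambda>Z. (k Z)\<^sup>2 * ((yc Z)\<^sup>2 / xc Z ^ 3) - c2 * inverse (xc Z) - \<alpha>0 Z - 1)"
  define \<beta> where "\<beta> = (\<lambda>Z. - (k Z * (\<alpha> Z - \<alpha>0 Z) + \<beta>0 Z))"
  have nz1: "1 - 1 / t\<^sup>2 \<noteq> 0" using t by simp
  \<comment> \<open>The limit is nonzero as m is at least 2. Hence mZ and Z have different abscissae
    for almost all Z, which puts their sum in the chord case.\<close>
  have al: "lim_inf (\<lambda>Z. 1 - \<alpha>0 Z) (1 - 1 / t\<^sup>2)" by (intro lim_inf_intros a0)
  have k: "lim_inf k \<kappa>" unfolding k_def \<kappa>_def by (intro lim_inf_intros a0 b0 nz1)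
  have "lim_inf \<alpha> (\<kappa>\<^sup>2 * 1 - c2 * 0 - 1 / t\<^sup>2 - 1)" unfolding \<alpha>_def
    by (intro lim_inf_intros k a0 lim_yc2_xc3 lim_inverse_xc)
  hence a: "lim_inf \<alpha> (1 / (t + 1)\<^sup>2)"
    using multiplication_limit_identities(1)[OF t] by (simp add: \<kappa>_def)
  have "lim_inf \<beta> (- (\<kappa> * (1 / (t + 1)\<^sup>2 - 1 / t\<^sup>2) + 1 / t ^ 3))" unfolding \<beta>_def
    by (intro lim_inf_intros k a a0 b0)
  hence b: "lim_inf \<beta> (1 / (t + 1) ^ 3)"
    using multiplication_limit_identities(2)[OF t] by (simp add: \<kappa>_def)
  have mZ: "\<forall>\<^sub>F Z in ecf. m \<cdot>\<^sub>E Z \<noteq> Infinity" using assms(1) by (simp add: mult_lim_def)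
  have e: "\<forall>\<^sub>F Z in ecf. Suc m \<cdot>\<^sub>E Z \<noteq> Infinity \<and> \<alpha> Z = xc (Suc m \<cdot>\<^sub>E Z) / xc Z \<and> \<beta> Z = yc (Suc m \<cdot>\<^sub>E Z) / yc Z"
    using RFN_nonzero[OF RFN_xc(1)] RFN_nonzero[OF RFN_yc(1)] eventually_ecf_neq[of Infinity] mZ
      RFN_nonzero[OF lim_inf_RFN(1)[OF al nz1]]
  proof eventually_elim
    case (elim Z)
    from elim(3) obtain x y where Z: "Z = Affine x y" "y\<^sup>2 = cf x" using EC_E by metis
    have "m \<cdot>\<^sub>E Z \<in> EC" using elim(3) by simp
    from EC_E[OF this elim(4)] obtain x1 y1 where W: "m \<cdot>\<^sub>E Z = Affine x1 y1" by metis
    have nz: "x \<noteq> 0" "y \<noteq> 0" using elim Z by auto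
    have a0: "\<alpha>0 Z = x1 / x" and b0: "\<beta>0 Z = y1 / y" unfolding \<alpha>0_def \<beta>0_def W by (simp_all add: Z)
    have ne: "x1 \<noteq> x" using elim(5) nz a0 by auto
    define l where "l = (y - y1) / (x - x1)"
    have "Suc m \<cdot>\<^sub>E Z = Affine x1 y1 +\<^sub>E Affine x y" unfolding smul_Suc W by (simp add: Z(1))
    also have "\<dots> = Affine (l\<^sup>2 - c2 - x1 - x) (- (l * ((l\<^sup>2 - c2 - x1 - x) - x1) + y1))"
      using ne by (simp add: padd.simps(3) Let_def l_def)
    finally have sum: "Suc m \<cdot>\<^sub>E Z = Affine (l\<^sup>2 - c2 - x1 - x) (- (l * ((l\<^sup>2 - c2 - x1 - x) - x1) + y1))" .
    have "k Z = ((y - y1) / y) / ((x - x1) / x)"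
      unfolding k_def a0 b0 using nz by (simp add: diff_divide_distrib)
    hence k: "k Z = l * x / y" by (simp add: l_def)
    have a: "\<alpha> Z = (l\<^sup>2 - c2 - x1 - x) / x"
      unfolding \<alpha>_def k a0 unfolding Z(1) using nz by (simp add: power2_eq_square power3_eq_cube field_simps)
    have b: "\<beta> Z = (- (l * ((l\<^sup>2 - c2 - x1 - x) - x1) + y1)) / y"
      unfolding \<beta>_def k a a0 b0 using nz by (simp add: field_simps)
    show ?case unfolding sum a b by (simp add: Z(1))
  qed
  have "\<forall>\<^sub>F Z in ecf. Suc m \<cdot>\<^sub>E Z \<noteq> Infinity" using e by eventually_elim blast
  moreover have "\<forall>\<^sub>F Z in ecf. \<alpha> Z = xc (Suc m \<cdot>\<^sub>E Z) / xc Z" using e by eventually_elim blast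
  moreover have "\<forall>\<^sub>F Z in ecf. \<beta> Z = yc (Suc m \<cdot>\<^sub>E Z) / yc Z" using e by eventually_elim blast
  moreover have "t + 1 = of_nat (Suc m)" by (simp add: t_def)
  ultimately show ?thesis unfolding mult_lim_def
    using lim_inf_cong[OF a] lim_inf_cong[OF b] by (simp only: simp_thms)
qed

lemma mult_lim: "m \<ge> 1 \<Longrightarrow> mult_lim m"
proof (induction m rule: less_induct)
  case (less m)
  show ?case
  proof (cases "m \<ge> 3")
    case True
    then obtain n where "m = Suc n" "n \<ge> 2" by (cases m) auto
    thus ?thesis using less mult_lim_Suc by auto
  next
    case False
    hence "m = 1 \<or> m = 2" using less by auto
    thus ?thesis using mult_lim_1 mult_lim_2 by blast
  qed
qed

section \<open>Multiplication by m preserves orders\<close>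

lemma RFN_xc_smul:
  assumes "m \<ge> 1"
  shows "(\<lambda>Z. xc (m \<cdot>\<^sub>E Z)) \<in> RFN" "ord (\<lambda>Z. xc (m \<cdot>\<^sub>E Z)) = - 2"
    "(\<lambda>Z. yc (m \<cdot>\<^sub>E Z)) \<in> RFN" "ord (\<lambda>Z. yc (m \<cdot>\<^sub>E Z)) = - 3"
proof -
  have L: "lim_inf (\<lambda>Z. xc (m \<cdot>\<^sub>E Z) / xc Z) (1 / of_nat m ^ 2)"
    "lim_inf (\<lambda>Z. yc (m \<cdot>\<^sub>E Z) / yc Z) (1 / of_nat m ^ 3)"
    using mult_lim[OF assms] by (simp_all add: mult_lim_def)
  have nz: "1 / of_nat m ^ 2 \<noteq> (0 :: 'a)" "1 / of_nat m ^ 3 \<noteq> (0 :: 'a)" using assms by auto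
  note X = lim_inf_RFN[OF L(1) nz(1)] and Y = lim_inf_RFN[OF L(2) nz(2)]
  have ex: "\<forall>\<^sub>F Z in ecf. xc (m \<cdot>\<^sub>E Z) / xc Z * xc Z = xc (m \<cdot>\<^sub>E Z)"
    using RFN_nonzero[OF RFN_xc(1)] by eventually_elim simp
  have ey: "\<forall>\<^sub>F Z in ecf. yc (m \<cdot>\<^sub>E Z) / yc Z * yc Z = yc (m \<cdot>\<^sub>E Z)"
    using RFN_nonzero[OF RFN_yc(1)] by eventually_elim simp
  show "(\<lambda>Z. xc (m \<cdot>\<^sub>E Z)) \<in> RFN" by (rule RFN_cong[OF RFN_mult(1)[OF X(1) RFN_xc(1)] ex])
  show "ord (\<lambda>Z. xc (m \<cdot>\<^sub>E Z)) = - 2"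
    using ord_cong[OF RFN_mult(1)[OF X(1) RFN_xc(1)] ex] RFN_mult(2)[OF X(1) RFN_xc(1)] X(2) RFN_xc(2) by simp
  show "(\<lambda>Z. yc (m \<cdot>\<^sub>E Z)) \<in> RFN" by (rule RFN_cong[OF RFN_mult(1)[OF Y(1) RFN_yc(1)] ey])
  show "ord (\<lambda>Z. yc (m \<cdot>\<^sub>E Z)) = - 3"
    using ord_cong[OF RFN_mult(1)[OF Y(1) RFN_yc(1)] ey] RFN_mult(2)[OF Y(1) RFN_yc(1)] Y(2) RFN_yc(2) by simp
qed

text \<open>Fibres of multiplication are finite: x(mZ) - r still has its pole at infinity, so it is
  a nonzero function with finitely many zeros.\<close>

lemma eventually_smul:
  assumes "m \<ge> 1" "\<forall>\<^sub>F Z in ecf. \<Phi> Z"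
  shows "\<forall>\<^sub>F Z in ecf. \<Phi> (m \<cdot>\<^sub>E Z)"
proof -
  define B where "B = {P \<in> EC. \<not> \<Phi> P}"
  have "finite B" using assms(2) by (simp add: eventually_ecf B_def)
  have "\<forall>\<^sub>F Z in ecf. m \<cdot>\<^sub>E Z \<noteq> R" for R
  proof (cases R)
    case Infinity
    thus ?thesis using mult_lim[OF assms(1)] by (simp add: mult_lim_def)
  next
    case (Affine r s)
    have "(\<lambda>Z. xc (m \<cdot>\<^sub>E Z) + - r) \<in> RFN"
      using RFN_xc_smul(1,2)[OF assms(1)] by (intro ord_add_dominant ord_ge_mono[OF ord_ge_const]) auto
    from RFN_nonzero[OF this] show ?thesis
      by eventually_elim (auto simp: Affine)
  qed
  hence "\<forall>\<^sub>F Z in ecf. \<forall>R\<in>B. m \<cdot>\<^sub>E Z \<noteq> R" by (intro eventually_ball_finite[OF \<open>finite B\<close>] ballI)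
  with eventually_ecf_neq[of Infinity] show ?thesis
  proof eventually_elim
    case (elim Z)
    have "m \<cdot>\<^sub>E Z \<in> EC" using elim(1) by simp
    thus ?case using elim(2) unfolding B_def by blast
  qed
qed

lemma RFN_poly_of:
  assumes "\<psi> \<in> RFN" "ord \<psi> < 0" "p \<noteq> 0"
  shows "(\<lambda>Z. poly p (\<psi> Z)) \<in> RFN \<and> ord (\<lambda>Z. poly p (\<psi> Z)) = int (degree p) * ord \<psi>"
  using assms(3)
proof (induction p)
  case (pCons c q)
  show ?case
  proof (cases "q = 0")
    case True
    thus ?thesis using pCons RFN_const[of c] by simp
  next
    case False
    hence IH: "(\<lambda>Z. poly q (\<psi> Z)) \<in> RFN" "ord (\<lambda>Z. poly q (\<psi> Z)) = int (degree q) * ord \<psi>"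
      using pCons by auto
    note M = RFN_mult[OF assms(1) IH(1)]
    have o: "ord (\<lambda>Z. \<psi> Z * poly q (\<psi> Z)) = int (degree (pCons c q)) * ord \<psi>"
      using M(2) IH(2) False by (simp add: algebra_simps)
    have "int (degree (pCons c q)) * ord \<psi> < 0" using assms(2) False by (simp add: mult_pos_neg)
    hence "ord_ge (\<lambda>_. c) (ord (\<lambda>Z. \<psi> Z * poly q (\<psi> Z)) + 1)"
      using o by (intro ord_ge_mono[OF ord_ge_const]) auto
    from ord_add_dominant[OF M(1) this] o show ?thesis by (simp add: add.commute)
  qed
qed simp

text \<open>x(mZ) and y(mZ) have poles of order exactly two and three, as x and y do, so by parity
  the order of a(x) + b(x) y is computed from a and b by the same formula: multiplication by m is
  unramified at infinity.\<close>

lemma RFN_smul: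
  assumes m: "m \<ge> 1" and "\<phi> \<in> RFN"
  shows "(\<lambda>Z. \<phi> (m \<cdot>\<^sub>E Z)) \<in> RFN" "ord (\<lambda>Z. \<phi> (m \<cdot>\<^sub>E Z)) = ord \<phi>"
proof -
  note X = RFN_xc_smul(1,2)[OF m] and Y = RFN_xc_smul(3,4)[OF m]
  from assms(2) obtain a b d where r: "rep \<phi> a b d" "a \<noteq> 0 \<or> b \<noteq> 0" by (rule RFN_E)
  have d: "d \<noteq> 0" and e: "\<forall>\<^sub>F P in ecf. \<phi> P * poly d (xc P) = evp a b P" using r by (auto simp: rep_def)
  have P: "(\<lambda>Z. poly p (xc (m \<cdot>\<^sub>E Z))) \<in> RFN" "ord (\<lambda>Z. poly p (xc (m \<cdot>\<^sub>E Z))) = - 2 * int (degree p)"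
    if "p \<noteq> 0" for p
    using RFN_poly_of[OF X(1) _ that] X(2) by auto
  have N: "(\<lambda>Z. evp a b (m \<cdot>\<^sub>E Z)) \<in> RFN \<and> ord (\<lambda>Z. evp a b (m \<cdot>\<^sub>E Z)) = - int (degree (nrm a b))"
  proof (cases "a = 0 \<or> b = 0")
    case True
    show ?thesis
    proof (cases "a = 0")
      case a: True
      hence "b \<noteq> 0" using r by simp
      from RFN_mult[OF P(1)[OF this] Y(1)] P(2)[OF this] Y(2) this a show ?thesis
        by (simp add: evp_def degree_nrm)
    next
      case False
      thus ?thesis using P[of a] True by (simp add: evp_def degree_nrm)
    qed
  next
    case False
    hence ab: "a \<noteq> 0" "b \<noteq> 0" by auto
    note A = P[OF ab(1)]
    have B: "(\<lambda>Z. poly b (xc (m \<cdot>\<^sub>E Z)) * yc (m \<cdot>\<^sub>E Z)) \<in> RFN"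
      "ord (\<lambda>Z. poly b (xc (m \<cdot>\<^sub>E Z)) * yc (m \<cdot>\<^sub>E Z)) = - 2 * int (degree b) - 3"
      using RFN_mult[OF P(1)[OF ab(2)] Y(1)] P(2)[OF ab(2)] Y(2) by simp_all
    have ne: "2 * degree a \<noteq> 2 * degree b + 3" by presburger
    show ?thesis
    proof (cases "2 * degree a < 2 * degree b + 3")
      case True
      hence "ord_ge (\<lambda>Z. poly a (xc (m \<cdot>\<^sub>E Z))) (ord (\<lambda>Z. poly b (xc (m \<cdot>\<^sub>E Z)) * yc (m \<cdot>\<^sub>E Z)) + 1)"
        using A B RFN_imp_RF[OF A(1)] by (simp add: ord_ge_def)
      from ord_add_dominant[OF B(1) this] B(2) True ab show ?thesis
        by (simp add: evp_def degree_nrm add.commute)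
    next
      case F: False
      hence "ord_ge (\<lambda>Z. poly b (xc (m \<cdot>\<^sub>E Z)) * yc (m \<cdot>\<^sub>E Z)) (ord (\<lambda>Z. poly a (xc (m \<cdot>\<^sub>E Z))) + 1)"
        using A B RFN_imp_RF[OF B(1)] ne by (simp add: ord_ge_def)
      from ord_add_dominant[OF A(1) this] A(2) F ab show ?thesis
        by (simp add: evp_def degree_nrm max_def)
    qed
  qed
  have q: "\<forall>\<^sub>F Z in ecf. evp a b (m \<cdot>\<^sub>E Z) / poly d (xc (m \<cdot>\<^sub>E Z)) = \<phi> (m \<cdot>\<^sub>E Z)"
    using eventually_smul[OF m e] RFN_nonzero[OF P(1)[OF d]] by eventually_elim (simp add: divide_eq_eq)
  note D = RFN_divide[OF conjunct1[OF N] P(1)[OF d]]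
  show "(\<lambda>Z. \<phi> (m \<cdot>\<^sub>E Z)) \<in> RFN" by (rule RFN_cong[OF D(1) q])
  show "ord (\<lambda>Z. \<phi> (m \<cdot>\<^sub>E Z)) = ord \<phi>"
    using ord_cong[OF D(1) q] D(2) N P(2)[OF d] ord_rep[OF r] by simp
qed

lemma ord_ge_smul:
  assumes "m \<ge> 1" "ord_ge \<phi> k"
  shows "ord_ge (\<lambda>Z. \<phi> (m \<cdot>\<^sub>E Z)) k"
proof (cases "\<phi> \<in> RFN")
  case True
  thus ?thesis using RFN_smul[OF assms(1) True] assms(2) by (simp add: ord_ge_def RFN_imp_RF)
next
  case False
  hence "\<forall>\<^sub>F Z in ecf. \<phi> Z = 0" using assms(2) RF_cases by (auto simp: ord_ge_def)
  from eventually_smul[OF assms(1) this] show ?thesis by (rule ord_ge_zero)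
qed

lemma eventually_smul_translate:
  assumes "X \<in> EC"
  shows "\<forall>\<^sub>F Z in ecf. \<phi> (m \<cdot>\<^sub>E Z +\<^sub>E m \<cdot>\<^sub>E X) = \<phi> (m \<cdot>\<^sub>E (Z +\<^sub>E X))"
  using eventually_ecf_neq[of Infinity] by eventually_elim (simp add: smul_padd assms)

lemma dv_smul:
  assumes m: "m \<ge> 1" and "\<phi> \<in> RFN" "X \<in> EC"
  shows "dv (\<lambda>Z. \<phi> (m \<cdot>\<^sub>E Z)) X = dv \<phi> (m \<cdot>\<^sub>E X)"
proof -
  have R: "(\<lambda>Z. \<phi> (Z +\<^sub>E m \<cdot>\<^sub>E X)) \<in> RFN" using assms by (intro RFN_translate) auto
  have "ord (\<lambda>Z. \<phi> (m \<cdot>\<^sub>E Z +\<^sub>E m \<cdot>\<^sub>E X)) = ord (\<lambda>Z. \<phi> (m \<cdot>\<^sub>E (Z +\<^sub>E X)))"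
    by (rule ord_cong[OF RFN_smul(1)[OF m R] eventually_smul_translate[OF assms(3)]])
  thus ?thesis using RFN_smul(2)[OF m R] by (simp add: dv_def)
qed

lemma xc_evp: "xc = evp [:0, 1:] 0"
  by (auto simp: evp_def)

lemma dv_xc_nonneg: "X \<in> EC \<Longrightarrow> X \<noteq> Infinity \<Longrightarrow> dv xc X \<ge> 0"
  unfolding xc_evp by (rule dv_evp_nonneg) auto

lemma finite_tors:
  assumes "m \<ge> 1"
  shows "finite (tors m)"
proof -
  have "tors m \<subseteq> {X \<in> EC. dv (\<lambda>Z. xc (m \<cdot>\<^sub>E Z)) X \<noteq> 0}"
    using dv_smul[OF assms RFN_xc(1)] RFN_xc(2) by (auto simp: tors_def)
  thus ?thesis using degree_zero(1)[OF RFN_xc_smul(1)[OF assms]] finite_subset by blast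
qed

text \<open>The function x(mZ) - x(R) has a pole at infinity, hence a zero Y somewhere, and mY is R
  or -R.\<close>

lemma smul_surj:
  assumes "m \<ge> 1" "R \<in> EC"
  obtains X where "X \<in> EC" "m \<cdot>\<^sub>E X = R"
proof (cases "R = Infinity")
  case True
  thus ?thesis using that[of Infinity] by simp
next
  case False
  note R = RFN_xc_minus[of "xc R"]
  have "dv (\<lambda>Z. xc (m \<cdot>\<^sub>E Z) - xc R) Infinity < 0" using RFN_smul(2)[OF assms(1) R(1)] R(2) by simp
  then obtain Y where Y: "Y \<in> EC" "dv (\<lambda>Z. xc (m \<cdot>\<^sub>E Z) - xc R) Y > 0"
    using dv_pos_exists[OF RFN_smul(1)[OF assms(1) R(1)] Infinity_in_EC] by blast
  hence "dv (\<lambda>Z. xc Z - xc R) (m \<cdot>\<^sub>E Y) > 0" using dv_smul[OF assms(1) R(1) Y(1)] by simp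
  hence "m \<cdot>\<^sub>E Y = R \<or> m \<cdot>\<^sub>E Y = -\<^sub>E R"
    using dv_vertical[OF assms(2) False, of "m \<cdot>\<^sub>E Y"] Y(1) by (auto simp: of_bool_def split: if_splits)
  thus ?thesis
  proof
    assume "m \<cdot>\<^sub>E Y = -\<^sub>E R"
    hence "m \<cdot>\<^sub>E (-\<^sub>E Y) = R" using Y(1) by (simp add: smul_pneg)
    thus ?thesis using that[of "-\<^sub>E Y"] Y(1) by simp
  qed (use that Y in blast)
qed

section \<open>The count of m-torsion points\<close>

lemma two_torsion_iff: "X \<in> EC \<Longrightarrow> 2 \<cdot>\<^sub>E X = Infinity \<longleftrightarrow> -\<^sub>E X = X"
proof -
  assume X: "X \<in> EC"
  have "2 \<cdot>\<^sub>E X = X +\<^sub>E X" using X by (simp add: numeral_2_eq_2)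
  thus ?thesis using padd_pneg_eq_iff[of X "-\<^sub>E X" Infinity] X by auto
qed

text \<open>Zeros and poles of x(mZ) - x(Z). It has at most double poles on E[m] and none elsewhere,
  and outside E[m] it vanishes where mX is X or -X, that is on E[m - 1] and E[m + 1]. The 2 on the
  right pays for \<infinity>, which lies in all three groups but counts only as a pole.\<close>

lemma card_tors_concave:
  assumes m: "m \<ge> 2"
  shows "int (card (tors (m + 1))) + int (card (tors (m - 1))) \<le> 2 * int (card (tors m)) + 2"
proof -
  have m1: "m \<ge> 1" "m + 1 \<ge> 1" "m - 1 \<ge> 1" using m by auto
  define f where "f = (\<lambda>Z. xc (m \<cdot>\<^sub>E Z) - xc Z)"
  have fR: "f \<in> RFN"
  proof -
    have "lim_inf (\<lambda>Z. xc (m \<cdot>\<^sub>E Z) / xc Z) (1 / of_nat m ^ 2)"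
      using mult_lim[OF m1(1)] by (simp add: mult_lim_def)
    hence "lim_inf (\<lambda>Z. xc (m \<cdot>\<^sub>E Z) / xc Z - 1) (1 / of_nat m ^ 2 - 1)"
      by (rule lim_inf_diff[OF _ lim_inf_const])
    moreover have "1 / of_nat m ^ 2 - 1 \<noteq> (0 :: 'a)"
    proof
      assume "1 / of_nat m ^ 2 - 1 = (0 :: 'a)"
      hence "of_nat (m ^ 2) = (of_nat 1 :: 'a)" using m by (simp add: field_simps)
      hence "m ^ 2 = 1" by (simp only: of_nat_eq_iff)
      thus False using m by simp
    qed
    ultimately have "(\<lambda>Z. xc (m \<cdot>\<^sub>E Z) / xc Z - 1) \<in> RFN" by (rule lim_inf_RFN)
    from RFN_mult(1)[OF RFN_xc(1) this] show ?thesis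
    proof (rule RFN_cong)
      show "\<forall>\<^sub>F Z in ecf. xc Z * (xc (m \<cdot>\<^sub>E Z) / xc Z - 1) = f Z"
        using RFN_nonzero[OF RFN_xc(1)] by eventually_elim (simp add: f_def algebra_simps)
    qed
  qed
  have fX: "(\<lambda>Z. f (Z +\<^sub>E X)) \<in> RFN" if "X \<in> EC" for X using RFN_translate[OF fR that] .
  have pole: "dv f X \<ge> - 2" if X: "X \<in> tors m" for X
  proof -
    have XE: "X \<in> EC" "m \<cdot>\<^sub>E X = Infinity" using X by (auto simp: tors_def)
    have "dv xc X \<ge> - 2" using dv_xc_nonneg[OF XE(1)] RFN_xc(2) by (cases "X = Infinity") auto
    hence 1: "ord_ge (\<lambda>Z. xc (Z +\<^sub>E X)) (- 2)"
      using RFN_translate[OF RFN_xc(1) XE(1)] by (simp add: ord_ge_def dv_def RFN_imp_RF)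
    have "dv (\<lambda>Z. xc (m \<cdot>\<^sub>E Z)) X = - 2" using dv_smul[OF m1(1) RFN_xc(1) XE(1)] XE RFN_xc(2) by simp
    hence 2: "ord_ge (\<lambda>Z. xc (m \<cdot>\<^sub>E (Z +\<^sub>E X))) (- 2)"
      using RFN_translate[OF RFN_xc_smul(1)[OF m1(1)] XE(1)] by (simp add: ord_ge_def dv_def RFN_imp_RF)
    from ord_ge_diff[OF 2 1] show ?thesis using fX[OF XE(1)] by (simp add: ord_ge_def dv_def f_def)
  qed
  have lim: "lim_inf (\<lambda>Z. f (Z +\<^sub>E X)) (xc (m \<cdot>\<^sub>E X) - xc X)" if X: "X \<in> EC" "X \<notin> tors m" for X
  proof -
    have ne: "X \<noteq> Infinity" "m \<cdot>\<^sub>E X \<noteq> Infinity" using X by (auto simp: tors_def)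
    have 1: "lim_inf (\<lambda>Z. xc (Z +\<^sub>E X)) (xc X)"
      using lim_translate_evp[OF X(1) ne(1), of "[:0, 1:]" 0] by (simp flip: xc_evp)
    have "lim_inf (\<lambda>Z. xc (Z +\<^sub>E m \<cdot>\<^sub>E X)) (xc (m \<cdot>\<^sub>E X))"
      using lim_translate_evp[of "m \<cdot>\<^sub>E X" "[:0, 1:]" 0] X(1) ne(2) by (simp flip: xc_evp)
    hence "lim_inf (\<lambda>Z. xc (m \<cdot>\<^sub>E Z +\<^sub>E m \<cdot>\<^sub>E X)) (xc (m \<cdot>\<^sub>E X))"
      unfolding lim_inf_def by (rule ord_ge_smul[OF m1(1)])
    hence "lim_inf (\<lambda>Z. xc (m \<cdot>\<^sub>E (Z +\<^sub>E X))) (xc (m \<cdot>\<^sub>E X))"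
      by (rule lim_inf_cong[OF _ eventually_smul_translate[OF X(1)]])
    from lim_inf_diff[OF this 1] show ?thesis by (simp add: f_def)
  qed
  have mSuc: "(m + 1) \<cdot>\<^sub>E X = m \<cdot>\<^sub>E X +\<^sub>E X" if "X \<in> EC" for X by simp
  have mPred: "(m - 1) \<cdot>\<^sub>E X +\<^sub>E X = m \<cdot>\<^sub>E X" if "X \<in> EC" for X
    using smul_Suc[of X "m - 1"] m by simp
  have plus: "m \<cdot>\<^sub>E X = -\<^sub>E X" if "X \<in> tors (m + 1)" for X
  proof -
    have "X \<in> EC" "m \<cdot>\<^sub>E X +\<^sub>E X = Infinity" using that mSuc by (auto simp: tors_def)
    thus ?thesis using padd_pneg_eq_iff[of "m \<cdot>\<^sub>E X" "-\<^sub>E X" Infinity] by simp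
  qed
  have minus: "m \<cdot>\<^sub>E X = X" if "X \<in> tors (m - 1)" for X
    using that mPred[of X] by (auto simp: tors_def)
  have zero: "dv f X \<ge> of_bool (X \<in> tors (m + 1)) + of_bool (X \<in> tors (m - 1))"
    if X: "X \<in> EC" "X \<notin> tors m" for X
  proof -
    have reg: "dv f X \<ge> 0" using lim_inf_ord_ge[OF lim[OF X]] fX[OF X(1)] by (simp add: ord_ge_def dv_def)
    have one: "dv f X \<ge> 1" if "X \<in> tors (m + 1) \<or> X \<in> tors (m - 1)"
    proof -
      have "xc (m \<cdot>\<^sub>E X) = xc X" using that plus minus by auto
      hence "lim_inf (\<lambda>Z. f (Z +\<^sub>E X)) 0" using lim[OF X] by simp
      thus ?thesis using fX[OF X(1)] by (simp add: lim_inf_0 ord_ge_def dv_def)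
    qed
    \<comment> \<open>Such a point is its own negative, so f is even about it and its order there is
      even; being positive, it is at least 2.\<close>
    have two: "dv f X \<ge> 2" if "X \<in> tors (m + 1)" "X \<in> tors (m - 1)"
    proof -
      have nX: "-\<^sub>E X = X" using plus[OF that(1)] minus[OF that(2)] by simp
      have "\<forall>\<^sub>F Z in ecf. f ((-\<^sub>E Z) +\<^sub>E X) = f (Z +\<^sub>E X)"
        using eventually_ecf_neq[of Infinity]
      proof eventually_elim
        case (elim Z)
        have "(-\<^sub>E Z) +\<^sub>E X = -\<^sub>E (Z +\<^sub>E X)" using pneg_padd[of Z X] elim X nX by simp
        thus ?case using elim X unfolding f_def by (simp add: smul_pneg)
      qed
      from even_ord[OF fX[OF X(1)] this] have "even (dv f X)" by (simp add: dv_def)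
      thus ?thesis using one that by (cases "dv f X = 1") auto
    qed
    show ?thesis using reg one two by (auto simp: of_bool_def)
  qed
  let ?T = "tors m \<union> (tors (m + 1) \<union> tors (m - 1))"
  have fin: "finite (tors m)" "finite (tors (m + 1))" "finite (tors (m - 1))" using finite_tors m1 by blast+
  have TE: "?T \<subseteq> EC" by (auto simp: tors_def)
  have "dv f X \<ge> 0" if "X \<in> EC - ?T" for X using zero[of X] that by simp
  hence le0: "(\<Sum>X\<in>?T. dv f X) \<le> 0"
    using fin TE by (intro dv_sum_bound[OF fR]) auto
  have le1: "(\<Sum>X\<in>?T. - 2 * of_bool (X \<in> tors m) + of_bool (X \<in> tors (m + 1) - {Infinity})
      + of_bool (X \<in> tors (m - 1) - {Infinity})) \<le> (\<Sum>X\<in>?T. dv f X)"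
  proof (rule sum_mono)
    fix X assume X: "X \<in> ?T"
    have XE: "X \<in> EC" using X TE by blast
    show "- 2 * of_bool (X \<in> tors m) + of_bool (X \<in> tors (m + 1) - {Infinity})
      + of_bool (X \<in> tors (m - 1) - {Infinity}) \<le> dv f X"
    proof (cases "X \<in> tors m")
      case True
      have "X = Infinity" if "X \<in> tors (m + 1) \<or> X \<in> tors (m - 1)"
        using that plus[of X] minus[of X] True by (auto simp: tors_def)
      thus ?thesis using pole[OF True] True by (auto simp: of_bool_def)
    next
      case False
      hence "X \<noteq> Infinity" by auto
      thus ?thesis using zero[OF XE False] False by simp
    qed
  qed
  have "(\<Sum>X\<in>?T. of_bool (X \<in> S)) = int (card S)" if "S \<subseteq> ?T" for S
  proof -
    have "(\<Sum>X\<in>?T. of_bool (X \<in> S)) = (\<Sum>X\<in>S. (1 :: int))"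
      using that fin by (intro sum.mono_neutral_cong_right) auto
    thus ?thesis by simp
  qed
  from this[of "tors m"] this[of "tors (m + 1) - {Infinity}"] this[of "tors (m - 1) - {Infinity}"]
  have cards: "(\<Sum>X\<in>?T. of_bool (X \<in> tors m)) = int (card (tors m))"
    "(\<Sum>X\<in>?T. of_bool (X \<in> tors (m + 1) - {Infinity})) = int (card (tors (m + 1) - {Infinity}))"
    "(\<Sum>X\<in>?T. of_bool (X \<in> tors (m - 1) - {Infinity})) = int (card (tors (m - 1) - {Infinity}))"
    by blast+
  have minus1: "int (card (tors k - {Infinity})) = int (card (tors k)) - 1" if "finite (tors k)" for k
  proof -
    have "card (tors k) > 0" using that Infinity_in_tors[of k] by (metis card_gt_0_iff empty_iff)
    thus ?thesis using card_Diff_singleton[OF Infinity_in_tors[of k]] by simp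
  qed
  have "- 2 * int (card (tors m)) + int (card (tors (m + 1) - {Infinity})) + int (card (tors (m - 1) - {Infinity})) \<le> 0"
    using le0 le1 unfolding sum.distrib sum_distrib_left[symmetric] cards by linarith
  thus ?thesis using minus1 fin by simp
qed

lemma card_tors_1: "card (tors 1) = 1"
proof -
  have "tors 1 = {Infinity}" by (auto simp: tors_def)
  thus ?thesis by simp
qed

lemma card_tors_2: "card (tors 2) = 4"
proof -
  obtain e1 e2 e3 where e: "\<forall>x. cf x = (x - e1) * (x - e2) * (x - e3)" "e1 \<noteq> e2" "e1 \<noteq> e3" "e2 \<noteq> e3"
    by (rule cf_roots)
  have "tors 2 = {Infinity, Affine e1 0, Affine e2 0, Affine e3 0}"
  proof (rule Set.set_eqI)
    fix X
    show "X \<in> tors 2 \<longleftrightarrow> X \<in> {Infinity, Affine e1 0, Affine e2 0, Affine e3 0}"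
    proof (cases X)
      case (Affine x y)
      have "X \<in> tors 2 \<longleftrightarrow> X \<in> EC \<and> -\<^sub>E X = X" using two_torsion_iff[of X] by (auto simp: tors_def)
      also have "\<dots> \<longleftrightarrow> y\<^sup>2 = cf x \<and> - y = y" by (simp add: Affine)
      also have "- y = y \<longleftrightarrow> y = 0"
      proof
        assume "- y = y"
        hence "y + y = 0" by (metis add.right_inverse)
        hence "2 * y = 0" by (simp only: mult_2)
        thus "y = 0" by simp
      qed simp
      finally show ?thesis using e(1) by (auto simp: Affine)
    qed simp
  qed
  thus ?thesis using e by simp
qed

text \<open>Doubling is surjective with the cosets of E[2] as fibres, which gives the exact count at
  powers of two.\<close>

lemma card_tors_double:
  assumes "k \<ge> 1"
  shows "card (tors (2 * k)) = 4 * card (tors k)"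
proof -
  have un: "tors (2 * k) = (\<Union>R\<in>tors k. {X \<in> EC. 2 \<cdot>\<^sub>E X = R})"
  proof -
    have "X \<in> tors (2 * k) \<longleftrightarrow> X \<in> EC \<and> 2 \<cdot>\<^sub>E X \<in> tors k" for X
      by (auto simp: tors_def smul_smul mult.commute)
    thus ?thesis by blast
  qed
  have fib: "card {X \<in> EC. 2 \<cdot>\<^sub>E X = R} = 4" "finite {X \<in> EC. 2 \<cdot>\<^sub>E X = R}" if R: "R \<in> EC" for R
  proof -
    obtain X0 where X0: "X0 \<in> EC" "2 \<cdot>\<^sub>E X0 = R" using smul_surj[of 2 R] R by auto
    have "bij_betw (\<lambda>T. T +\<^sub>E X0) (tors 2) {X \<in> EC. 2 \<cdot>\<^sub>E X = R}"
    proof (rule bij_betwI[where g = "\<lambda>X. X +\<^sub>E (-\<^sub>E X0)"])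
      show "(\<lambda>T. T +\<^sub>E X0) \<in> tors 2 \<rightarrow> {X \<in> EC. 2 \<cdot>\<^sub>E X = R}"
        using X0 by (auto simp: tors_def smul_padd)
      show "(\<lambda>X. X +\<^sub>E (-\<^sub>E X0)) \<in> {X \<in> EC. 2 \<cdot>\<^sub>E X = R} \<rightarrow> tors 2"
        using X0 by (auto simp: tors_def smul_padd smul_pneg)
    qed (use X0 in \<open>auto simp: padd_cancel padd_cancel' tors_def\<close>)
    from bij_betw_same_card[OF this] bij_betw_finite[OF this] show "card {X \<in> EC. 2 \<cdot>\<^sub>E X = R} = 4" "finite {X \<in> EC. 2 \<cdot>\<^sub>E X = R}"
      using card_tors_2 finite_tors[of 2] by simp_all
  qed
  have "card (tors (2 * k)) = (\<Sum>R\<in>tors k. card {X \<in> EC. 2 \<cdot>\<^sub>E X = R})"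
    unfolding un using fib finite_tors[OF assms] tors_in_EC
    by (intro card_UN_disjoint) auto
  also have "\<dots> = (\<Sum>R\<in>tors k. 4)" using fib tors_in_EC by (intro sum.cong) auto
  finally show ?thesis by simp
qed

text \<open>The excess of the count over m^2 has nonpositive second differences and vanishes at 1
  and 2, so it never increases; that is the upper bound. It also vanishes at all powers of two, some
  of which exceed m, and this gives the lower bound.\<close>

theorem card_tors:
  assumes "m \<ge> 1"
  shows "card (tors m) = m\<^sup>2"
proof -
  define s where "s = (\<lambda>m. int (card (tors m)) - int (m\<^sup>2))"
  have conc: "s (m + 1) + s (m - 1) \<le> 2 * s m" if "m \<ge> 2" for m
  proof -
    have "int ((m + 1)\<^sup>2) + int ((m - 1)\<^sup>2) = 2 * int (m\<^sup>2) + 2"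
      using that by (cases m) (simp_all add: power2_eq_square algebra_simps)
    thus ?thesis using card_tors_concave[OF that] by (simp add: s_def)
  qed
  have dec: "s (Suc m) \<le> s m" if "m \<ge> 1" for m
    using that
  proof (induction m rule: dec_induct)
    case base
    show ?case using card_tors_1 card_tors_2 by (simp add: s_def numeral_2_eq_2)
  next
    case (step n)
    have "s (Suc n + 1) + s (Suc n - 1) \<le> 2 * s (Suc n)" using step by (intro conc) auto
    thus ?case using step by simp
  qed
  have mono: "s n \<le> s m" if "1 \<le> m" "m \<le> n" for m n
    using that(2,1) by (induction n rule: dec_induct) (auto intro: order_trans[OF dec])
  have pow: "card (tors (2 ^ k)) = 4 ^ k" for k
  proof (induction k)
    case (Suc k)
    thus ?case using card_tors_double[of "2 ^ k"] by simp
  qed (use card_tors_1 in simp)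
  have "s (2 ^ m) = 0" 
  proof -
    have "(4 :: nat) ^ m = (2 ^ m)\<^sup>2" by (simp add: power2_eq_square flip: power_mult_distrib)
    thus ?thesis unfolding s_def pow by simp
  qed
  moreover have "s (2 ^ m) \<le> s m" using assms less_exp[of m] by (intro mono) auto
  moreover have "s m \<le> s 1" using assms by (intro mono) auto
  moreover have "s 1 = 0" using card_tors_1 by (simp add: s_def)
  ultimately have "s m = 0" by simp
  thus ?thesis by (simp add: s_def)
qed

end

section \<open>Galois equivariance\<close>

definition field_aut :: "('a :: field \<Rightarrow> 'a) \<Rightarrow> bool" where
  "field_aut \<sigma> \<longleftrightarrow> bij \<sigma> \<and> (\<forall>x y. \<sigma> (x + y) = \<sigma> x + \<sigma> y) \<and> (\<forall>x y. \<sigma> (x * y) = \<sigma> x * \<sigma> y)"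

context
  fixes \<sigma> :: "'a :: field \<Rightarrow> 'a"
  assumes aut: "field_aut \<sigma>"
begin

lemma field_aut_add: "\<sigma> (x + y) = \<sigma> x + \<sigma> y"
  and field_aut_mult: "\<sigma> (x * y) = \<sigma> x * \<sigma> y"
  and field_aut_bij: "bij \<sigma>"
  using aut by (auto simp: field_aut_def)

lemma field_aut_eq_iff: "\<sigma> x = \<sigma> y \<longleftrightarrow> x = y"
  using field_aut_bij by (auto simp: bij_def inj_eq)

lemma field_aut_0: "\<sigma> 0 = 0"
  using field_aut_add[of 0 0] by (metis add_0 add_left_cancel add.right_neutral)

lemma field_aut_eq_0_iff: "\<sigma> x = 0 \<longleftrightarrow> x = 0"
  using field_aut_eq_iff[of x 0] field_aut_0 by simp

lemma field_aut_1: "\<sigma> 1 = 1"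
  using field_aut_mult[of 1 1] field_aut_eq_0_iff[of 1] by simp

lemma field_aut_uminus: "\<sigma> (- x) = - \<sigma> x"
  using field_aut_add[of x "- x"] field_aut_0 by (simp add: eq_neg_iff_add_eq_0 add.commute)

lemma field_aut_diff: "\<sigma> (x - y) = \<sigma> x - \<sigma> y"
  using field_aut_add[of x "- y"] field_aut_uminus[of y] by simp

lemma field_aut_inverse: "\<sigma> (inverse x) = inverse (\<sigma> x)"
proof (cases "x = 0")
  case False
  hence "\<sigma> x * \<sigma> (inverse x) = 1" using field_aut_mult[of x "inverse x"] field_aut_1 by simp
  thus ?thesis by (rule inverse_unique[symmetric])
qed (simp add: field_aut_0)

lemma field_aut_divide: "\<sigma> (x / y) = \<sigma> x / \<sigma> y"
  by (simp add: divide_inverse field_aut_mult field_aut_inverse)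

lemma field_aut_power: "\<sigma> (x ^ n) = \<sigma> x ^ n"
  by (induction n) (simp_all add: field_aut_1 field_aut_mult)

lemma field_aut_of_nat: "\<sigma> (of_nat n) = of_nat n"
  by (induction n) (simp_all add: field_aut_0 field_aut_1 field_aut_add)

lemma field_aut_numeral: "\<sigma> (numeral n) = numeral n"
  using field_aut_of_nat[of "numeral n"] by simp

lemma field_aut_poly: "poly (map_poly \<sigma> p) (\<sigma> x) = \<sigma> (poly p x)"
  by (induction p) (simp_all add: map_poly_pCons field_aut_0 field_aut_add field_aut_mult)

lemma field_aut_degree: "degree (map_poly \<sigma> p) = degree p"
  by (rule degree_map_poly) (simp add: field_aut_eq_0_iff)

lemma field_aut_map_poly_eq_0: "map_poly \<sigma> p = 0 \<longleftrightarrow> p = 0"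
  by (rule map_poly_eq_0_iff) (simp_all add: field_aut_0 field_aut_eq_0_iff)

end

lemmas field_aut_simps = field_aut_add field_aut_mult field_aut_0 field_aut_1 field_aut_uminus
  field_aut_diff field_aut_inverse field_aut_divide field_aut_power field_aut_numeral
  field_aut_eq_iff field_aut_eq_0_iff

lemma field_aut_id: "field_aut id"
  by (simp add: field_aut_def)

lemma field_aut_comp: "field_aut \<sigma> \<Longrightarrow> field_aut \<tau> \<Longrightarrow> field_aut (\<sigma> \<circ> \<tau>)"
  by (auto simp: field_aut_def intro: bij_comp)

lemma map_point_funpow:
  fixes \<sigma> :: "'a \<Rightarrow> 'a"
  shows "map_point (\<sigma> ^^ n) = map_point \<sigma> ^^ n"
proof (induction n)
  case 0
  show ?case unfolding funpow.simps by (rule point.map_id0)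
next
  case (Suc n)
  show ?case unfolding funpow.simps Suc[symmetric] by (simp add: fun_eq_iff point.map_comp o_def)
qed

context monic_cubic_curve
begin

definition gal :: "('a \<Rightarrow> 'a) \<Rightarrow> bool" where
  "gal \<sigma> \<longleftrightarrow> field_aut \<sigma> \<and> \<sigma> c2 = c2 \<and> \<sigma> c1 = c1 \<and> \<sigma> c0 = c0"

lemma gal_funpow: "gal \<sigma> \<Longrightarrow> gal (\<sigma> ^^ n)"
  by (induction n) (auto simp: gal_def field_aut_id field_aut_comp)

context
  fixes \<sigma> :: "'a \<Rightarrow> 'a"
  assumes g: "gal \<sigma>"
begin

lemma fa: "field_aut \<sigma>"
  using g by (simp add: gal_def)

lemma gal_cf: "\<sigma> (cf x) = cf (\<sigma> x)" and gal_cf': "\<sigma> (cf' x) = cf' (\<sigma> x)"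
  using g by (simp_all add: gal_def cf_def cf'_def field_aut_simps[OF fa])

lemma map_point_in_EC: "map_point \<sigma> P \<in> EC \<longleftrightarrow> P \<in> EC"
proof (cases P)
  case (Affine x y)
  have "(\<sigma> y)\<^sup>2 = cf (\<sigma> x) \<longleftrightarrow> \<sigma> (y\<^sup>2) = \<sigma> (cf x)" by (simp add: field_aut_simps[OF fa] gal_cf)
  thus ?thesis by (simp add: Affine field_aut_eq_iff[OF fa])
qed simp

lemma map_point_eq_iff: "map_point \<sigma> P = map_point \<sigma> Q \<longleftrightarrow> P = Q"
  using point.inj_map[of \<sigma>] field_aut_bij[OF fa] by (auto simp: bij_def inj_eq)

lemma map_point_inv: "map_point \<sigma> (map_point (inv_into UNIV \<sigma>) P) = P" "map_point (inv_into UNIV \<sigma>) (map_point \<sigma> P) = P"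
proof -
  have "\<sigma> \<circ> inv_into UNIV \<sigma> = id" "inv_into UNIV \<sigma> \<circ> \<sigma> = id" using field_aut_bij[OF fa] by (auto simp: bij_def surj_iff inj_iff)
  thus "map_point \<sigma> (map_point (inv_into UNIV \<sigma>) P) = P" "map_point (inv_into UNIV \<sigma>) (map_point \<sigma> P) = P"
    by (simp_all add: point.map_comp point.map_id)
qed

lemma bij_betw_map_point: "bij_betw (map_point \<sigma>) EC EC"
proof (rule bij_betwI[where g = "map_point (inv_into UNIV \<sigma>)"])
  show "map_point (inv_into UNIV \<sigma>) \<in> EC \<rightarrow> EC"
    using map_point_in_EC[of "map_point (inv_into UNIV \<sigma>) _"] by (auto simp: map_point_inv)
qed (auto simp: map_point_in_EC map_point_inv)

lemma map_point_pneg: "map_point \<sigma> (-\<^sub>E P) = -\<^sub>E (map_point \<sigma> P)"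
  by (cases P) (simp_all add: field_aut_simps[OF fa])

lemma map_point_padd: "map_point \<sigma> (P +\<^sub>E Q) = map_point \<sigma> P +\<^sub>E map_point \<sigma> Q"
proof (cases "P = Infinity \<or> Q = Infinity")
  case False
  then obtain x1 y1 x2 y2 where PQ: "P = Affine x1 y1" "Q = Affine x2 y2"
    by (metis point.exhaust)
  have 0: "\<sigma> y1 + \<sigma> y2 = 0 \<longleftrightarrow> y1 + y2 = 0"
    using field_aut_eq_0_iff[OF fa, of "y1 + y2"] by (simp add: field_aut_add[OF fa])
  have c: "\<sigma> c2 = c2" using g by (simp add: gal_def)
  define l where "l = (if x1 = x2 then cf' x1 / (2 * y1) else (y2 - y1) / (x2 - x1))"
  have l: "(if \<sigma> x1 = \<sigma> x2 then cf' (\<sigma> x1) / (2 * \<sigma> y1) else (\<sigma> y2 - \<sigma> y1) / (\<sigma> x2 - \<sigma> x1)) = \<sigma> l"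
    unfolding l_def by (simp add: field_aut_simps[OF fa] gal_cf')
  show ?thesis
    unfolding PQ point.map padd.simps(3) Let_def l l_def[symmetric] unfolding 0 field_aut_eq_iff[OF fa]
    by (simp add: field_aut_simps[OF fa] c)
qed auto

lemma map_point_smul: "map_point \<sigma> (n \<cdot>\<^sub>E P) = n \<cdot>\<^sub>E map_point \<sigma> P"
  by (induction n) (simp_all add: map_point_padd)

lemma map_point_in_tors: "P \<in> tors N \<Longrightarrow> map_point \<sigma> P \<in> tors N"
proof -
  assume "P \<in> tors N"
  moreover have "N \<cdot>\<^sub>E map_point \<sigma> P = map_point \<sigma> (N \<cdot>\<^sub>E P)" by (rule map_point_smul[symmetric])
  ultimately show ?thesis by (simp add: tors_def map_point_in_EC)
qed

lemma eventually_map_point: "eventually (\<lambda>P. \<Phi> (map_point \<sigma> P)) ecf \<longleftrightarrow> eventually \<Phi> ecf"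
  by (rule filtermap_bij_ecf[OF bij_betw_map_point])

text \<open>The conjugate of \<phi> as a function on points. It is represented by the polynomials
  with conjugated coefficients, so its order at \<sigma>X is that of \<phi> at X.\<close>

definition conj_fun :: "('a point \<Rightarrow> 'a) \<Rightarrow> 'a point \<Rightarrow> 'a" where
  "conj_fun \<phi> Z = \<sigma> (\<phi> (map_point (inv_into UNIV \<sigma>) Z))"

lemma conj_fun_map: "conj_fun \<phi> (map_point \<sigma> Z) = \<sigma> (\<phi> Z)"
  by (simp add: conj_fun_def map_point_inv)

lemma evp_map: "evp (map_poly \<sigma> a) (map_poly \<sigma> b) (map_point \<sigma> P) = \<sigma> (evp a b P)"
proof -
  have "xc (map_point \<sigma> P) = \<sigma> (xc P)" "yc (map_point \<sigma> P) = \<sigma> (yc P)"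
    by (cases P; simp add: field_aut_simps[OF fa])+
  thus ?thesis by (simp add: evp_def field_aut_simps[OF fa] field_aut_poly[OF fa])
qed

lemma rep_conj_fun:
  assumes "rep \<phi> a b d"
  shows "rep (conj_fun \<phi>) (map_poly \<sigma> a) (map_poly \<sigma> b) (map_poly \<sigma> d)"
proof -
  have xc: "xc (map_point \<sigma> P) = \<sigma> (xc P)" for P by (cases P) (simp_all add: field_aut_simps[OF fa])
  have "\<forall>\<^sub>F P in ecf. \<phi> P * poly d (xc P) = evp a b P" using assms by (simp add: rep_def)
  hence "\<forall>\<^sub>F P in ecf. conj_fun \<phi> (map_point \<sigma> P) * poly (map_poly \<sigma> d) (xc (map_point \<sigma> P))
      = evp (map_poly \<sigma> a) (map_poly \<sigma> b) (map_point \<sigma> P)"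
  proof eventually_elim
    case (elim P)
    have "\<sigma> (\<phi> P * poly d (xc P)) = \<sigma> (evp a b P)" using elim by simp
    thus ?case unfolding conj_fun_map evp_map xc field_aut_poly[OF fa] field_aut_mult[OF fa] .
  qed
  hence "\<forall>\<^sub>F P in ecf. conj_fun \<phi> P * poly (map_poly \<sigma> d) (xc P) = evp (map_poly \<sigma> a) (map_poly \<sigma> b) P"
    by (subst (asm) eventually_map_point[of "\<lambda>P. conj_fun \<phi> P * poly (map_poly \<sigma> d) (xc P)
          = evp (map_poly \<sigma> a) (map_poly \<sigma> b) P"])
  thus ?thesis using assms by (simp add: rep_def field_aut_map_poly_eq_0[OF fa])
qed

lemma RFN_conj_fun:
  assumes "\<phi> \<in> RFN"
  shows "conj_fun \<phi> \<in> RFN" "ord (conj_fun \<phi>) = ord \<phi>"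
proof -
  from assms obtain a b d where r: "rep \<phi> a b d" "a \<noteq> 0 \<or> b \<noteq> 0" by (rule RFN_E)
  have nz: "map_poly \<sigma> a \<noteq> 0 \<or> map_poly \<sigma> b \<noteq> 0" using r(2) by (simp add: field_aut_map_poly_eq_0[OF fa])
  show "conj_fun \<phi> \<in> RFN" by (rule RFN_I[OF rep_conj_fun[OF r(1)] nz])
  show "ord (conj_fun \<phi>) = ord \<phi>"
    unfolding ord_rep[OF r] ord_rep[OF rep_conj_fun[OF r(1)] nz] degree_nrm(2)[OF r(2)] degree_nrm(2)[OF nz]
      field_aut_degree[OF fa] field_aut_map_poly_eq_0[OF fa] ..
qed

lemma dv_conj_fun:
  assumes "\<phi> \<in> RFN" "X \<in> EC"
  shows "dv (conj_fun \<phi>) (map_point \<sigma> X) = dv \<phi> X"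
proof -
  have R: "(\<lambda>Z. \<phi> (Z +\<^sub>E X)) \<in> RFN" by (rule RFN_translate[OF assms])
  have "conj_fun (\<lambda>Z. \<phi> (Z +\<^sub>E X)) Z = conj_fun \<phi> (Z +\<^sub>E map_point \<sigma> X)" for Z
  proof -
    define Y where "Y = map_point (inv_into UNIV \<sigma>) Z"
    have Z: "Z = map_point \<sigma> Y" by (simp add: Y_def map_point_inv)
    show ?thesis unfolding Z map_point_padd[symmetric] conj_fun_map ..
  qed
  hence "conj_fun (\<lambda>Z. \<phi> (Z +\<^sub>E X)) = (\<lambda>Z. conj_fun \<phi> (Z +\<^sub>E map_point \<sigma> X))" by blast
  thus ?thesis using RFN_conj_fun(2)[OF R] by (simp add: dv_def)
qed

lemma tdiv_conj_fun:
  assumes "tdiv N f P"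
  shows "tdiv N (conj_fun f) (map_point \<sigma> P)"
  unfolding tdiv_def
proof (intro conjI ballI)
  show "conj_fun f \<in> RFN" using RFN_conj_fun assms by (simp add: tdiv_def)
  fix X assume X: "X \<in> EC"
  define Y where "Y = map_point (inv_into UNIV \<sigma>) X"
  have XY: "X = map_point \<sigma> Y" by (simp add: Y_def map_point_inv)
  have Y: "Y \<in> EC" using X XY map_point_in_EC by simp
  have "X = Infinity \<longleftrightarrow> Y = Infinity" using map_point_eq_iff[of Y Infinity] XY by simp
  thus "dv (conj_fun f) X = int N * (of_bool (X = map_point \<sigma> P) - of_bool (X = Infinity))"
    using assms Y dv_conj_fun[of f Y] unfolding XY map_point_eq_iff by (simp add: tdiv_def)
qed

text \<open>Conjugating the commutator relation of P and Q gives one for \<sigma>P and \<sigma>Q,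
  with conjugated functions of the right divisors and with the conjugated scalar.\<close>

lemma weil_galois:
  assumes "P \<in> tors N" "Q \<in> tors N"
  shows "weil N (map_point \<sigma> P) (map_point \<sigma> Q) = \<sigma> (weil N P Q)"
proof -
  obtain f h where fh: "tdiv N f P" "tdiv N h Q" using exists_tdiv assms by metis
  have E: "P \<in> EC" "Q \<in> EC" using assms tors_in_EC by auto
  have "\<forall>\<^sub>F Z in ecf. conj_fun f (map_point \<sigma> Z) * conj_fun h (map_point \<sigma> Z +\<^sub>E (-\<^sub>E (map_point \<sigma> P)))
     = \<sigma> (weil N P Q) * (conj_fun h (map_point \<sigma> Z) * conj_fun f (map_point \<sigma> Z +\<^sub>E (-\<^sub>E (map_point \<sigma> Q))))"
    using weil_spec(2)[OF E fh]
  proof eventually_elim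
    case (elim Z)
    show ?case
      unfolding map_point_pneg[symmetric] map_point_padd[symmetric] conj_fun_map field_aut_mult[OF fa, symmetric] elim ..
  qed
  hence "\<forall>\<^sub>F Z in ecf. conj_fun f Z * conj_fun h (Z +\<^sub>E (-\<^sub>E (map_point \<sigma> P)))
     = \<sigma> (weil N P Q) * (conj_fun h Z * conj_fun f (Z +\<^sub>E (-\<^sub>E (map_point \<sigma> Q))))"
    by (subst (asm) eventually_map_point[of "\<lambda>Z. conj_fun f Z * conj_fun h (Z +\<^sub>E (-\<^sub>E (map_point \<sigma> P)))
     = \<sigma> (weil N P Q) * (conj_fun h Z * conj_fun f (Z +\<^sub>E (-\<^sub>E (map_point \<sigma> Q))))"])
  thus ?thesis
    using E by (intro weil_eqI[OF _ _ tdiv_conj_fun[OF fh(1)] tdiv_conj_fun[OF fh(2)]]) (simp_all add: map_point_in_EC)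
qed

end

end

section \<open>Galois action on the torsion\<close>

lemma exists_finite_order:
  assumes "finite A" "bij_betw f A A"
  obtains d where "d > 0" "\<forall>x\<in>A. (f ^^ d) x = x"
proof -
  have bij: "bij_betw (f ^^ k) A A" for k by (rule bij_betw_funpow[OF assms(2)])
  define r where "r = (\<lambda>k. restrict (f ^^ k) A)"
  have "r k \<in> A \<rightarrow>\<^sub>E A" for k unfolding r_def using bij_betwE[OF bij[of k]] by auto
  hence "range r \<subseteq> A \<rightarrow>\<^sub>E A" by blast
  moreover have "finite (A \<rightarrow>\<^sub>E A)" using assms(1) by (intro finite_PiE) auto
  ultimately have "finite (range r)" by (rule finite_subset)
  hence "\<not> inj r" using finite_imageD infinite_UNIV_nat by blast
  then obtain i j where ij: "r i = r j" "i < j" unfolding inj_def by (metis linorder_neqE_nat)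
  have "(f ^^ (j - i)) x = x" if x: "x \<in> A" for x
  proof -
    have "j = i + (j - i)" using ij(2) by simp
    hence "(f ^^ j) x = (f ^^ i) ((f ^^ (j - i)) x)" by (metis comp_apply funpow_add)
    moreover have "(f ^^ j) x = (f ^^ i) x" using fun_cong[OF ij(1), of x] x by (simp add: r_def)
    ultimately have "(f ^^ i) ((f ^^ (j - i)) x) = (f ^^ i) x" by simp
    moreover have "inj_on (f ^^ i) A" using bij[of i] by (rule bij_betw_imp_inj_on)
    moreover have "(f ^^ (j - i)) x \<in> A" using bij_betwE[OF bij[of "j - i"]] x by blast
    ultimately show ?thesis using x by (metis inj_onD)
  qed
  thus ?thesis using that[of "j - i"] ij(2) by simp
qed

text \<open>Orbits of f on A have length 1 or p, as p is prime; the moved points are a disjoint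
  union of orbits of length p.\<close>

lemma prime_dvd_card_moved:
  assumes "finite A" "prime p" "\<And>x. x \<in> A \<Longrightarrow> f x \<in> A" "\<And>x. x \<in> A \<Longrightarrow> (f ^^ p) x = x"
  shows "p dvd card {x \<in> A. f x \<noteq> x}"
proof -
  define B where "B = {x \<in> A. f x \<noteq> x}"
  have p0: "p > 0" using assms(2) by (simp add: prime_gt_0_nat)
  have cl: "(f ^^ i) x \<in> A" if "x \<in> A" for i x using that assms(3) by (induction i) auto
  have fadd: "(f ^^ i) ((f ^^ j) x) = (f ^^ (i + j)) x" for i j x by (simp add: funpow_add)
  have md: "(f ^^ (k mod p)) x = (f ^^ k) x" if "x \<in> A" for k x
    using assms(4)[OF that] by (rule funpow_mod_eq)
  define orb where "orb = (\<lambda>x. (\<lambda>i. (f ^^ i) x) ` {..<p})"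
  have mem: "(f ^^ k) x \<in> orb x" if "x \<in> A" for x k
    unfolding orb_def using md[OF that, of k] p0 by (intro image_eqI[of _ _ "k mod p"]) auto
  have ret: "\<exists>k. x = (f ^^ k) y" if "x \<in> A" "y \<in> orb x" for x y
  proof -
    from that(2) obtain i where i: "i < p" "y = (f ^^ i) x" by (auto simp: orb_def)
    have "(f ^^ (p - i)) y = (f ^^ p) x" using i by (simp add: fadd)
    thus ?thesis using assms(4)[OF that(1)] by metis
  qed
  have oA: "y \<in> A" if "x \<in> A" "y \<in> orb x" for x y using that cl by (auto simp: orb_def)
  have sub: "orb y \<subseteq> orb x" if xA: "x \<in> A" and yx: "y \<in> orb x" for x y
  proof
    fix z assume "z \<in> orb y"
    then obtain i where i: "z = (f ^^ i) y" by (auto simp: orb_def)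
    obtain j where "y = (f ^^ j) x" using yx by (auto simp: orb_def)
    thus "z \<in> orb x" using mem[OF xA, of "i + j"] i by (simp add: fadd)
  qed
  have orb_eq: "orb y = orb x" if xA: "x \<in> A" and yx: "y \<in> orb x" for x y
  proof
    obtain k where "x = (f ^^ k) y" using ret[OF xA yx] by blast
    hence "x \<in> orb y" using mem[OF oA[OF xA yx], of k] by simp
    thus "orb x \<subseteq> orb y" by (rule sub[OF oA[OF xA yx]])
  qed (rule sub[OF xA yx])
  have orbB: "orb x \<subseteq> B" if "x \<in> B" for x
  proof
    fix y assume y: "y \<in> orb x"
    have xA: "x \<in> A" using that by (simp add: B_def)
    have "f y \<noteq> y"
    proof
      assume fy: "f y = y"
      obtain k where "x = (f ^^ k) y" using ret[OF xA y] by blast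
      moreover have "(f ^^ k) y = y" for k using fy by (induction k) auto
      ultimately show False using fy that by (simp add: B_def)
    qed
    thus "y \<in> B" using oA[OF xA y] by (simp add: B_def)
  qed
  have card_orb: "card (orb x) = p" if "x \<in> B" for x
  proof -
    have xA: "x \<in> A" and fx: "f x \<noteq> x" using that by (auto simp: B_def)
    have ne: False if "i < j" "j < p" "(f ^^ i) x = (f ^^ j) x" for i j
    proof -
      define k where "k = j - i"
      have k: "0 < k" "k < p" using that by (auto simp: k_def)
      have "(f ^^ (p - i)) ((f ^^ i) x) = (f ^^ (p - i)) ((f ^^ j) x)" using that by simp
      moreover have "p - i + i = p" "p - i + j = k + p" using that by (auto simp: k_def)
      ultimately have "(f ^^ p) x = (f ^^ (k + p)) x" by (simp only: fadd)
      hence kx: "(f ^^ k) x = x" using assms(4)[OF xA] fadd[of k p x] by simp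
      \<comment> \<open>A return after k steps with 0 < k < p gives, through an inverse u of k
        modulo p, a return after one step.\<close>
      have "coprime k p" using k assms(2)
        by (metis coprime_commute nat_dvd_not_less prime_imp_coprime)
      then obtain u where u: "[k * u = Suc 0] (mod p)" using cong_solve_coprime_nat by blast
      have "(f ^^ (k * u)) x = x"
      proof (induction u)
        case (Suc u)
        thus ?case using kx fadd[of k "k * u" x] by simp
      qed simp
      moreover have "(k * u) mod p = 1" using u prime_gt_1_nat[OF assms(2)] by (simp add: cong_def)
      ultimately have "(f ^^ 1) x = x" using md[OF xA, of "k * u"] by simp
      thus False using fx by simp
    qed
    have "inj_on (\<lambda>i. (f ^^ i) x) {..<p}"
    proof (rule inj_onI)
      fix i j assume ij: "i \<in> {..<p}" "j \<in> {..<p}" "(f ^^ i) x = (f ^^ j) x"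
      show "i = j"
      proof (rule ccontr)
        assume "i \<noteq> j"
        hence "i < j \<or> j < i" by auto
        thus False using ne[of i j] ne[of j i] ij by auto
      qed
    qed
    thus ?thesis by (simp add: orb_def card_image)
  qed
  have fB: "finite B" using assms(1) by (simp add: B_def)
  have UB: "\<Union> (orb ` B) = B"
  proof
    show "B \<subseteq> \<Union> (orb ` B)" using mem[of _ 0] by (force simp: B_def)
  qed (use orbB in blast)
  have "p * card (orb ` B) = card (\<Union> (orb ` B))"
  proof (rule card_partition)
    fix c1 c2 assume c: "c1 \<in> orb ` B" "c2 \<in> orb ` B" "c1 \<noteq> c2"
    then obtain x y where xy: "x \<in> A" "y \<in> A" "c1 = orb x" "c2 = orb y" by (auto simp: B_def)
    show "c1 \<inter> c2 = {}"
    proof (rule ccontr)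
      assume "c1 \<inter> c2 \<noteq> {}"
      then obtain z where "z \<in> orb x" "z \<in> orb y" using xy by auto
      hence "orb x = orb y" using orb_eq xy by metis
      thus False using c xy by simp
    qed
  qed (use fB UB card_orb in auto)
  thus ?thesis unfolding UB B_def[symmetric] by (metis dvd_triv_left)
qed

section \<open>Roots of unity of prime power order\<close>

lemma root_of_unity_order:
  fixes z :: "'a :: field"
  assumes "prime p" "z ^ (p ^ Suc m) = 1" "z ^ (p ^ m) \<noteq> 1" "z ^ k = 1"
  shows "p ^ Suc m dvd k"
proof -
  let ?d = "gcd k (p ^ Suc m)"
  have "z ^ ?d = 1"
  proof (cases "k = 0")
    case False
    then obtain x y where xy: "k * x = p ^ Suc m * y + ?d" using bezout_nat by blast
    have "1 = (z ^ k) ^ x" using assms(4) by simp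
    also have "\<dots> = z ^ (p ^ Suc m * y + ?d)" by (simp only: xy flip: power_mult)
    also have "\<dots> = z ^ ?d" unfolding power_add power_mult assms(2) by simp
    finally show ?thesis by simp
  qed (use assms(2) in simp)
  obtain i where i: "i \<le> Suc m" "?d = p ^ i"
    using divides_primepow_nat[OF assms(1), of ?d "Suc m"] by auto
  have "i = Suc m"
  proof (rule ccontr)
    assume "i \<noteq> Suc m"
    hence "m = i + (m - i)" using i by simp
    hence "z ^ (p ^ m) = (z ^ p ^ i) ^ (p ^ (m - i))" by (metis power_add power_mult)
    thus False using assms(3) \<open>z ^ ?d = 1\<close> i by simp
  qed
  thus ?thesis using i by (metis gcd_dvd1)
qed

lemma root_of_unity_power_eq:
  fixes z :: "'a :: field"
  assumes "prime p" "z ^ (p ^ Suc m) = 1" "z ^ (p ^ m) \<noteq> 1" "z ^ a = z ^ b"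
  shows "[a = b] (mod p ^ Suc m)"
proof -
  have z0: "z \<noteq> 0" using assms(1,2) by (auto simp: power_0_left prime_gt_0_nat)
  have *: "[a = b] (mod p ^ Suc m)" if "a \<le> b" "z ^ a = z ^ b" for a b
  proof -
    have "z ^ a * z ^ (b - a) = z ^ b" unfolding power_add[symmetric] using that(1) by simp
    hence "z ^ a * z ^ (b - a) = z ^ a * 1" using that(2) by simp
    hence "z ^ (b - a) = 1" using z0 by simp
    hence "p ^ Suc m dvd b - a" using root_of_unity_order[OF assms(1-3)] by blast
    thus ?thesis using that by (metis cong_altdef_nat cong_sym)
  qed
  show ?thesis
  proof (cases "a \<le> b")
    case True
    thus ?thesis using *[of a b] assms(4) by simp
  next
    case False
    thus ?thesis using cong_sym[OF *[of b a]] assms(4) by simp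
  qed
qed

text \<open>The powers of z already give p^(m+1) distinct roots of unity, as many as there
  are.\<close>

lemma root_of_unity_is_power:
  fixes z :: "'a :: {alg_closed_field, field_char_0}"
  assumes "prime p" "z ^ (p ^ Suc m) = 1" "z ^ (p ^ m) \<noteq> 1" "w ^ (p ^ Suc m) = 1"
  shows "\<exists>i. w = z ^ i"
proof -
  let ?N = "p ^ Suc m"
  have N: "?N > 0" using prime_gt_0_nat[OF assms(1)] by simp
  have c: "card {x :: 'a. x ^ ?N = 1} = ?N" using N by (intro card_nth_roots_alg_closed) auto
  have "inj_on (\<lambda>i. z ^ i) {..<?N}"
  proof (rule inj_onI)
    fix i j assume "i \<in> {..<?N}" "j \<in> {..<?N}" "z ^ i = z ^ j"
    thus "i = j" using root_of_unity_power_eq[OF assms(1-3), of i j] by (auto simp: cong_less_modulus_unique_nat simp del: power_Suc)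
  qed
  hence "card ((\<lambda>i. z ^ i) ` {..<?N}) = ?N" by (simp add: card_image del: power_Suc)
  moreover have "(\<lambda>i. z ^ i) ` {..<?N} \<subseteq> {x. x ^ ?N = 1}"
  proof
    fix x assume "x \<in> (\<lambda>i. z ^ i) ` {..<?N}"
    then obtain i where "x = z ^ i" by blast
    hence "x ^ ?N = (z ^ ?N) ^ i" by (simp only: power_mult[symmetric] mult.commute)
    thus "x \<in> {x. x ^ ?N = 1}" using assms(2) by (simp del: power_Suc)
  qed
  moreover have "finite {x :: 'a. x ^ ?N = 1}" using c N by (metis card.infinite less_numeral_extra(3))
  ultimately have "(\<lambda>i. z ^ i) ` {..<?N} = {x. x ^ ?N = 1}" using c by (intro card_subset_eq) auto
  hence "w \<in> (\<lambda>i. z ^ i) ` {..<?N}" using assms(4) by blast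
  thus ?thesis by blast
qed

text \<open>In a^p - 1 = (a - 1)(1 + a + ... + a^(p-1)) both factors are divisible by p, the second
  as a sum of p terms congruent to 1.\<close>

lemma power_prime_cong_1:
  fixes a p :: nat
  assumes "[a = 1] (mod p)"
  shows "[a ^ p = 1] (mod p\<^sup>2)"
proof -
  have ai: "[int a = 1] (mod int p)" using assms by (metis cong_int_iff of_nat_1)
  hence "[int a ^ i = 1] (mod int p)" for i using cong_pow[OF ai, of i] by simp
  hence "[(\<Sum>i<p. int a ^ i) = (\<Sum>i<p. 1)] (mod int p)" by (intro cong_sum)
  hence "int p dvd (\<Sum>i<p. int a ^ i)" by (simp add: cong_0_iff[symmetric] cong_def)
  moreover have "int p dvd int a - 1" using ai by (simp add: cong_iff_dvd_diff)
  ultimately have "int p * int p dvd (int a - 1) * (\<Sum>i<p. int a ^ i)" by (intro mult_dvd_mono)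
  hence "(int p)\<^sup>2 dvd int a ^ p - 1" by (simp only: power_diff_1_eq power2_eq_square)
  hence "[int (a ^ p) = int 1] (mod int (p\<^sup>2))" by (simp add: cong_iff_dvd_diff)
  thus ?thesis by (simp only: cong_int_iff)
qed

context monic_cubic_curve
begin

context
  fixes p :: nat
  assumes p: "prime p"
begin

section \<open>The p-torsion as a plane over the field with p elements\<close>

lemma p_pos: "p > 0" "p > 1"
  using p prime_gt_0_nat prime_gt_1_nat by auto

lemma smul_dvd: "X \<in> tors p \<Longrightarrow> p dvd a \<Longrightarrow> a \<cdot>\<^sub>E X = Infinity"
proof -
  assume X: "X \<in> tors p" and "p dvd a"
  then obtain k where "a = k * p" by (auto simp: dvd_def mult.commute)
  thus ?thesis using X by (simp add: tors_def flip: smul_smul)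
qed

lemma smul_cong: "X \<in> tors p \<Longrightarrow> [a = b] (mod p) \<Longrightarrow> a \<cdot>\<^sub>E X = b \<cdot>\<^sub>E X"
proof -
  assume X: "X \<in> tors p" and ab: "[a = b] (mod p)"
  have "c \<cdot>\<^sub>E X = (c mod p) \<cdot>\<^sub>E X" for c
  proof -
    have "c \<cdot>\<^sub>E X = (p * (c div p) + c mod p) \<cdot>\<^sub>E X" by simp
    also have "\<dots> = (c mod p) \<cdot>\<^sub>E X"
      using X smul_dvd[OF X, of "p * (c div p)"] tors_in_EC[OF X] by (subst smul_add) simp_all
    finally show ?thesis .
  qed
  thus ?thesis using ab by (metis cong_def)
qed

lemma smul_inverse:
  assumes "X \<in> tors p" "\<not> p dvd a"
  obtains u where "u \<cdot>\<^sub>E a \<cdot>\<^sub>E X = X"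
proof -
  have "coprime a p" using p assms(2) prime_imp_coprime coprime_commute by metis
  then obtain u where "[a * u = Suc 0] (mod p)" using cong_solve_coprime_nat by blast
  hence "(u * a) \<cdot>\<^sub>E X = Suc 0 \<cdot>\<^sub>E X" using assms(1) by (intro smul_cong) (simp_all add: mult.commute)
  hence "u \<cdot>\<^sub>E a \<cdot>\<^sub>E X = X" using tors_in_EC[OF assms(1)] by (simp add: smul_smul)
  thus ?thesis by (rule that)
qed

lemma smul_eq_Infinity:
  assumes "X \<in> tors p" "X \<noteq> Infinity" "a \<cdot>\<^sub>E X = Infinity"
  shows "p dvd a"
proof (rule ccontr)
  assume "\<not> p dvd a"
  then obtain u where "u \<cdot>\<^sub>E a \<cdot>\<^sub>E X = X" using smul_inverse assms(1) by blast
  thus False using assms by simp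
qed

definition indep :: "'a point \<Rightarrow> 'a point \<Rightarrow> bool" where
  "indep P Q \<longleftrightarrow> P \<in> tors p \<and> Q \<in> tors p \<and> P \<noteq> Infinity \<and> (\<forall>i. Q \<noteq> i \<cdot>\<^sub>E P)"

lemma coords_unique:
  assumes "indep P Q" "i \<cdot>\<^sub>E Q +\<^sub>E j \<cdot>\<^sub>E P = i' \<cdot>\<^sub>E Q +\<^sub>E j' \<cdot>\<^sub>E P"
  shows "[i = i'] (mod p)" "[j = j'] (mod p)"
proof -
  have P: "P \<in> tors p" "Q \<in> tors p" "P \<noteq> Infinity" using assms(1) by (auto simp: indep_def)
  have E: "P \<in> EC" "Q \<in> EC" using P tors_in_EC by auto
  \<comment> \<open>Scalars are natural numbers, so p - 1 plays the role of -1: modulo p,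
    \<open>a\<close> is i - i' and \<open>b\<close> is j' - j.\<close>
  define a where "a = i + (p - 1) * i'"
  define b where "b = j' + (p - 1) * j"
  have pk: "k + (p - 1) * k = p * k" for k using p_pos by (cases p) auto
  have "(i \<cdot>\<^sub>E Q +\<^sub>E j \<cdot>\<^sub>E P) +\<^sub>E (((p - 1) * i') \<cdot>\<^sub>E Q +\<^sub>E ((p - 1) * j) \<cdot>\<^sub>E P)
      = (i' \<cdot>\<^sub>E Q +\<^sub>E j' \<cdot>\<^sub>E P) +\<^sub>E (((p - 1) * i') \<cdot>\<^sub>E Q +\<^sub>E ((p - 1) * j) \<cdot>\<^sub>E P)" using assms(2) by simp
  moreover have "(x \<cdot>\<^sub>E Q +\<^sub>E y \<cdot>\<^sub>E P) +\<^sub>E (x' \<cdot>\<^sub>E Q +\<^sub>E y' \<cdot>\<^sub>E P) = (x + x') \<cdot>\<^sub>E Q +\<^sub>E (y + y') \<cdot>\<^sub>E P" for x y x' y'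
    using E by (simp add: smul_add padd_ac)
  ultimately have "a \<cdot>\<^sub>E Q +\<^sub>E (p * j) \<cdot>\<^sub>E P = (p * i') \<cdot>\<^sub>E Q +\<^sub>E b \<cdot>\<^sub>E P"
    by (simp only: a_def b_def pk)
  hence ab: "a \<cdot>\<^sub>E Q = b \<cdot>\<^sub>E P" using smul_dvd[OF P(1), of "p * j"] smul_dvd[OF P(2), of "p * i'"] by simp
  have pa: "p dvd a"
  proof (rule ccontr)
    assume "\<not> p dvd a"
    then obtain u where "u \<cdot>\<^sub>E a \<cdot>\<^sub>E Q = Q" using smul_inverse P(2) by blast
    hence "Q = (u * b) \<cdot>\<^sub>E P" using ab E by (simp add: smul_smul)
    thus False using assms(1) by (auto simp: indep_def)
  qed
  hence "b \<cdot>\<^sub>E P = Infinity" using ab smul_dvd[OF P(2)] by simp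
  hence pb: "p dvd b" using smul_eq_Infinity P by blast
  have key: "[x = y] (mod p)" if "p dvd x + (p - 1) * y" for x y
  proof -
    have "[x + (p - 1) * y + y = 0 + y] (mod p)" using that by (intro cong_add) (auto simp: cong_0_iff)
    moreover have "x + (p - 1) * y + y = x + p * y" using pk[of y] by simp
    ultimately have "[x + p * y = y] (mod p)" by (simp only: add_0)
    thus ?thesis by (simp add: cong_def)
  qed
  show "[i = i'] (mod p)" using key pa by (simp add: a_def)
  show "[j = j'] (mod p)" using cong_sym[OF key[OF pb[unfolded b_def]]] .
qed

lemma indep_inj:
  assumes "indep P Q"
  shows "inj_on (\<lambda>(i, j). i \<cdot>\<^sub>E Q +\<^sub>E j \<cdot>\<^sub>E P) ({..<p} \<times> {..<p})"
proof (rule inj_onI, clarify)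
  fix i j i' j' assume ij: "i < p" "j < p" "i' < p" "j' < p" "i \<cdot>\<^sub>E Q +\<^sub>E j \<cdot>\<^sub>E P = i' \<cdot>\<^sub>E Q +\<^sub>E j' \<cdot>\<^sub>E P"
  from coords_unique[OF assms ij(5)] ij(1-4) show "i = i' \<and> j = j'"
    by (auto intro: cong_less_modulus_unique_nat)
qed

lemma tors_coords:
  assumes "indep P Q" "X \<in> tors p"
  shows "\<exists>i j. i < p \<and> j < p \<and> X = i \<cdot>\<^sub>E Q +\<^sub>E j \<cdot>\<^sub>E P"
proof -
  let ?f = "\<lambda>(i, j). i \<cdot>\<^sub>E Q +\<^sub>E j \<cdot>\<^sub>E P"
  have P: "P \<in> tors p" "Q \<in> tors p" using assms(1) by (auto simp: indep_def)
  have "?f ` ({..<p} \<times> {..<p}) \<subseteq> tors p" using P by (auto intro: padd_in_tors smul_in_tors)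
  moreover have "card (?f ` ({..<p} \<times> {..<p})) = card (tors p)"
    using card_image[OF indep_inj[OF assms(1)]] card_tors[of p] p_pos by (simp add: power2_eq_square)
  ultimately have "?f ` ({..<p} \<times> {..<p}) = tors p"
    using finite_tors[of p] p_pos by (intro card_subset_eq) auto
  hence "X \<in> ?f ` ({..<p} \<times> {..<p})" using assms(2) by simp
  then obtain q where "q \<in> {..<p} \<times> {..<p}" "X = ?f q" by blast
  thus ?thesis by (cases q) auto
qed

lemma exists_indep:
  assumes "P \<in> tors p" "P \<noteq> Infinity"
  obtains Q where "indep P Q"
proof -
  have "\<exists>Q\<in>tors p. \<forall>i. Q \<noteq> i \<cdot>\<^sub>E P"
  proof (rule ccontr)
    assume "\<not> ?thesis"
    hence *: "\<forall>Q\<in>tors p. \<exists>i. Q = i \<cdot>\<^sub>E P" by blast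
    have "tors p \<subseteq> (\<lambda>i. i \<cdot>\<^sub>E P) ` {..<p}"
    proof
      fix Q assume "Q \<in> tors p"
      then obtain i where "Q = i \<cdot>\<^sub>E P" using * by blast
      moreover have "i \<cdot>\<^sub>E P = (i mod p) \<cdot>\<^sub>E P" using assms(1) by (intro smul_cong) (simp_all add: cong_def)
      ultimately show "Q \<in> (\<lambda>i. i \<cdot>\<^sub>E P) ` {..<p}" using p_pos by (intro image_eqI[of _ _ "i mod p"]) auto
    qed
    hence "card (tors p) \<le> card ((\<lambda>i. i \<cdot>\<^sub>E P) ` {..<p})" by (intro card_mono) auto
    also have "\<dots> \<le> p" using card_image_le[of "{..<p}"] by simp
    finally have "p\<^sup>2 \<le> p" using card_tors[of p] p_pos by simp
    thus False using p_pos by (simp add: power2_eq_square)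
  qed
  thus ?thesis using that assms unfolding indep_def by blast
qed

lemma exists_p_torsion:
  obtains P where "P \<in> tors p" "P \<noteq> Infinity"
proof -
  have "\<exists>P\<in>tors p. P \<noteq> Infinity"
  proof (rule ccontr)
    assume "\<not> ?thesis"
    hence "tors p \<subseteq> {Infinity}" by blast
    hence "card (tors p) \<le> card {Infinity :: 'a point}" by (intro card_mono) auto
    hence "p * p \<le> 1" using card_tors[of p] p_pos by (simp add: power2_eq_square)
    moreover have "2 * 2 \<le> p * p" using p_pos by (intro mult_le_mono) auto
    ultimately show False by simp
  qed
  thus ?thesis using that by blast
qed

text \<open>Nondegeneracy: with a trivial pairing all p^2 points of E[p] would be combinations of
  two points whose operators commute, beyond the isotropic bound p.\<close>

lemma weil_indep:
  assumes "indep P Q"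
  shows "weil p P Q \<noteq> 1"
proof
  assume e: "weil p P Q = 1"
  have P: "P \<in> tors p" "Q \<in> tors p" using assms by (auto simp: indep_def)
  have "tors p \<subseteq> {i \<cdot>\<^sub>E P +\<^sub>E j \<cdot>\<^sub>E Q | i j. True}"
  proof
    fix X assume "X \<in> tors p"
    then obtain i j where "X = i \<cdot>\<^sub>E Q +\<^sub>E j \<cdot>\<^sub>E P" using tors_coords[OF assms] by blast
    hence "X = j \<cdot>\<^sub>E P +\<^sub>E i \<cdot>\<^sub>E Q" using P tors_in_EC by (simp add: padd_commute)
    thus "X \<in> {i \<cdot>\<^sub>E P +\<^sub>E j \<cdot>\<^sub>E Q | i j. True}" by blast
  qed
  from weil_isotropic_bound[OF P p_pos(1) e _ this] have "card (tors p) \<le> p"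
    using finite_tors p_pos by auto
  thus False using card_tors[of p] p_pos by (simp add: power2_eq_square)
qed

text \<open>P and Q are p-th parts of a basis of E[p]. Were the p-th power of their pairing 1, then
  P would pair trivially with Q0 = pQ, although the two generate p^3 points, beyond the isotropic
  bound p^2. So the pairing takes a primitive root of unity of order p^2 as a value.\<close>

lemma weil_level_p2:
  obtains P Q where "P \<in> tors (p\<^sup>2)" "Q \<in> tors (p\<^sup>2)" "weil (p\<^sup>2) P Q ^ p \<noteq> 1"
proof -
  obtain P0 where P0: "P0 \<in> tors p" "P0 \<noteq> Infinity" by (rule exists_p_torsion)
  obtain Q0 where I: "indep P0 Q0" using exists_indep[OF P0] .
  have Q0: "Q0 \<in> tors p" using I by (simp add: indep_def)
  have E0: "P0 \<in> EC" "Q0 \<in> EC" using P0 Q0 tors_in_EC by auto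
  obtain P where P: "P \<in> EC" "p \<cdot>\<^sub>E P = P0" using smul_surj[of p P0] E0 p_pos by auto
  obtain Q where Q: "Q \<in> EC" "p \<cdot>\<^sub>E Q = Q0" using smul_surj[of p Q0] E0 p_pos by auto
  have lift: "R \<in> tors (p\<^sup>2)" if "R \<in> EC" "p \<cdot>\<^sub>E R \<in> tors p" for R
    using that by (simp add: tors_def smul_smul power2_eq_square)
  have PQ: "P \<in> tors (p\<^sup>2)" "Q \<in> tors (p\<^sup>2)" using lift P Q P0 Q0 by auto
  have Q02: "Q0 \<in> tors (p\<^sup>2)" using Q0 by (rule tors_dvd) (simp add: power2_eq_square)
  have "weil (p\<^sup>2) P Q ^ p \<noteq> 1"
  proof
    assume "weil (p\<^sup>2) P Q ^ p = 1"
    hence e: "weil (p\<^sup>2) P Q0 = 1" using weil_smul_right[OF PQ, of p] Q by simp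
    let ?f = "\<lambda>(i, j). i \<cdot>\<^sub>E P +\<^sub>E j \<cdot>\<^sub>E Q0"
    let ?A = "?f ` ({..<p\<^sup>2} \<times> {..<p})"
    have "inj_on ?f ({..<p\<^sup>2} \<times> {..<p})"
    proof (rule inj_onI, clarify)
      fix i j i' j' assume ij: "i < p\<^sup>2" "j < p" "i' < p\<^sup>2" "j' < p" "i \<cdot>\<^sub>E P +\<^sub>E j \<cdot>\<^sub>E Q0 = i' \<cdot>\<^sub>E P +\<^sub>E j' \<cdot>\<^sub>E Q0"
      \<comment> \<open>Multiplication by p kills the Q0 part and determines i modulo p; what
        remains, j and the quotient of i by p, is read off in the basis P0, Q0 of E[p].\<close>
      have m: "p \<cdot>\<^sub>E (i \<cdot>\<^sub>E P +\<^sub>E j \<cdot>\<^sub>E Q0) = 0 \<cdot>\<^sub>E Q0 +\<^sub>E i \<cdot>\<^sub>E P0" for i j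
      proof -
        have "p \<cdot>\<^sub>E i \<cdot>\<^sub>E P = i \<cdot>\<^sub>E p \<cdot>\<^sub>E P" unfolding smul_smul[OF P(1)] by (simp only: mult.commute)
        moreover have "p \<cdot>\<^sub>E j \<cdot>\<^sub>E Q0 = Infinity" using smul_in_tors[OF Q0] by (simp add: tors_def)
        moreover have "p \<cdot>\<^sub>E (i \<cdot>\<^sub>E P +\<^sub>E j \<cdot>\<^sub>E Q0) = p \<cdot>\<^sub>E i \<cdot>\<^sub>E P +\<^sub>E p \<cdot>\<^sub>E j \<cdot>\<^sub>E Q0"
          by (rule smul_padd) (use P E0 in simp_all)
        ultimately show ?thesis unfolding P(2) by (simp only: smul_0 padd.simps(1) padd_Infinity_right)
      qed
      have "0 \<cdot>\<^sub>E Q0 +\<^sub>E i \<cdot>\<^sub>E P0 = 0 \<cdot>\<^sub>E Q0 +\<^sub>E i' \<cdot>\<^sub>E P0" using m[of i j] m[of i' j'] ij(5) by metis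
      from coords_unique(2)[OF I this] have im: "i mod p = i' mod p" by (simp add: cong_def)
      have s: "i \<cdot>\<^sub>E P +\<^sub>E j \<cdot>\<^sub>E Q0 = (i mod p) \<cdot>\<^sub>E P +\<^sub>E (j \<cdot>\<^sub>E Q0 +\<^sub>E (i div p) \<cdot>\<^sub>E P0)" for i j
      proof -
        have "i \<cdot>\<^sub>E P = (i mod p + (i div p) * p) \<cdot>\<^sub>E P" by simp
        also have "\<dots> = (i mod p) \<cdot>\<^sub>E P +\<^sub>E (i div p) \<cdot>\<^sub>E p \<cdot>\<^sub>E P" unfolding smul_smul[OF P(1)] smul_add[OF P(1)] ..
        finally have iP: "i \<cdot>\<^sub>E P = (i mod p) \<cdot>\<^sub>E P +\<^sub>E (i div p) \<cdot>\<^sub>E P0" unfolding P(2) .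
        show ?thesis
          unfolding iP padd_commute[OF smul_in_EC[OF E0(2)] smul_in_EC[OF E0(1)]]
          by (rule padd_assoc) (use P E0 in simp_all)
      qed
      have "(i mod p) \<cdot>\<^sub>E P +\<^sub>E (j \<cdot>\<^sub>E Q0 +\<^sub>E (i div p) \<cdot>\<^sub>E P0) = (i mod p) \<cdot>\<^sub>E P +\<^sub>E (j' \<cdot>\<^sub>E Q0 +\<^sub>E (i' div p) \<cdot>\<^sub>E P0)"
        using ij(5) unfolding s[of i j] s[of i' j'] im .
      hence "j \<cdot>\<^sub>E Q0 +\<^sub>E (i div p) \<cdot>\<^sub>E P0 = j' \<cdot>\<^sub>E Q0 +\<^sub>E (i' div p) \<cdot>\<^sub>E P0"
        using EG.l_cancel[of "(i mod p) \<cdot>\<^sub>E P"] P E0 by simp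
      from coords_unique[OF I this] have c: "[j = j'] (mod p)" "[i div p = i' div p] (mod p)" .
      have "j = j'" using c(1) ij by (auto intro: cong_less_modulus_unique_nat)
      moreover have "i div p < p" "i' div p < p" using ij by (simp_all add: less_mult_imp_div_less power2_eq_square)
      hence "i div p = i' div p" using c(2) by (auto intro: cong_less_modulus_unique_nat)
      hence "i = i'" using im by (metis div_mult_mod_eq)
      ultimately show "i = i' \<and> j = j'" by simp
    qed
    hence "card ?A = p\<^sup>2 * p" by (simp add: card_image)
    moreover have "card ?A \<le> p\<^sup>2"
      using p_pos by (intro weil_isotropic_bound[OF PQ(1) Q02 _ e]) auto
    ultimately show False using p_pos by simp
  qed
  thus ?thesis using that PQ by blast
qed

text \<open>For P in E[p^j] the difference \<sigma>P - P lies in E[p], which \<sigma> fixes, so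
  \<sigma>^p fixes E[p^j] and by hypothesis E[p^(j+1)]. But \<sigma>^p sends Q with pQ = P to Q +
  (\<sigma>P - P) up to a multiple by \<open>p choose 2\<close>, which vanishes for odd p. That j is
  at least 2 puts E[p] inside E[p^(j-1)].\<close>

lemma torsion_fix_descent:
  assumes odd: "p \<ge> 3" and j: "j \<ge> 2"
    and H: "\<And>\<sigma>. gal \<sigma> \<Longrightarrow> \<forall>P\<in>tors (p ^ j). map_point \<sigma> P = P \<Longrightarrow> \<forall>P\<in>tors (p ^ (j + 1)). map_point \<sigma> P = P"
    and \<sigma>: "gal \<sigma>" and fix1: "\<forall>P\<in>tors (p ^ (j - 1)). map_point \<sigma> P = P"
  shows "\<forall>P\<in>tors (p ^ j). map_point \<sigma> P = P"
proof
  define S where "S = map_point \<sigma>"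
  have SE: "S P \<in> EC" if "P \<in> EC" for P using that map_point_in_EC[OF \<sigma>] by (simp add: S_def)
  have Sadd: "S (P +\<^sub>E Q) = S P +\<^sub>E S Q" for P Q unfolding S_def by (rule map_point_padd[OF \<sigma>])
  have Ssmul: "S (n \<cdot>\<^sub>E P) = n \<cdot>\<^sub>E S P" for n P unfolding S_def by (rule map_point_smul[OF \<sigma>])
  have pj: "p ^ j = p * p ^ (j - 1)" "p dvd p ^ (j - 1)"
    using j by (auto simp: power_eq_if dvd_power)
  have fixp: "S X = X" if "X \<in> tors p" for X
    using fix1 tors_dvd[OF that pj(2)] by (simp add: S_def)
  have diff: "\<exists>\<delta>\<in>tors p. S P = P +\<^sub>E \<delta>" if "P \<in> EC" "S (p \<cdot>\<^sub>E P) = p \<cdot>\<^sub>E P" for P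
  proof -
    define \<delta> where "\<delta> = S P +\<^sub>E (-\<^sub>E P)"
    have "\<delta> \<in> EC" using that SE by (simp add: \<delta>_def)
    moreover have "p \<cdot>\<^sub>E \<delta> = Infinity"
      using that SE by (simp add: \<delta>_def smul_padd smul_pneg flip: Ssmul)
    moreover have "S P = P +\<^sub>E \<delta>"
      using padd_cancel'[of "S P" P] that SE by (simp add: \<delta>_def padd_commute[of P])
    ultimately show ?thesis by (auto simp: tors_def)
  qed
  have iter: "(S ^^ k) P = P +\<^sub>E k \<cdot>\<^sub>E \<delta>" if "P \<in> EC" "\<delta> \<in> tors p" "S P = P +\<^sub>E \<delta>" for P \<delta> k
  proof (induction k)
    case (Suc k)
    have d: "\<delta> \<in> EC" using that tors_in_EC by auto
    have "(S ^^ Suc k) P = S (P +\<^sub>E k \<cdot>\<^sub>E \<delta>)" using Suc by simp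
    also have "\<dots> = P +\<^sub>E \<delta> +\<^sub>E k \<cdot>\<^sub>E \<delta>" using that fixp[OF that(2)] by (simp add: Sadd Ssmul)
    also have "\<dots> = P +\<^sub>E Suc k \<cdot>\<^sub>E \<delta>" using that d by (simp add: padd_assoc padd_commute[of \<delta>])
    finally show ?case .
  qed simp
  have mulp: "S (p \<cdot>\<^sub>E P) = p \<cdot>\<^sub>E P" if "P \<in> tors (p ^ j)" for P
  proof -
    have "p \<cdot>\<^sub>E P \<in> tors (p ^ (j - 1))"
      using that pj(1) by (simp add: tors_def smul_smul mult.commute)
    thus ?thesis using fix1 by (simp add: S_def)
  qed
  have "map_point (\<sigma> ^^ p) P = P" if P: "P \<in> tors (p ^ j)" for P
  proof -
    have PE: "P \<in> EC" using P tors_in_EC by auto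
    obtain \<delta> where \<delta>: "\<delta> \<in> tors p" "S P = P +\<^sub>E \<delta>" using diff[OF PE mulp[OF P]] by blast
    have "(S ^^ p) P = P" using iter[OF PE \<delta>, of p] \<delta>(1) by (simp add: tors_def)
    thus ?thesis by (simp add: map_point_funpow S_def)
  qed
  hence fixSp: "\<forall>Q\<in>tors (p ^ (j + 1)). (S ^^ p) Q = Q"
    using H[OF gal_funpow[OF \<sigma>]] by (simp add: map_point_funpow S_def)
  fix P assume P: "P \<in> tors (p ^ j)"
  have PE: "P \<in> EC" using P tors_in_EC by auto
  obtain Q where Q: "Q \<in> EC" "p \<cdot>\<^sub>E Q = P" using smul_surj[of p P] PE p_pos by auto
  have "p ^ (j + 1) \<cdot>\<^sub>E Q = p ^ j \<cdot>\<^sub>E p \<cdot>\<^sub>E Q" unfolding smul_smul[OF Q(1)] by (simp add: mult.commute)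
  hence Qt: "Q \<in> tors (p ^ (j + 1))" using P Q by (simp add: tors_def)
  define \<epsilon> where "\<epsilon> = S Q +\<^sub>E (-\<^sub>E Q)"
  have eE: "\<epsilon> \<in> EC" using Q SE by (simp add: \<epsilon>_def)
  have SQ: "S Q = Q +\<^sub>E \<epsilon>"
    using padd_cancel'[of "S Q" Q] Q SE by (simp add: \<epsilon>_def padd_commute[of Q])
  obtain \<delta> where \<delta>: "\<delta> \<in> tors p" "S P = P +\<^sub>E \<delta>" using diff[OF PE mulp[OF P]] by blast
  have dE: "\<delta> \<in> EC" using \<delta> tors_in_EC by auto
  have pe: "p \<cdot>\<^sub>E \<epsilon> = \<delta>"
  proof -
    have "p \<cdot>\<^sub>E \<epsilon> = S P +\<^sub>E (-\<^sub>E P)" unfolding \<epsilon>_def using Q SE by (simp add: smul_padd smul_pneg flip: Ssmul)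
    also have "\<dots> = \<delta>" using \<delta>(2) padd_cancel[OF dE PE] PE dE by (simp add: padd_commute[of P \<delta>])
    finally show ?thesis .
  qed
  obtain \<delta>' where \<delta>': "\<delta>' \<in> tors p" "S \<epsilon> = \<epsilon> +\<^sub>E \<delta>'"
    using diff[OF eE] pe fixp[OF \<delta>(1)] by auto
  have d'E: "\<delta>' \<in> EC" using \<delta>' tors_in_EC by auto
  \<comment> \<open>With N = \<sigma> - 1 one has NQ = \<epsilon>, N\<epsilon> = \<delta>' and
    N\<delta>' = \<infinity>, so the binomial expansion of (1 + N)^k Q stops after the quadratic
    term.\<close>
  have "(S ^^ k) Q = Q +\<^sub>E (k \<cdot>\<^sub>E \<epsilon> +\<^sub>E (k choose 2) \<cdot>\<^sub>E \<delta>')" for k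
  proof (induction k)
    case 0
    show ?case using Q by (simp add: binomial_eq_0)
  next
    case (Suc k)
    have "(S ^^ Suc k) Q = S (Q +\<^sub>E (k \<cdot>\<^sub>E \<epsilon> +\<^sub>E (k choose 2) \<cdot>\<^sub>E \<delta>'))" using Suc by simp
    also have "\<dots> = (Q +\<^sub>E \<epsilon>) +\<^sub>E ((k \<cdot>\<^sub>E \<epsilon> +\<^sub>E k \<cdot>\<^sub>E \<delta>') +\<^sub>E (k choose 2) \<cdot>\<^sub>E \<delta>')"
      using SQ \<delta>'(2) fixp[OF \<delta>'(1)] eE d'E by (simp add: Sadd Ssmul smul_padd)
    also have "\<dots> = Q +\<^sub>E (Suc k \<cdot>\<^sub>E \<epsilon> +\<^sub>E (k + (k choose 2)) \<cdot>\<^sub>E \<delta>')"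
      using Q eE d'E by (simp add: smul_add padd_ac)
    also have "k + (k choose 2) = Suc k choose 2" by (simp add: numeral_2_eq_2)
    finally show ?case .
  qed
  from this[of p] have "(S ^^ p) Q = Q +\<^sub>E (\<delta> +\<^sub>E (p choose 2) \<cdot>\<^sub>E \<delta>')" unfolding pe .
  moreover have "p dvd (p choose 2)"
  proof -
    have "odd p" using p odd prime_odd_nat[of p] by auto
    hence "p choose 2 = p * ((p - 1) div 2)" by (simp add: choose_two div_mult_swap)
    thus ?thesis by simp
  qed
  hence "(p choose 2) \<cdot>\<^sub>E \<delta>' = Infinity" using smul_dvd \<delta>'(1) by blast
  ultimately have "(S ^^ p) Q = Q +\<^sub>E \<delta>" by simp
  hence "Q +\<^sub>E \<delta> = Q +\<^sub>E Infinity" using fixSp Qt by auto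
  hence "\<delta> = Infinity" using EG.l_cancel[of Q \<delta> Infinity] Q dE by simp
  thus "map_point \<sigma> P = P" using \<delta>(2) PE by (simp add: S_def)
qed

lemma torsion_fix_descent_1:
  assumes "p \<ge> 3" "n \<ge> 1"
    and "\<And>\<sigma>. gal \<sigma> \<Longrightarrow> \<forall>P\<in>tors (p ^ n). map_point \<sigma> P = P \<Longrightarrow> \<forall>P\<in>tors (p ^ (n + 1)). map_point \<sigma> P = P"
    and "gal \<sigma>" "\<forall>P\<in>tors p. map_point \<sigma> P = P"
  shows "\<forall>P\<in>tors (p\<^sup>2). map_point \<sigma> P = P"
proof -
  have "\<forall>\<sigma>. gal \<sigma> \<longrightarrow> (\<forall>P\<in>tors (p ^ j). map_point \<sigma> P = P) \<longrightarrow> (\<forall>P\<in>tors (p ^ (j + 1)). map_point \<sigma> P = P)"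
    if "1 \<le> j" "j \<le> n" for j
    using that(2,1)
  proof (induction j rule: inc_induct)
    case base
    show ?case using assms(3) by blast
  next
    case (step j)
    have IH: "gal \<tau> \<Longrightarrow> \<forall>P\<in>tors (p ^ Suc j). map_point \<tau> P = P \<Longrightarrow> \<forall>P\<in>tors (p ^ (Suc j + 1)). map_point \<tau> P = P" for \<tau>
      using step by simp
    show ?case
    proof (intro allI impI)
      fix \<tau> assume t: "gal \<tau>" "\<forall>P\<in>tors (p ^ j). map_point \<tau> P = P"
      have j2: "Suc j \<ge> 2" using step.prems by simp
      have t2: "\<forall>P\<in>tors (p ^ (Suc j - 1)). map_point \<tau> P = P" using t(2) by simp
      have "\<forall>P\<in>tors (p ^ Suc j). map_point \<tau> P = P"
        by (rule torsion_fix_descent[OF assms(1) j2 IH t(1) t2])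
      thus "\<forall>P\<in>tors (p ^ (j + 1)). map_point \<tau> P = P" by simp
    qed
  qed
  from this[of 1] assms(2,4,5) show ?thesis by (simp add: power2_eq_square)
qed

text \<open>
  The image of \<open>\<sigma>\<close> in the linear group of the \<open>p\<close>-torsion has order divisible by \<open>p\<close>, which
  forces a double eigenvalue \<open>\<beta>\<close>; its determinant is \<open>g\<close>, so \<open>g\<close> would be the square \<open>\<beta>\<^sup>2\<close>.
\<close>

theorem no_coincidence:
  assumes odd: "p \<ge> 3" and n: "n \<ge> 1"
    and H: "\<And>\<sigma>. gal \<sigma> \<Longrightarrow> \<forall>P\<in>tors (p ^ n). map_point \<sigma> P = P \<Longrightarrow> \<forall>P\<in>tors (p ^ (n + 1)). map_point \<sigma> P = P"
    and g: "\<And>k. [g ^ k = 1] (mod p\<^sup>2) \<Longrightarrow> p * (p - 1) dvd k" "coprime g p"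
    and cyc: "\<And>z. z ^ (p\<^sup>2) = 1 \<Longrightarrow> z ^ p \<noteq> 1 \<Longrightarrow> \<exists>\<sigma>. gal \<sigma> \<and> \<sigma> z = z ^ g"
  shows False
proof -
  have H1: "\<forall>P\<in>tors (p\<^sup>2). map_point \<sigma> P = P" if "gal \<sigma>" "\<forall>P\<in>tors p. map_point \<sigma> P = P" for \<sigma>
    by (rule torsion_fix_descent_1[OF odd n H that])
  obtain P Q where PQ: "P \<in> tors (p\<^sup>2)" "Q \<in> tors (p\<^sup>2)" "weil (p\<^sup>2) P Q ^ p \<noteq> 1" by (rule weil_level_p2)
  define z where "z = weil (p\<^sup>2) P Q"
  have z: "z ^ (p ^ Suc 1) = 1" "z ^ (p ^ 1) \<noteq> 1"
    using weil_power_N[OF PQ(1,2)] PQ(3) by (simp_all add: z_def numeral_2_eq_2)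
  obtain \<sigma> where \<sigma>: "gal \<sigma>" "\<sigma> z = z ^ g" using cyc[of z] z by (auto simp: power2_eq_square)
  define S where "S = map_point \<sigma>"
  have fp: "(\<sigma> ^^ k) z = z ^ (g ^ k)" for k
  proof (induction k)
    case (Suc k)
    have "(\<sigma> ^^ Suc k) z = \<sigma> (z ^ (g ^ k))" using Suc by simp
    also have "\<dots> = z ^ (g ^ Suc k)"
      using field_aut_power[OF fa[OF \<sigma>(1)]] \<sigma>(2) by (simp add: power_mult)
    finally show ?case .
  qed simp
  \<comment> \<open>A power of \<sigma> that fixes E[p^2] fixes the pairing value z, so its exponent
    is a multiple of p(p - 1) by the choice of g.\<close>
  have fixz: "p * (p - 1) dvd k" if "\<forall>R\<in>tors (p\<^sup>2). (S ^^ k) R = R" for k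
  proof -
    have "(\<sigma> ^^ k) z = z"
      using weil_galois[OF gal_funpow[OF \<sigma>(1)] PQ(1,2), of k] that PQ
      by (simp add: z_def S_def map_point_funpow)
    hence "z ^ (g ^ k) = z ^ 1" using fp by simp
    hence "[g ^ k = 1] (mod p ^ Suc 1)" by (rule root_of_unity_power_eq[OF p z])
    thus ?thesis using g(1) by (simp add: numeral_2_eq_2)
  qed
  have Stor: "S R \<in> tors N" if "R \<in> tors N" for R N using that map_point_in_tors[OF \<sigma>(1)] by (simp add: S_def)
  have Sinj: "S R = S R' \<longleftrightarrow> R = R'" for R R' unfolding S_def by (rule map_point_eq_iff[OF \<sigma>(1)])
  have fin: "finite (tors (p\<^sup>2))" "finite (tors p)" using finite_tors p_pos by auto
  have "S ` tors (p\<^sup>2) = tors (p\<^sup>2)"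
    using Stor Sinj fin by (intro card_subset_eq) (auto simp: card_image inj_on_def)
  hence "bij_betw S (tors (p\<^sup>2)) (tors (p\<^sup>2))" using Sinj by (auto simp: bij_betw_def inj_on_def)
  then obtain d where d: "d > 0" "\<forall>R\<in>tors (p\<^sup>2). (S ^^ d) R = R"
    using exists_finite_order[OF fin(1)] by blast
  obtain k m where km: "d = p ^ k * m" "\<not> p dvd m"
    using multiplicity_decompose'[of d p] d(1) p by (metis not_prime_unit less_numeral_extra(3))
  \<comment> \<open>Along the exponents m, mp, mp^2, ... the action on E[p] becomes trivial; the
    last power before that, T, is nontrivial with T^p = 1. The start is nontrivial, since \<sigma>^m
    fixing E[p] would fix E[p^2] and force p to divide m.\<close>
  define fixj where "fixj = (\<lambda>j. \<forall>R\<in>tors p. (S ^^ (m * p ^ j)) R = R)"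
  have "fixj k"
    using d(2) tors_dvd[of _ p "p\<^sup>2"] km(1) by (auto simp: fixj_def mult.commute power2_eq_square)
  moreover have "\<not> fixj 0"
  proof
    assume "fixj 0"
    hence "\<forall>R\<in>tors (p\<^sup>2). (S ^^ m) R = R"
      using H1[OF gal_funpow[OF \<sigma>(1)], of m] by (simp add: fixj_def S_def map_point_funpow)
    hence "p dvd m" using fixz dvd_mult_left by blast
    thus False using km by simp
  qed
  ultimately obtain j where j: "\<not> fixj j" "fixj (Suc j)"
    using ex_least_nat_less[of fixj k] by blast
  define T where "T = S ^^ (m * p ^ j)"
  have comp: "(S ^^ a) ((S ^^ b) R) = (S ^^ (a + b)) R" for a b R by (simp add: funpow_add)
  have Tp: "(T ^^ p) R = R" if "R \<in> tors p" for R
  proof -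
    have "T ^^ p = S ^^ (m * p ^ j * p)" unfolding T_def by (simp add: funpow_mult mult.commute)
    thus ?thesis using j(2) that by (simp add: fixj_def mult_ac)
  qed
  have Sadd: "S (R +\<^sub>E R') = S R +\<^sub>E S R'" for R R' unfolding S_def by (rule map_point_padd[OF \<sigma>(1)])
  have Ssmul: "S (a \<cdot>\<^sub>E R) = a \<cdot>\<^sub>E S R" for a R unfolding S_def by (rule map_point_smul[OF \<sigma>(1)])
  have Tm: "T = map_point (\<sigma> ^^ (m * p ^ j))" by (simp add: T_def S_def map_point_funpow)
  have Tadd: "T (R +\<^sub>E R') = T R +\<^sub>E T R'" for R R' unfolding Tm by (rule map_point_padd[OF gal_funpow[OF \<sigma>(1)]])
  have Tsmul: "T (a \<cdot>\<^sub>E R) = a \<cdot>\<^sub>E T R" for a R unfolding Tm by (rule map_point_smul[OF gal_funpow[OF \<sigma>(1)]])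
  have TS: "T (S R) = S (T R)" for R unfolding T_def by (simp add: funpow_swap1)
  have Ttor: "T R \<in> tors N" if "R \<in> tors N" for R N
    unfolding Tm using that map_point_in_tors[OF gal_funpow[OF \<sigma>(1)]] by blast
  \<comment> \<open>T has a nonzero fixed vector: the number of moved points is divisible by p,
    hence also the number of fixed points, and \<infinity> is one of them.\<close>
  obtain P1' where P1': "P1' \<in> tors p" "P1' \<noteq> Infinity" "T P1' = P1'"
  proof -
    let ?F = "{R \<in> tors p. T R = R}" and ?M = "{R \<in> tors p. T R \<noteq> R}"
    have pM: "p dvd card ?M" using fin(2) p Ttor Tp by (intro prime_dvd_card_moved) auto
    have cs: "card (tors p) = card ?F + card ?M"
      using fin(2) by (subst card_Un_disjoint[symmetric]) (auto intro: arg_cong[where f = card])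
    have "p dvd card (tors p)" using card_tors[of p] p_pos by (simp add: power2_eq_square)
    hence pF: "p dvd card ?F" unfolding cs dvd_add_left_iff[OF pM] .
    have "T Infinity = Infinity" unfolding Tm by simp
    hence inF: "Infinity \<in> ?F" by simp
    have "?F \<noteq> {Infinity}"
    proof
      assume F: "?F = {Infinity}"
      have "card ?F = 1" unfolding F by simp
      thus False using pF p_pos by simp
    qed
    thus ?thesis using that inF by blast
  qed
  obtain Q0 where I': "indep P1' Q0" using exists_indep[OF P1'(1,2)] .
  have Q0: "Q0 \<in> tors p" "Q0 \<in> EC" using I' tors_in_EC by (auto simp: indep_def)
  have P1'E: "P1' \<in> EC" using P1' tors_in_EC by auto
  obtain a b where ab: "a < p" "b < p" "T Q0 = a \<cdot>\<^sub>E Q0 +\<^sub>E b \<cdot>\<^sub>E P1'"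
    using tors_coords[OF I' Ttor[OF Q0(1)]] by blast
  \<comment> \<open>T is triangular with diagonal entries 1 and a. From T^p = 1 follows a^p = 1, and
    by Fermat a = 1 modulo p: T is unipotent.\<close>
  have "\<exists>e. (T ^^ i) Q0 = a ^ i \<cdot>\<^sub>E Q0 +\<^sub>E e \<cdot>\<^sub>E P1'" for i
  proof (induction i)
    case 0
    show ?case using Q0 by (intro exI[of _ 0]) simp
  next
    case (Suc i)
    then obtain e where e: "(T ^^ i) Q0 = a ^ i \<cdot>\<^sub>E Q0 +\<^sub>E e \<cdot>\<^sub>E P1'" by blast
    have "(T ^^ Suc i) Q0 = a ^ i \<cdot>\<^sub>E (a \<cdot>\<^sub>E Q0 +\<^sub>E b \<cdot>\<^sub>E P1') +\<^sub>E e \<cdot>\<^sub>E P1'"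
      using e ab(3) P1'(3) by (simp add: Tadd Tsmul)
    also have "\<dots> = a ^ Suc i \<cdot>\<^sub>E Q0 +\<^sub>E (a ^ i * b + e) \<cdot>\<^sub>E P1'"
      using Q0 P1'E by (simp add: smul_padd smul_smul smul_add padd_assoc mult.commute)
    finally show ?case by blast
  qed
  then obtain e where e: "(T ^^ p) Q0 = a ^ p \<cdot>\<^sub>E Q0 +\<^sub>E e \<cdot>\<^sub>E P1'" by blast
  have "a ^ p \<cdot>\<^sub>E Q0 +\<^sub>E e \<cdot>\<^sub>E P1' = 1 \<cdot>\<^sub>E Q0 +\<^sub>E 0 \<cdot>\<^sub>E P1'" using e Tp[OF Q0(1)] Q0 by simp
  from coords_unique(1)[OF I' this] have a1: "[a ^ p = 1] (mod p)" .
  have "[a = 1] (mod p)"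
  proof -
    have na: "\<not> p dvd a"
    proof
      assume "p dvd a"
      hence "[a ^ p = 0] (mod p)" using p_pos by (simp add: cong_0_iff dvd_power dvd_trans[of p a])
      hence "[0 = 1] (mod p)" using a1 by (metis cong_sym cong_trans)
      thus False using p_pos by (simp add: cong_def)
    qed
    have "[a ^ (p - 1) = 1] (mod p)" using fermat_theorem[OF p na] .
    hence "[a ^ (p - 1) * a = 1 * a] (mod p)" by (rule cong_scalar_right)
    moreover have "a ^ (p - 1) * a = a ^ p" using p_pos by (metis mult.commute power_eq_if less_numeral_extra(3))
    ultimately show ?thesis using a1 by (metis cong_sym cong_trans mult_1)
  qed
  hence TQ0': "T Q0 = Q0 +\<^sub>E b \<cdot>\<^sub>E P1'" using ab(3) smul_cong[OF Q0(1), of a 1] Q0 by simp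
  \<comment> \<open>P1 = TQ0 - Q0 replaces P1', so that in the basis (P1, Q0) T is a single Jordan
    block with fixed line spanned by P1.\<close>
  define P1 where "P1 = b \<cdot>\<^sub>E P1'"
  have P1: "P1 \<in> tors p" "T P1 = P1" unfolding P1_def using P1' by (simp_all add: smul_in_tors Tsmul)
  have P1E: "P1 \<in> EC" using P1 tors_in_EC by auto
  have TQ0: "T Q0 = Q0 +\<^sub>E P1" using TQ0' by (simp add: P1_def)
  have "P1 \<noteq> Infinity"
  proof
    assume "P1 = Infinity"
    hence TQ: "T Q0 = Q0" using TQ0 by simp
    have "T R = R" if R: "R \<in> tors p" for R
    proof -
      obtain x y where "R = x \<cdot>\<^sub>E Q0 +\<^sub>E y \<cdot>\<^sub>E P1'" using tors_coords[OF I' R] by blast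
      thus ?thesis using TQ P1' by (simp add: Tadd Tsmul)
    qed
    thus False using j(1) by (simp add: fixj_def T_def)
  qed
  hence I: "indep P1 Q0"
    using P1 Q0 I' P1'E by (auto simp: indep_def P1_def smul_smul)
  \<comment> \<open>\<sigma> commutes with T and so preserves its fixed line, which makes \<alpha>
    vanish modulo p.\<close>
  obtain \<alpha> \<beta> where SP1: "S P1 = \<alpha> \<cdot>\<^sub>E Q0 +\<^sub>E \<beta> \<cdot>\<^sub>E P1" using tors_coords[OF I Stor[OF P1(1)]] by blast
  have "\<alpha> \<cdot>\<^sub>E Q0 +\<^sub>E (\<alpha> + \<beta>) \<cdot>\<^sub>E P1 = T (S P1)"
    unfolding SP1 using TQ0 P1 Q0 P1E by (simp add: Tadd Tsmul smul_padd smul_add padd_assoc)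
  also have "\<dots> = \<alpha> \<cdot>\<^sub>E Q0 +\<^sub>E \<beta> \<cdot>\<^sub>E P1" unfolding TS unfolding P1(2) unfolding SP1 ..
  finally have "[\<alpha> + \<beta> = \<beta>] (mod p)" by (rule coords_unique(2)[OF I])
  hence "[\<alpha> + \<beta> = 0 + \<beta>] (mod p)" by simp
  hence "p dvd \<alpha>" by (simp only: cong_add_rcancel_nat cong_0_iff)
  hence SP1: "S P1 = \<beta> \<cdot>\<^sub>E P1" using SP1 smul_dvd[OF Q0(1)] by simp
  \<comment> \<open>Comparing the P1-coordinates of T\<sigma>Q0 and \<sigma>TQ0 shows that the two
    diagonal entries of \<sigma> agree modulo p.\<close>
  obtain \<gamma> \<kappa> where SQ0: "S Q0 = \<gamma> \<cdot>\<^sub>E Q0 +\<^sub>E \<kappa> \<cdot>\<^sub>E P1" using tors_coords[OF I Stor[OF Q0(1)]] by blast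
  have "\<gamma> \<cdot>\<^sub>E Q0 +\<^sub>E (\<gamma> + \<kappa>) \<cdot>\<^sub>E P1 = T (S Q0)"
    unfolding SQ0 using TQ0 P1 Q0 P1E by (simp add: Tadd Tsmul smul_padd smul_add padd_assoc)
  also have "\<dots> = S Q0 +\<^sub>E S P1" unfolding TS unfolding TQ0 unfolding Sadd ..
  also have "\<dots> = \<gamma> \<cdot>\<^sub>E Q0 +\<^sub>E (\<beta> + \<kappa>) \<cdot>\<^sub>E P1"
    unfolding SQ0 SP1 using Q0 P1E by (simp add: smul_add padd_ac)
  finally have "[\<gamma> + \<kappa> = \<beta> + \<kappa>] (mod p)" by (rule coords_unique(2)[OF I])
  hence gb: "[\<gamma> = \<beta>] (mod p)" by (simp only: cong_add_rcancel_nat)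
  define w where "w = weil p P1 Q0"
  have w: "w ^ (p ^ Suc 0) = 1" "w ^ (p ^ 0) \<noteq> 1"
    using weil_power_N[OF P1(1) Q0(1)] weil_indep[OF I] by (simp_all add: w_def)
  \<comment> \<open>The order of w divides p^2, so w is a power of z, and \<sigma> raises it to the
    power g as well.\<close>
  have "w ^ (p ^ Suc 1) = (w ^ p) ^ p" by (simp add: power_mult)
  hence "w ^ (p ^ Suc 1) = 1" using w by simp
  then obtain i where i: "w = z ^ i" using root_of_unity_is_power[OF p z] by blast
  have "\<sigma> w = (\<sigma> z) ^ i" unfolding i by (rule field_aut_power[OF fa[OF \<sigma>(1)]])
  also have "\<dots> = w ^ g" unfolding \<sigma>(2) i by (simp add: power_mult[symmetric] mult.commute)
  finally have sw: "\<sigma> w = w ^ g" .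
  \<comment> \<open>The pairing of the images is w raised to the determinant \<gamma>\<beta> of
    \<sigma> on E[p].\<close>
  have "\<sigma> w = weil p (S P1) (S Q0)" unfolding S_def w_def by (rule weil_galois[OF \<sigma>(1) P1(1) Q0(1), symmetric])
  also have "\<dots> = (w ^ \<gamma>) ^ \<beta>"
    unfolding SP1 SQ0 using P1 Q0
    by (simp add: weil_smul_left weil_padd_right weil_smul_right weil_self padd_in_tors smul_in_tors w_def power_mult_distrib mult.commute flip: power_mult)
  finally have "w ^ g = w ^ (\<gamma> * \<beta>)" using sw by (simp add: power_mult)
  from root_of_unity_power_eq[OF p w this] have "[g = \<gamma> * \<beta>] (mod p)" by simp
  hence gsq: "[g = \<beta> * \<beta>] (mod p)" using gb by (meson cong_scalar_right cong_trans)
  have nb: "\<not> p dvd \<beta>"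
  proof
    assume "p dvd \<beta>"
    hence "p dvd g" using gsq by (meson cong_dvd_iff dvd_mult)
    thus False using g(2) p by (metis coprime_absorb_right coprime_commute not_prime_unit)
  qed
  \<comment> \<open>As g is congruent to \<beta>^2, its h-th power is \<beta>^(p-1), which is 1
    modulo p; so its hp-th power is 1 modulo p^2, and 2hp would have to divide hp.\<close>
  define h where "h = (p - 1) div 2"
  have "odd p" using p odd prime_odd_nat[of p] by auto
  hence h: "2 * h = p - 1" by (simp add: h_def)
  have "[g ^ h = (\<beta> * \<beta>) ^ h] (mod p)" using gsq by (rule cong_pow)
  moreover have "(\<beta> * \<beta>) ^ h = \<beta> ^ (p - 1)" unfolding h[symmetric] by (simp add: power_mult power2_eq_square)
  ultimately have "[g ^ h = 1] (mod p)" using fermat_theorem[OF p nb] by (metis cong_trans)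
  hence "[(g ^ h) ^ p = 1] (mod p\<^sup>2)" by (rule power_prime_cong_1)
  hence "[g ^ (h * p) = 1] (mod p\<^sup>2)" by (simp add: power_mult)
  hence "p * (p - 1) dvd h * p" by (rule g(1))
  hence "p * (2 * h) dvd p * h" unfolding h by (simp add: mult.commute)
  hence "2 * h dvd h" using p_pos by simp
  moreover have "h > 0" using h odd by simp
  ultimately show False using dvd_imp_le[of "2 * h" h] by simp
qed

end

end

section \<open>Extending automorphisms\<close>

abbreviation qpoly :: "rat poly \<Rightarrow> rat alg_closure poly" where
  "qpoly \<equiv> map_poly to_ac"

lemma qpoly_pCons: "poly (qpoly (pCons c q)) x = to_ac c + x * poly (qpoly q) x"
  by (simp add: map_poly_pCons)

lemma qpoly_smult: "qpoly (smult k q) = smult (to_ac k) (qpoly q)"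
  by (intro poly_eqI) (simp add: coeff_map_poly)

lemma qpoly_eq_0_iff: "qpoly q = 0 \<longleftrightarrow> q = 0"
proof
  assume "qpoly q = 0"
  hence "coeff (qpoly q) i = 0" for i by simp
  thus "q = 0" by (intro poly_eqI) (simp add: coeff_map_poly)
qed simp

text \<open>An annihilating polynomial of x, divided by a suitable power of the variable, has
  nonzero constant term; solving for that term exhibits the inverse. Hence a ring of algebraic
  numbers containing the rationals is a field, and partial automorphisms need only respect sums and
  products.\<close>

lemma inverse_is_rational_polynomial:
  assumes "(x :: rat alg_closure) \<noteq> 0"
  obtains q where "x * poly (qpoly q) x = 1"
proof -
  obtain p where p: "p \<noteq> 0" "poly (qpoly p) x = 0" using alg_closure_algebraic .
  have "\<exists>q. x * poly (qpoly q) x = 1" using p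
  proof (induction p)
    case (pCons c q)
    show ?case
    proof (cases "c = 0")
      case True
      thus ?thesis using pCons assms by (simp add: qpoly_pCons)
    next
      case False
      have "x * poly (qpoly q) x = - to_ac c" using pCons.prems(2)
        by (simp add: qpoly_pCons eq_neg_iff_add_eq_0 add.commute)
      hence "x * poly (qpoly (smult (- inverse c) q)) x = to_ac (- inverse c) * (- to_ac c)"
        unfolding qpoly_smult poly_smult by (subst mult.left_commute) (simp only:)
      also have "\<dots> = 1" using False by simp
      finally show ?thesis by blast
    qed
  qed simp
  thus ?thesis using that by blast
qed

text \<open>Partial automorphisms are graphs, so that Zorn's lemma applies to them ordered by inclusion.\<close>

type_synonym qrel = "(rat alg_closure \<times> rat alg_closure) set"

definition partial_aut :: "qrel \<Rightarrow> bool" where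
  "partial_aut r \<longleftrightarrow> (\<forall>q. (to_ac q, to_ac q) \<in> r) \<and>
     (\<forall>a b c d. (a, b) \<in> r \<longrightarrow> (c, d) \<in> r \<longrightarrow> (a + c, b + d) \<in> r \<and> (a * c, b * d) \<in> r) \<and>
     (\<forall>a b c. (a, b) \<in> r \<longrightarrow> (a, c) \<in> r \<longrightarrow> b = c)"

definition rel_poly :: "qrel \<Rightarrow> rat alg_closure poly \<Rightarrow> rat alg_closure poly \<Rightarrow> bool" where
  "rel_poly r f f' \<longleftrightarrow> (\<forall>i. (coeff f i, coeff f' i) \<in> r)"

context
  fixes r :: qrel
  assumes r: "partial_aut r"
begin

lemma partial_aut_rat: "(to_ac q, to_ac q) \<in> r"
  using r by (simp add: partial_aut_def)

lemma partial_aut_0: "(0, 0) \<in> r" and partial_aut_1: "(1, 1) \<in> r"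
  using partial_aut_rat[of 0] partial_aut_rat[of 1] by simp_all

lemma partial_aut_add: "(a, b) \<in> r \<Longrightarrow> (c, d) \<in> r \<Longrightarrow> (a + c, b + d) \<in> r"
  and partial_aut_mult: "(a, b) \<in> r \<Longrightarrow> (c, d) \<in> r \<Longrightarrow> (a * c, b * d) \<in> r"
  and partial_aut_unique: "(a, b) \<in> r \<Longrightarrow> (a, c) \<in> r \<Longrightarrow> b = c"
  using r unfolding partial_aut_def by blast+

lemma partial_aut_uminus: "(a, b) \<in> r \<Longrightarrow> (- a, - b) \<in> r"
  using partial_aut_mult[OF partial_aut_rat[of "-1"], of a b] by simp

lemma partial_aut_zero: "(0, b) \<in> r \<Longrightarrow> b = 0"
  using partial_aut_unique partial_aut_0 by blast

lemma partial_aut_sum: "(\<And>i. i \<in> I \<Longrightarrow> (f i, g i) \<in> r) \<Longrightarrow> (sum f I, sum g I) \<in> r"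
  by (induction I rule: infinite_finite_induct) (auto intro: partial_aut_add partial_aut_0)

lemma partial_aut_qpoly: "(a, b) \<in> r \<Longrightarrow> (poly (qpoly q) a, poly (qpoly q) b) \<in> r"
  by (induction q) (auto simp: qpoly_pCons partial_aut_0 intro!: partial_aut_add partial_aut_mult partial_aut_rat)

lemma partial_aut_inverse:
  assumes "(a, b) \<in> r" "a \<noteq> 0"
  obtains c where "(inverse a, c) \<in> r"
proof -
  obtain q where "a * poly (qpoly q) a = 1" using inverse_is_rational_polynomial[OF assms(2)] .
  hence "inverse a = poly (qpoly q) a" by (rule inverse_unique)
  thus ?thesis using partial_aut_qpoly[OF assms(1), of q] that by simp
qed

lemma partial_aut_nonzero:
  assumes "(a, b) \<in> r" "a \<noteq> 0"
  shows "b \<noteq> 0"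
proof
  assume "b = 0"
  obtain c where "(inverse a, c) \<in> r" using partial_aut_inverse[OF assms] .
  hence "(1, 0) \<in> r" using partial_aut_mult[OF assms(1)] assms(2) \<open>b = 0\<close> by fastforce
  thus False using partial_aut_unique[OF partial_aut_1] by fastforce
qed

lemma rel_poly_add: "rel_poly r f f' \<Longrightarrow> rel_poly r g g' \<Longrightarrow> rel_poly r (f + g) (f' + g')"
  by (simp add: rel_poly_def partial_aut_add)

lemma rel_poly_uminus: "rel_poly r f f' \<Longrightarrow> rel_poly r (- f) (- f')"
  by (simp add: rel_poly_def partial_aut_uminus)

lemma rel_poly_diff: "rel_poly r f f' \<Longrightarrow> rel_poly r g g' \<Longrightarrow> rel_poly r (f - g) (f' - g')"
  using rel_poly_add[OF _ rel_poly_uminus] by fastforce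

lemma rel_poly_mult: "rel_poly r f f' \<Longrightarrow> rel_poly r g g' \<Longrightarrow> rel_poly r (f * g) (f' * g')"
  unfolding rel_poly_def coeff_mult by (auto intro!: partial_aut_sum partial_aut_mult)

lemma rel_poly_monom: "(a, b) \<in> r \<Longrightarrow> rel_poly r (monom a n) (monom b n)"
  by (simp add: rel_poly_def partial_aut_0)

lemma rel_poly_const: "(a, b) \<in> r \<Longrightarrow> rel_poly r [:a:] [:b:]"
  using rel_poly_monom[of a b 0] by (simp add: monom_0)

lemma rel_poly_qpoly: "rel_poly r (qpoly q) (qpoly q)"
  by (simp add: rel_poly_def coeff_map_poly partial_aut_rat)

lemma rel_poly_0: "rel_poly r 0 f' \<Longrightarrow> f' = 0"
  by (intro poly_eqI) (auto simp: rel_poly_def intro: partial_aut_zero)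

text \<open>Evaluating corresponding polynomials at \<alpha> and \<beta> gives the graph of the
  candidate extension that sends \<alpha> to \<beta>. It is single-valued when every relation
  satisfied by \<alpha> passes to \<beta>.\<close>

definition adjoin :: "rat alg_closure \<Rightarrow> rat alg_closure \<Rightarrow> qrel" where
  "adjoin \<alpha> \<beta> = {(poly f \<alpha>, poly f' \<beta>) | f f'. rel_poly r f f'}"

lemma partial_aut_adjoin:
  assumes "\<And>f f'. rel_poly r f f' \<Longrightarrow> poly f \<alpha> = 0 \<Longrightarrow> poly f' \<beta> = 0"
  shows "partial_aut (adjoin \<alpha> \<beta>)" "r \<subseteq> adjoin \<alpha> \<beta>" "(\<alpha>, \<beta>) \<in> adjoin \<alpha> \<beta>"
proof -
  have I: "(poly f \<alpha>, poly f' \<beta>) \<in> adjoin \<alpha> \<beta>" if "rel_poly r f f'" for f f'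
    using that by (auto simp: adjoin_def)
  have E: "\<exists>f f'. a = poly f \<alpha> \<and> b = poly f' \<beta> \<and> rel_poly r f f'" if "(a, b) \<in> adjoin \<alpha> \<beta>" for a b
    using that by (auto simp: adjoin_def)
  show sub: "r \<subseteq> adjoin \<alpha> \<beta>"
  proof (rule subrelI)
    fix a b assume "(a, b) \<in> r"
    from I[OF rel_poly_const[OF this]] show "(a, b) \<in> adjoin \<alpha> \<beta>" by simp
  qed
  show "(\<alpha>, \<beta>) \<in> adjoin \<alpha> \<beta>" using I[OF rel_poly_monom[OF partial_aut_1, of 1]] by (simp add: poly_monom)
  show "partial_aut (adjoin \<alpha> \<beta>)"
    unfolding partial_aut_def
  proof (intro conjI allI impI)
    fix q show "(to_ac q, to_ac q) \<in> adjoin \<alpha> \<beta>" using sub partial_aut_rat by blast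
  next
    fix a b c d assume "(a, b) \<in> adjoin \<alpha> \<beta>" "(c, d) \<in> adjoin \<alpha> \<beta>"
    then obtain f f' g g' where "a = poly f \<alpha>" "b = poly f' \<beta>" "rel_poly r f f'"
      "c = poly g \<alpha>" "d = poly g' \<beta>" "rel_poly r g g'" using E by metis
    thus "(a + c, b + d) \<in> adjoin \<alpha> \<beta>" "(a * c, b * d) \<in> adjoin \<alpha> \<beta>"
      using I[OF rel_poly_add[of f f' g g']] I[OF rel_poly_mult[of f f' g g']] by simp_all
  next
    fix a b c assume "(a, b) \<in> adjoin \<alpha> \<beta>" "(a, c) \<in> adjoin \<alpha> \<beta>"
    then obtain f f' g g' where *: "a = poly f \<alpha>" "b = poly f' \<beta>" "rel_poly r f f'"
      "a = poly g \<alpha>" "c = poly g' \<beta>" "rel_poly r g g'" using E by metis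
    have "poly (f' - g') \<beta> = 0" using * by (intro assms[OF rel_poly_diff[of f f' g g']]) simp_all
    thus "b = c" using * by simp
  qed
qed

text \<open>\<beta> is a root of the image m' of the minimal polynomial m of \<alpha> over the
  domain of r. Division by m is carried out on pairs of corresponding polynomials, so that a
  relation of \<alpha> and its image are reduced together.\<close>

lemma partial_aut_extend:
  "\<exists>\<beta>. \<forall>f f'. rel_poly r f f' \<longrightarrow> poly f \<alpha> = 0 \<longrightarrow> poly f' \<beta> = 0"
proof -
  define V where "V = (\<lambda>f. f \<noteq> 0 \<and> poly f \<alpha> = 0 \<and> (\<exists>f'. rel_poly r f f'))"
  obtain p where p: "p \<noteq> 0" "poly (qpoly p) \<alpha> = 0" using alg_closure_algebraic .
  have "V (qpoly p)" using p rel_poly_qpoly[of p] unfolding V_def qpoly_eq_0_iff by blast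
  then obtain f where f: "V f" "\<And>h. V h \<Longrightarrow> degree f \<le> degree h"
    using ex_has_least_nat[of V "qpoly p" degree] by blast
  then obtain f' where f': "rel_poly r f f'" by (auto simp: V_def)
  have lc: "(lead_coeff f, coeff f' (degree f)) \<in> r" using f' by (simp add: rel_poly_def)
  have lc0: "lead_coeff f \<noteq> 0" using f by (simp add: V_def)
  obtain c where c: "(inverse (lead_coeff f), c) \<in> r" using partial_aut_inverse[OF lc lc0] .
  define m where "m = [:inverse (lead_coeff f):] * f"
  define m' where "m' = [:c:] * f'"
  have mm: "rel_poly r m m'" unfolding m_def m'_def by (intro rel_poly_mult rel_poly_const c f')
  have dm: "degree m = degree f" "lead_coeff m = 1" "poly m \<alpha> = 0"
    using lc0 f(1) by (auto simp: m_def V_def)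
  have "degree m > 0"
  proof (rule ccontr)
    assume "\<not> degree m > 0"
    hence "m = [:1:]" using dm(2) by (metis degree_eq_zeroE gr0I lead_coeff_pCons(2))
    thus False using dm(3) by simp
  qed
  moreover have lm': "coeff m' (degree m) = 1"
    using mm dm(2) partial_aut_unique[OF partial_aut_1] by (metis rel_poly_def)
  hence "degree m' \<ge> degree m" by (intro le_degree) simp
  ultimately have "degree m' > 0" by simp
  then obtain \<beta> where \<beta>: "poly m' \<beta> = 0" using alg_closed_imp_poly_has_root by blast
  have "poly h' \<beta> = 0" if "rel_poly r h h'" "poly h \<alpha> = 0" for h h'
    using that
  proof (induction "degree h" arbitrary: h h' rule: less_induct)
    case less
    show ?case
    proof (cases "h = 0")
      case True
      thus ?thesis using rel_poly_0[of h'] less(2) by simp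
    next
      case False
      hence "V h" using less by (auto simp: V_def)
      hence dh: "degree m \<le> degree h" using f(2) dm(1) by simp
      let ?k = "degree h - degree m" and ?a = "lead_coeff h" and ?b = "coeff h' (degree h)"
      have ab: "(?a, ?b) \<in> r" using less by (simp add: rel_poly_def)
      define g where "g = h - monom ?a ?k * m"
      define g' where "g' = h' - monom ?b ?k * m'"
      have gg: "rel_poly r g g'" unfolding g_def g'_def
        by (intro rel_poly_diff rel_poly_mult rel_poly_monom ab mm less)
      have g0: "poly g \<alpha> = 0" using less dm(3) by (simp add: g_def)
      have "poly g' \<beta> = 0"
      proof (cases "g = 0")
        case True
        thus ?thesis using rel_poly_0[of g'] gg by simp
      next
        case g: False
        have "degree (monom ?a ?k * m) = degree h"
        proof -
          have "m \<noteq> 0" "monom ?a ?k \<noteq> 0" using dm(2) False by auto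
          thus ?thesis using dh False by (simp add: degree_mult_eq degree_monom_eq)
        qed
        hence "degree g \<le> degree h" unfolding g_def by (intro degree_diff_le) auto
        moreover have "coeff g (degree h) = 0"
        proof -
          have "coeff (monom ?a ?k * m) (?k + degree m) = ?a * coeff m (degree m)"
            by (simp add: coeff_monom_mult)
          thus ?thesis using dh dm(2) by (simp add: g_def)
        qed
        moreover have "coeff g (degree g) \<noteq> 0" using g by simp
        ultimately have "degree g < degree h" by (cases "degree g = degree h") auto
        thus ?thesis using less(1) gg g0 by blast
      qed
      thus ?thesis using \<beta> by (simp add: g'_def)
    qed
  qed
  thus ?thesis by blast
qed

end

text \<open>A partial automorphism that is maximal among those sending \<alpha> to \<beta> is total,
  by the extension step. It is onto because it is injective and maps the finite set of roots of each
  nonzero rational polynomial into itself.\<close>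

lemma exists_field_aut:
  fixes \<alpha> \<beta> :: "rat alg_closure"
  assumes "\<And>p :: rat poly. poly (qpoly p) \<alpha> = 0 \<Longrightarrow> poly (qpoly p) \<beta> = 0"
  shows "\<exists>\<sigma>. field_aut \<sigma> \<and> \<sigma> \<alpha> = \<beta>"
proof -
  define r0 :: qrel where "r0 = range (\<lambda>q. (to_ac q, to_ac q))"
  have r0: "partial_aut r0" unfolding partial_aut_def r0_def
    by (auto simp flip: to_ac_add to_ac_mult)
  \<comment> \<open>Over the rationals corresponding polynomials are equal, so the hypothesis is
    exactly the condition for adjoining the pair (\<alpha>, \<beta>).\<close>
  have c0: "poly f' \<beta> = 0" if "rel_poly r0 f f'" "poly f \<alpha> = 0" for f f'
  proof -
    have c: "coeff f i = coeff f' i \<and> coeff f i \<in> range to_ac" for i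
    proof -
      have "(coeff f i, coeff f' i) \<in> r0" using that(1) by (simp add: rel_poly_def)
      then obtain q where "(coeff f i, coeff f' i) = (to_ac q, to_ac q)" unfolding r0_def by (rule rangeE)
      thus ?thesis by simp
    qed
    have ff: "f' = f" by (intro poly_eqI) (simp add: c)
    have "f = qpoly (map_poly of_ac f)"
      by (intro poly_eqI) (simp add: coeff_map_poly to_ac_of_ac conjunct2[OF c])
    thus ?thesis using assms[of "map_poly of_ac f"] that(2) ff by simp
  qed
  have A: "partial_aut (adjoin r0 \<alpha> \<beta>)" "(\<alpha>, \<beta>) \<in> adjoin r0 \<alpha> \<beta>"
    by (rule partial_aut_adjoin[OF r0], rule c0, assumption+)+
  define G where "G = {r. partial_aut r \<and> (\<alpha>, \<beta>) \<in> r}"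
  have "\<exists>M\<in>G. \<forall>X\<in>G. M \<subseteq> X \<longrightarrow> X = M"
  proof (rule subset_Zorn_nonempty)
    show "G \<noteq> {}" using A unfolding G_def by blast
    fix C assume C: "C \<noteq> {}" "subset.chain G C"
    hence CG: "\<And>r. r \<in> C \<Longrightarrow> partial_aut r \<and> (\<alpha>, \<beta>) \<in> r"
      and tot: "\<And>r s. r \<in> C \<Longrightarrow> s \<in> C \<Longrightarrow> r \<subseteq> s \<or> s \<subseteq> r"
      unfolding subset.chain_def G_def by auto
    have two: "\<exists>t\<in>C. x \<in> t \<and> y \<in> t" if "x \<in> \<Union>C" "y \<in> \<Union>C" for x y
      using that tot by blast
    obtain r where rC: "r \<in> C" using C(1) by blast
    have "partial_aut (\<Union>C)"
      unfolding partial_aut_def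
    proof (intro conjI allI impI)
      fix q show "(to_ac q, to_ac q) \<in> \<Union>C" using partial_aut_rat CG rC by blast
    next
      fix a b c d assume "(a, b) \<in> \<Union>C" "(c, d) \<in> \<Union>C"
      then obtain t where "t \<in> C" "(a, b) \<in> t" "(c, d) \<in> t" using two by blast
      thus "(a + c, b + d) \<in> \<Union>C" "(a * c, b * d) \<in> \<Union>C"
        using CG partial_aut_add partial_aut_mult by blast+
    next
      fix a b c assume "(a, b) \<in> \<Union>C" "(a, c) \<in> \<Union>C"
      then obtain t where "t \<in> C" "(a, b) \<in> t" "(a, c) \<in> t" using two by blast
      thus "b = c" using CG partial_aut_unique by blast
    qed
    thus "\<Union>C \<in> G" using CG rC unfolding G_def by blast
  qed
  then obtain M where M: "partial_aut M" "(\<alpha>, \<beta>) \<in> M"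
    and maxM: "\<And>X. partial_aut X \<Longrightarrow> (\<alpha>, \<beta>) \<in> X \<Longrightarrow> M \<subseteq> X \<Longrightarrow> X = M"
    unfolding G_def by blast
  have tot: "\<exists>b. (a, b) \<in> M" for a
  proof -
    obtain b where "\<forall>f f'. rel_poly M f f' \<longrightarrow> poly f a = 0 \<longrightarrow> poly f' b = 0"
      using partial_aut_extend[OF M(1), of a] by blast
    hence c: "rel_poly M f f' \<Longrightarrow> poly f a = 0 \<Longrightarrow> poly f' b = 0" for f f' by blast
    have B: "partial_aut (adjoin M a b)" "M \<subseteq> adjoin M a b" "(a, b) \<in> adjoin M a b"
      by (rule partial_aut_adjoin[OF M(1)], rule c, assumption+)+
    have "adjoin M a b = M" using B(1) subsetD[OF B(2) M(2)] B(2) by (rule maxM)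
    hence "(a, b) \<in> M" using B(3) by (simp only:)
    thus ?thesis by (rule exI)
  qed
  define \<sigma> where "\<sigma> = (\<lambda>a. THE b. (a, b) \<in> M)"
  have \<sigma>: "(a, b) \<in> M \<longleftrightarrow> \<sigma> a = b" for a b
  proof -
    obtain b' where b': "(a, b') \<in> M" using tot by blast
    have "\<sigma> a = b'" unfolding \<sigma>_def
    proof (rule the_equality)
      show "(a, b') \<in> M" by (rule b')
      fix b assume "(a, b) \<in> M"
      thus "b = b'" using b' by (rule partial_aut_unique[OF M(1)])
    qed
    moreover have "b = b'" if "(a, b) \<in> M" using that b' by (rule partial_aut_unique[OF M(1)])
    ultimately show ?thesis using b' by auto
  qed
  have gr: "(a, \<sigma> a) \<in> M" for a using \<sigma> by blast
  have add: "\<sigma> (a + b) = \<sigma> a + \<sigma> b" and mult: "\<sigma> (a * b) = \<sigma> a * \<sigma> b" for a b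
    using partial_aut_add[OF M(1) gr gr, of a b] partial_aut_mult[OF M(1) gr gr, of a b] \<sigma> by auto
  have inj: "inj \<sigma>"
  proof (rule injI)
    fix a b assume "\<sigma> a = \<sigma> b"
    hence "(a - b, 0) \<in> M"
      using partial_aut_add[OF M(1) gr[of a] partial_aut_uminus[OF M(1) gr[of b]]] by simp
    hence "a - b = 0" using partial_aut_nonzero[OF M(1), of "a - b" 0] by blast
    thus "a = b" by simp
  qed
  have surj: "\<exists>x. \<sigma> x = y" for y
  proof -
    obtain p where p: "p \<noteq> 0" "poly (qpoly p) y = 0" using alg_closure_algebraic .
    define A where "A = {x. poly (qpoly p) x = 0}"
    have "qpoly p \<noteq> 0" using p(1) by (simp only: qpoly_eq_0_iff not_False_eq_True)
    hence fin: "finite A" unfolding A_def by (rule poly_roots_finite)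
    have "\<sigma> x \<in> A" if "x \<in> A" for x
      using partial_aut_qpoly[OF M(1) gr[of x], of p] that partial_aut_zero[OF M(1)] by (simp add: A_def)
    hence "\<sigma> ` A \<subseteq> A" by blast
    hence "\<sigma> ` A = A" using fin inj by (intro endo_inj_surj inj_on_subset[OF inj]) auto
    moreover have "y \<in> A" using p by (simp add: A_def)
    ultimately have "y \<in> \<sigma> ` A" by simp
    then obtain x where "y = \<sigma> x" by (rule imageE)
    thus ?thesis by (intro exI[of _ x]) simp
  qed
  have "surj \<sigma>" by (rule surjI[where f="\<lambda>y. SOME x. \<sigma> x = y"]) (rule someI_ex[OF surj])
  hence "field_aut \<sigma>" unfolding field_aut_def bij_def using inj add mult by simp
  moreover have "\<sigma> \<alpha> = \<beta>" using \<sigma> M(2) by simp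
  ultimately show ?thesis by blast
qed

lemma field_aut_to_ac:
  fixes \<sigma> :: "rat alg_closure \<Rightarrow> rat alg_closure"
  assumes "field_aut \<sigma>"
  shows "\<sigma> (to_ac q) = to_ac q"
proof -
  have i: "\<sigma> (of_int k) = of_int k" for k
  proof (cases k rule: int_cases2)
    case (nonneg n)
    thus ?thesis using field_aut_of_nat[OF assms, of n] by simp
  next
    case (nonpos n)
    thus ?thesis using field_aut_of_nat[OF assms, of n] field_aut_uminus[OF assms, of "of_nat n"] by simp
  qed
  obtain a b where "quotient_of q = (a, b)" by (rule prod.exhaust)
  hence "q = of_int a / of_int b" by (rule quotient_of_div)
  thus ?thesis by (simp add: field_aut_divide[OF assms] i)
qed

section \<open>The cyclotomic polynomial of a squared prime\<close>

text \<open>From m (q choose m) = q (q - 1 choose m - 1) with q = p^e: a binomial coefficient prime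
  to p would leave q dividing m.\<close>

lemma prime_dvd_prime_power_choose:
  fixes p :: nat
  assumes "prime p" "0 < m" "m < p ^ e"
  shows "p dvd (p ^ e choose m)"
proof (rule ccontr)
  assume "\<not> p dvd (p ^ e choose m)"
  hence "coprime (p ^ e) (p ^ e choose m)"
    using prime_imp_coprime_nat[OF assms(1)] by simp
  moreover have "p ^ e dvd (p ^ e choose m) * m"
    using Suc_times_binomial_eq[of "p ^ e - 1" "m - 1"] assms(2,3)
    by (metis Suc_pred' dvd_triv_left order.strict_trans)
  ultimately have "p ^ e dvd m" by (simp add: coprime_dvd_mult_right_iff)
  thus False using assms(2,3) by (simp add: nat_dvd_not_less)
qed

text \<open>The lowest coefficients prime to p, at i in A and at j in B, produce a coefficient prime
  to p at i + j in the product. That forces i + j to be the full degree, so both constant terms are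
  divisible by p and their product by p^2.\<close>

lemma eisenstein:
  fixes A B :: "int poly" and p :: int
  assumes "prime p" and dvd: "\<And>k. k < degree (A * B) \<Longrightarrow> p dvd coeff (A * B) k"
    and lc: "\<not> p dvd lead_coeff (A * B)" and c0: "\<not> p\<^sup>2 dvd coeff (A * B) 0"
    and deg: "degree A > 0" "degree B > 0"
  shows False
proof -
  have nz: "A \<noteq> 0" "B \<noteq> 0" using deg by auto
  have la: "\<not> p dvd coeff A (degree A)" and lb: "\<not> p dvd coeff B (degree B)"
    using lc by (auto simp: lead_coeff_mult)
  define i where "i = (LEAST i. \<not> p dvd coeff A i)"
  define j where "j = (LEAST j. \<not> p dvd coeff B j)"
  have i: "\<not> p dvd coeff A i" "i \<le> degree A"
    unfolding i_def using la by (rule LeastI, rule Least_le)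
  have j: "\<not> p dvd coeff B j" "j \<le> degree B"
    unfolding j_def using lb by (rule LeastI, rule Least_le)
  have i': "p dvd coeff A k" if "k < i" for k using that not_less_Least unfolding i_def by blast
  have j': "p dvd coeff B k" if "k < j" for k using that not_less_Least unfolding j_def by blast
  have "coeff (A * B) (i + j) = coeff A i * coeff B j + (\<Sum>k\<in>{..i + j} - {i}. coeff A k * coeff B (i + j - k))"
    unfolding coeff_mult by (subst sum.remove[of _ i]) auto
  moreover have "p dvd (\<Sum>k\<in>{..i + j} - {i}. coeff A k * coeff B (i + j - k))"
  proof (rule dvd_sum)
    fix k assume k: "k \<in> {..i + j} - {i}"
    show "p dvd coeff A k * coeff B (i + j - k)"
    proof (cases "k < i")
      case True
      thus ?thesis using i' by simp
    next
      case False
      hence "i + j - k < j" using k by auto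
      thus ?thesis using j' by simp
    qed
  qed
  moreover have "\<not> p dvd coeff A i * coeff B j" using i j assms(1) by (simp add: prime_dvd_mult_iff)
  ultimately have "\<not> p dvd coeff (A * B) (i + j)" by (simp add: dvd_add_left_iff)
  hence "\<not> i + j < degree (A * B)" using dvd by blast
  hence "i = degree A" "j = degree B" using i j nz by (auto simp: degree_mult_eq)
  hence "p dvd coeff A 0" "p dvd coeff B 0" using i' j' deg by auto
  hence "p\<^sup>2 dvd coeff (A * B) 0" unfolding power2_eq_square by (simp add: coeff_mult mult_dvd_mono)
  thus False using c0 by blast
qed

text \<open>For prime p this is the cyclotomic polynomial of p^2, (X^(p^2) - 1)/(X^p - 1). The
  coefficient ring is left open, as it serves over the integers, the rationals and the algebraic
  closure.\<close>

abbreviation cyclotomic_p2 :: "nat \<Rightarrow> 'a :: comm_ring_1 poly" where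
  "cyclotomic_p2 p \<equiv> (\<Sum>i<p. monom 1 p ^ i)"

lemma coeff_X1_power: "coeff ([:1, 1:] ^ n) i = (of_nat (n choose i) :: int)"
proof (cases "i \<le> n")
  case False
  hence "degree ([:1, 1:] ^ n :: int poly) < i" using degree_power_le[of "[:1, 1:] :: int poly" n] by simp
  thus ?thesis using False by (simp add: coeff_eq_0 binomial_eq_0)
qed (simp add: coeff_linear_poly_power)

lemma pcompose_monom_1: "pcompose (monom 1 n) q = (q ^ n :: int poly)"
  by (induction n) (simp_all add: monom_Suc pcompose_pCons monom_0 one_pCons)

text \<open>Eisenstein after substituting X + 1. Modulo p the divisor (X + 1)^p - 1 is X^p, so the
  coefficients of the quotient agree with those of (X + 1)^(p^2) - 1 shifted by p; the constant term
  is the value at 1, which is p.\<close>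

lemma cyclotomic_p2_irreducible:
  fixes A B :: "int poly"
  assumes p: "prime p" and AB: "A * B = cyclotomic_p2 p" and deg: "degree A > 0" "degree B > 0"
  shows False
proof -
  define L :: "int poly" where "L = [:1, 1:]"
  define \<Psi> where "\<Psi> = pcompose A L * pcompose B L"
  define Q where "Q = L ^ p - 1"
  have p1: "p > 1" using prime_gt_1_nat[OF p] .
  have "(monom 1 p - 1) * cyclotomic_p2 p = (monom 1 (p * p) - 1 :: int poly)"
    using power_diff_1_eq[of "monom 1 p :: int poly" p] by (simp add: monom_power)
  hence "pcompose ((monom 1 p - 1) * (A * B)) L = pcompose (monom 1 (p * p) - 1) L" by (simp add: AB)
  hence id: "Q * \<Psi> = L ^ (p * p) - 1"
    unfolding Q_def \<Psi>_def by (simp only: pcompose_mult pcompose_diff pcompose_monom_1 pcompose_1)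
  have monic: "degree (L ^ n - 1) = n" "lead_coeff (L ^ n - 1) = 1" if "n > 0" for n
  proof -
    have c: "coeff (L ^ n - 1) k = (if k = 0 then 0 else int (n choose k))" for k
      unfolding L_def by (simp add: coeff_X1_power)
    have "coeff (L ^ n - 1) k = 0" if "k > n" for k unfolding c using that by simp
    hence "degree (L ^ n - 1) \<le> n" by (intro degree_le allI impI)
    moreover have "n \<le> degree (L ^ n - 1)" using that c[of n] by (intro le_degree) simp
    ultimately show d: "degree (L ^ n - 1) = n" by simp
    show "lead_coeff (L ^ n - 1) = 1" unfolding d c using that by simp
  qed
  have mQ: "degree Q = p" "lead_coeff Q = 1" unfolding Q_def using monic[of p] p1 by simp_all
  have mR: "degree (Q * \<Psi>) = p * p" "lead_coeff (Q * \<Psi>) = 1" unfolding id using monic[of "p * p"] p1 by simp_all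
  have nz: "Q \<noteq> 0" "\<Psi> \<noteq> 0" using mR(2) by auto
  have lc: "lead_coeff \<Psi> = 1" using mR(2) mQ(2) by (simp add: lead_coeff_mult)
  have d: "p + degree \<Psi> = p * p" using mR(1) mQ(1) nz by (simp add: degree_mult_eq)
  have low: "int p dvd coeff \<Psi> k" if "k < degree \<Psi>" for k
  proof -
    have kp: "k + p < p * p" using that d by simp
    have cQ: "int p dvd coeff Q i" if ip: "i \<noteq> p" for i
    proof -
      consider "i = 0" | "0 < i" "i < p" | "i > p" using ip by linarith
      thus ?thesis
      proof cases
        case 1 thus ?thesis by (simp add: Q_def L_def coeff_X1_power)
      next
        case 2
        hence "p dvd (p choose i)" using prime_dvd_prime_power_choose[of p i 1] p by simp
        thus ?thesis using 2 by (simp add: Q_def L_def coeff_X1_power)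
      next
        case 3 thus ?thesis using mQ(1) by (simp add: coeff_eq_0)
      qed
    qed
    have "coeff (Q * \<Psi>) (k + p) = coeff Q p * coeff \<Psi> k + (\<Sum>i\<in>{..k + p} - {p}. coeff Q i * coeff \<Psi> (k + p - i))"
      unfolding coeff_mult by (subst sum.remove[of _ p]) auto
    moreover have "int p dvd (\<Sum>i\<in>{..k + p} - {p}. coeff Q i * coeff \<Psi> (k + p - i))"
      using cQ by (intro dvd_sum dvd_mult2) auto
    moreover have "int p dvd coeff (Q * \<Psi>) (k + p)"
    proof -
      have "p dvd (p ^ 2 choose (k + p))"
        using kp p1 by (intro prime_dvd_prime_power_choose[OF p]) (auto simp: power2_eq_square)
      thus ?thesis unfolding id using p1 by (simp add: L_def coeff_X1_power power2_eq_square)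
    qed
    moreover have "coeff Q p = 1" using mQ by simp
    ultimately show ?thesis by (simp add: dvd_add_left_iff)
  qed
  have "coeff \<Psi> 0 = poly (A * B) 1"
    by (simp add: \<Psi>_def L_def poly_pcompose flip: poly_0_coeff_0)
  also have "\<dots> = int p" by (simp add: AB poly_sum poly_monom)
  finally have c0: "coeff \<Psi> 0 = int p" .
  have "\<not> (int p)\<^sup>2 dvd int p"
    using p1 by (simp add: power2_eq_square flip: of_nat_mult)
  hence "\<not> (int p)\<^sup>2 dvd coeff \<Psi> 0" unfolding c0 .
  moreover have "\<not> int p dvd lead_coeff \<Psi>" using p1 lc by simp
  moreover have "degree (pcompose A L) > 0" "degree (pcompose B L) > 0" using deg by (simp_all add: L_def degree_pcompose)
  moreover have "prime (int p)" using p by simp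
  ultimately show False using low unfolding \<Psi>_def by (intro eisenstein[of "int p" "pcompose A L" "pcompose B L"])
qed

section \<open>From integer to rational coefficients by Gauss's lemma\<close>

lemma clear_denominators:
  fixes q :: "rat poly"
  shows "\<exists>N A. N > 0 \<and> smult (of_int N) q = map_poly of_int A"
proof (induction q)
  case 0
  have "smult (of_int 1) (0 :: rat poly) = map_poly of_int 0" by simp
  thus ?case using zero_less_one by blast
next
  case (pCons c q)
  then obtain N A where NA: "N > 0" "smult (of_int N) q = map_poly of_int A" by blast
  obtain a b where "quotient_of c = (a, b)" by (rule prod.exhaust)
  hence c: "c = of_int a / of_int b" "b > 0" by (rule quotient_of_div, rule quotient_of_denom_pos)
  have "smult (of_int b) (smult (of_int N) q) = map_poly of_int (smult b A)"
    unfolding NA(2) by (intro poly_eqI) (simp add: coeff_map_poly)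
  hence "smult (of_int (b * N)) (pCons c q) = map_poly of_int (pCons (N * a) (smult b A))"
    using c by (simp add: map_poly_pCons)
  moreover have "b * N > 0" using c NA by simp
  ultimately show ?case by blast
qed

lemma of_int_poly_mult: "map_poly of_int (A * B) = (map_poly of_int A * map_poly of_int B :: rat poly)"
  by (intro poly_eqI) (simp add: coeff_map_poly coeff_mult)

lemma of_int_poly_inject: "map_poly of_int A = (map_poly of_int B :: rat poly) \<Longrightarrow> A = B"
  by (intro poly_eqI) (simp add: poly_eq_iff coeff_map_poly)

lemma cyclotomic_p2_hom:
  assumes "h 0 = 0" "h 1 = 1" "\<And>x y. h (x + y) = h x + h y"
  shows "map_poly h (cyclotomic_p2 p) = cyclotomic_p2 p"
proof (rule poly_eqI)
  have s: "h (sum f I) = (\<Sum>i\<in>I. h (f i))" for f and I :: "nat set"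
    by (induction I rule: infinite_finite_induct) (simp_all add: assms)
  fix n
  show "coeff (map_poly h (cyclotomic_p2 p)) n = coeff (cyclotomic_p2 p) n"
    by (simp add: coeff_map_poly assms(1) coeff_sum s monom_power)
       (intro sum.cong refl, simp add: assms)
qed

text \<open>Clearing denominators and passing to primitive parts turns a rational factorisation into
  an integral one. The polynomial is primitive because its constant term is 1.\<close>

lemma cyclotomic_p2_irreducible_rat:
  fixes A B :: "rat poly"
  assumes p: "prime p" and AB: "A * B = cyclotomic_p2 p" and deg: "degree A > 0" "degree B > 0"
  shows False
proof -
  let ?i = "map_poly of_int :: int poly \<Rightarrow> rat poly"
  obtain M C where C: "M > 0" "smult (of_int M) A = ?i C" using clear_denominators by blast
  obtain N D where D: "N > 0" "smult (of_int N) B = ?i D" using clear_denominators by blast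
  have cyc: "?i (cyclotomic_p2 p) = cyclotomic_p2 p" by (rule cyclotomic_p2_hom) simp_all
  have "?i (C * D) = smult (of_int (M * N)) (A * B)"
    unfolding of_int_poly_mult C(2)[symmetric] D(2)[symmetric] by (simp add: mult.commute)
  also have "\<dots> = ?i (smult (M * N) (cyclotomic_p2 p))"
    unfolding AB cyc[symmetric] by (intro poly_eqI) (simp add: coeff_map_poly)
  finally have CD: "C * D = smult (M * N) (cyclotomic_p2 p)" by (rule of_int_poly_inject)
  have "content (cyclotomic_p2 p :: int poly) dvd coeff (cyclotomic_p2 p) 0" by (rule content_dvd_coeff)
  also have "coeff (cyclotomic_p2 p :: int poly) 0 = poly (cyclotomic_p2 p) 0" by (simp add: poly_0_coeff_0)
  also have "\<dots> = (\<Sum>i<p. if i = 0 then 1 else 0)"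
    unfolding poly_sum using prime_gt_0_nat[OF p] by (intro sum.cong refl) (auto simp: poly_monom)
  also have "\<dots> = 1" using prime_gt_0_nat[OF p] by (simp add: sum.delta)
  finally have "is_unit (content (cyclotomic_p2 p :: int poly))" .
  hence "content (cyclotomic_p2 p :: int poly) = 1" by (rule iffD1[OF is_unit_content_iff])
  hence "primitive_part (C * D) = smult (unit_factor (M * N)) (cyclotomic_p2 p)"
    unfolding CD by (simp add: primitive_part_smult primitive_part_prim)
  hence "primitive_part C * primitive_part D = cyclotomic_p2 p"
    using C(1) D(1) by (simp add: primitive_part_mult unit_factor_mult)
  moreover have "degree C > 0"
  proof -
    have "degree (?i C) = degree A" using C by (simp flip: C(2))
    thus ?thesis using deg by (simp add: degree_map_poly)
  qed
  moreover have "degree D > 0"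
  proof -
    have "degree (?i D) = degree B" using D by (simp flip: D(2))
    thus ?thesis using deg by (simp add: degree_map_poly)
  qed
  ultimately show False using cyclotomic_p2_irreducible[OF p, of "primitive_part C" "primitive_part D"] by simp
qed

lemma to_ac_sum: "to_ac (sum f I) = (\<Sum>i\<in>I. to_ac (f i))"
  by (induction I rule: infinite_finite_induct) simp_all

lemma qpoly_mult: "qpoly (A * B) = qpoly A * qpoly B"
  by (intro poly_eqI) (simp add: coeff_map_poly coeff_mult to_ac_sum)

lemma qpoly_add: "qpoly (A + B) = qpoly A + qpoly B"
  by (intro poly_eqI) (simp add: coeff_map_poly)

lemma poly_cyclotomic_p2_eq_0:
  fixes z :: "'a :: field"
  assumes "z ^ (p\<^sup>2) = 1" "z ^ p \<noteq> 1"
  shows "poly (cyclotomic_p2 p) z = 0"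
proof -
  have "poly (cyclotomic_p2 p) z = (\<Sum>i<p. (z ^ p) ^ i)" by (simp add: poly_sum poly_monom)
  moreover have "(z ^ p - 1) * (\<Sum>i<p. (z ^ p) ^ i) = 0"
    using power_diff_1_eq[of "z ^ p" p] assms(1) by (simp add: power2_eq_square power_mult)
  ultimately show ?thesis using assms(2) by simp
qed

text \<open>The minimal polynomial m of z divides the cyclotomic polynomial, hence equals it up to a
  constant by irreducibility. As g is prime to p, z^g is another root of it, so m vanishes there
  too, and so does its multiple f.\<close>

lemma primitive_root_conjugate:
  fixes z :: "rat alg_closure"
  assumes p: "prime p" and z: "z ^ (p\<^sup>2) = 1" "z ^ p \<noteq> 1" and g: "coprime g p"
    and f: "poly (qpoly f) z = 0"
  shows "poly (qpoly f) (z ^ g) = 0"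
proof -
  have cyc: "qpoly (cyclotomic_p2 p) = cyclotomic_p2 p" by (rule cyclotomic_p2_hom) simp_all
  define V where "V = (\<lambda>f :: rat poly. f \<noteq> 0 \<and> poly (qpoly f) z = 0)"
  have zg: "(z ^ g) ^ (p\<^sup>2) = 1" using z(1) by (metis power_commutes power_mult mult.commute power_one)
  have zg': "(z ^ g) ^ p \<noteq> 1"
  proof
    assume "(z ^ g) ^ p = 1"
    hence "p ^ Suc 1 dvd g * p" using root_of_unity_order[OF p, of z 1 "g * p"] z
      by (simp add: power_mult power2_eq_square)
    hence "p dvd g" using prime_gt_0_nat[OF p] by simp
    thus False using g p by (metis coprime_def dvd_refl not_prime_unit)
  qed
  obtain q where q: "q \<noteq> 0" "poly (qpoly q) z = 0" using alg_closure_algebraic .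
  hence "V q" by (simp add: V_def)
  then obtain m where m: "V m" "\<And>h. V h \<Longrightarrow> degree m \<le> degree h"
    using ex_has_least_nat[of V q degree] by blast
  have m0: "m \<noteq> 0" "poly (qpoly m) z = 0" using m(1) by (simp_all add: V_def)
  have dvd: "m dvd h" if h: "poly (qpoly h) z = 0" for h
  proof -
    have "qpoly h = qpoly (h div m) * qpoly m + qpoly (h mod m)"
      unfolding qpoly_mult[symmetric] qpoly_add[symmetric] by simp
    hence r: "poly (qpoly (h mod m)) z = 0" using h m0 by simp
    have "h mod m = 0"
    proof (rule ccontr)
      assume *: "h mod m \<noteq> 0"
      hence "degree m \<le> degree (h mod m)" using r by (intro m(2)) (simp add: V_def)
      thus False using degree_mod_less[OF m0(1), of h] * by simp
    qed
    thus ?thesis by (rule mod_0_imp_dvd)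
  qed
  have "poly (qpoly (cyclotomic_p2 p)) z = 0" unfolding cyc by (rule poly_cyclotomic_p2_eq_0[OF z])
  hence "m dvd cyclotomic_p2 p" by (rule dvd)
  then obtain e where e: "cyclotomic_p2 p = m * e" by (rule dvdE)
  have "degree m > 0"
  proof (rule ccontr)
    assume "\<not> degree m > 0"
    then obtain c where c: "m = [:c:]" using degree_eq_zeroE by blast
    thus False using m0 by (simp add: map_poly_pCons)
  qed
  hence "\<not> degree e > 0" using cyclotomic_p2_irreducible_rat[OF p e[symmetric]] by blast
  then obtain c where c: "e = [:c:]" using degree_eq_zeroE by blast
  have "cyclotomic_p2 p \<noteq> (0 :: rat poly)"
  proof
    assume "cyclotomic_p2 p = (0 :: rat poly)"
    hence "poly (cyclotomic_p2 p) (1 :: rat) = 0" by simp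
    thus False using prime_gt_0_nat[OF p] by (simp add: poly_sum poly_monom)
  qed
  hence "c \<noteq> 0" using e c by auto
  have "poly (qpoly (m * e)) (z ^ g) = 0"
    unfolding e[symmetric] cyc by (rule poly_cyclotomic_p2_eq_0[OF zg zg'])
  hence "poly (qpoly m) (z ^ g) = 0" using \<open>c \<noteq> 0\<close> unfolding qpoly_mult c by (simp add: map_poly_pCons)
  moreover obtain k where "f = m * k" using dvd[OF f] by (rule dvdE)
  ultimately show ?thesis by (simp add: qpoly_mult)
qed

section \<open>Weierstrass equations and division fields\<close>

locale elliptic_curve_ac =
  fixes W :: "'a::{alg_closed_field, field_char_0} weierstrass"
  assumes elliptic: "elliptic_curve W"
begin

text \<open>Completing the square: with Y = y + s x + t the equation becomes Y^2 = x^3 +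
  \<open>d2\<close> x^2 + \<open>d1\<close> x + \<open>d0\<close>.\<close>

definition s :: 'a where "s = a\<^sub>1 W / 2"
definition t :: 'a where "t = a\<^sub>3 W / 2"
definition d2 :: 'a where "d2 = a\<^sub>2 W + s\<^sup>2"
definition d1 :: 'a where "d1 = a\<^sub>4 W + 2 * s * t"
definition d0 :: 'a where "d0 = a\<^sub>6 W + t\<^sup>2"

lemma weierstrass_coeffs:
  "a\<^sub>1 W = 2 * s" "a\<^sub>3 W = 2 * t" "a\<^sub>2 W = d2 - s\<^sup>2" "a\<^sub>4 W = d1 - 2 * s * t" "a\<^sub>6 W = d0 - t\<^sup>2"
  by (simp_all add: s_def t_def d2_def d1_def d0_def)

text \<open>The bracket is the discriminant of the completed cubic, so a double root of that cubic
  makes the discriminant of W vanish.\<close>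

lemma discriminant_completed_square:
  "discriminant W = 16 * (- (d2\<^sup>2 * (4 * d2 * d0 - d1\<^sup>2)) - 4 * d1 ^ 3 - 27 * d0\<^sup>2 + 18 * d2 * d1 * d0)"
proof -
  have b: "(2 * s)\<^sup>2 + 4 * (d2 - s\<^sup>2) = 4 * d2" "2 * (d1 - 2 * s * t) + 2 * s * (2 * t) = 2 * d1"
    "(2 * t)\<^sup>2 + 4 * (d0 - t\<^sup>2) = 4 * d0"
    by (simp_all add: algebra_simps power2_eq_square)
  have b8: "(2 * s)\<^sup>2 * (d0 - t\<^sup>2) + 4 * (d2 - s\<^sup>2) * (d0 - t\<^sup>2) - 2 * s * (2 * t) * (d1 - 2 * s * t)
      + (d2 - s\<^sup>2) * (2 * t)\<^sup>2 - (d1 - 2 * s * t)\<^sup>2 = 4 * d2 * d0 - d1\<^sup>2"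
    by (simp add: algebra_simps power2_eq_square)
  show ?thesis unfolding discriminant_def Let_def weierstrass_coeffs b b8
    by (simp add: algebra_simps power2_eq_square power3_eq_cube)
qed

sublocale monic_cubic_curve d2 d1 d0
proof
  fix r :: 'a
  assume f: "r ^ 3 + d2 * r\<^sup>2 + d1 * r + d0 = 0"
  show "3 * r\<^sup>2 + 2 * d2 * r + d1 \<noteq> 0"
  proof
    assume "3 * r\<^sup>2 + 2 * d2 * r + d1 = 0"
    hence c1: "d1 = - (3 * r\<^sup>2 + 2 * d2 * r)" by (rule minus_unique[symmetric])
    have "d0 = - (r ^ 3 + d2 * r\<^sup>2 + d1 * r)" using f by (rule minus_unique[symmetric])
    also have "\<dots> = 2 * r ^ 3 + d2 * r\<^sup>2"
      unfolding c1 by (simp add: algebra_simps power2_eq_square power3_eq_cube)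
    finally have c0: "d0 = 2 * r ^ 3 + d2 * r\<^sup>2" .
    have "discriminant W = 0"
      unfolding discriminant_completed_square c1 c0
      by (simp add: algebra_simps power2_eq_square power3_eq_cube)
    thus False using elliptic by (simp add: elliptic_curve_def)
  qed
qed

section \<open>The isomorphism with the completed cubic\<close>

fun to_cubic :: "'a point \<Rightarrow> 'a point" where
  "to_cubic Infinity = Infinity"
| "to_cubic (Affine x y) = Affine x (y + s * x + t)"

lemma to_cubic_eq_Infinity_iff: "to_cubic P = Infinity \<longleftrightarrow> P = Infinity"
  by (cases P) auto

lemma to_cubic_inject: "to_cubic P = to_cubic Q \<longleftrightarrow> P = Q"
  by (cases P; cases Q) auto

lemma to_cubic_surj: "\<exists>P. to_cubic P = Q"
proof (cases Q)
  case Infinity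
  thus ?thesis by (intro exI[of _ Infinity]) simp
next
  case (Affine x y)
  thus ?thesis by (intro exI[of _ "Affine x (y - s * x - t)"]) simp
qed

lemma to_cubic_in_EC_iff: "to_cubic P \<in> EC \<longleftrightarrow> on_curve W P"
proof (cases P)
  case (Affine x y)
  have "(y + s * x + t)\<^sup>2 - (x ^ 3 + d2 * x\<^sup>2 + d1 * x + d0)
      = y\<^sup>2 + 2 * s * x * y + 2 * t * y - (x ^ 3 + (d2 - s\<^sup>2) * x\<^sup>2 + (d1 - 2 * s * t) * x + (d0 - t\<^sup>2))"
    by (simp add: algebra_simps power2_eq_square power3_eq_cube)
  hence "(y + s * x + t)\<^sup>2 = x ^ 3 + d2 * x\<^sup>2 + d1 * x + d0 \<longleftrightarrow>
      y\<^sup>2 + 2 * s * x * y + 2 * t * y = x ^ 3 + (d2 - s\<^sup>2) * x\<^sup>2 + (d1 - 2 * s * t) * x + (d0 - t\<^sup>2)"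
    by (metis right_minus_eq)
  thus ?thesis unfolding Affine to_cubic.simps Affine_in_EC cf_def on_curve.simps weierstrass_coeffs .
qed simp

text \<open>The map is a shear that keeps x and adds s to every slope, so the slope l of the
  Weierstrass law corresponds to l + s on the cubic.\<close>

lemma to_cubic_point_add:
  assumes "on_curve W P" "on_curve W Q"
  shows "to_cubic (point_add W P Q) = padd (to_cubic P) (to_cubic Q)"
proof (cases P)
  case P: (Affine x1 y1)
  show ?thesis
  proof (cases Q)
    case Q: (Affine x2 y2)
    note a = weierstrass_coeffs(1,2)
    define Y1 where "Y1 = y1 + s * x1 + t"
    define Y2 where "Y2 = y2 + s * x2 + t"
    have sq: "to_cubic P = Affine x1 Y1" "to_cubic Q = Affine x2 Y2"
      by (simp_all add: P Q Y1_def Y2_def)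
    have test: "x1 = x2 \<and> y1 + y2 + a\<^sub>1 W * x2 + a\<^sub>3 W = 0 \<longleftrightarrow> x1 = x2 \<and> Y1 + Y2 = 0"
      unfolding a Y1_def Y2_def by (auto simp: algebra_simps)
    show ?thesis
    proof (cases "x1 = x2 \<and> Y1 + Y2 = 0")
      case True
      hence "point_add W P Q = Infinity" using test by (simp add: P Q)
      thus ?thesis unfolding sq padd.simps using True by simp
    next
      case False
      define l where "l = (if x1 = x2 then (3 * x1\<^sup>2 + 2 * a\<^sub>2 W * x1 + a\<^sub>4 W - a\<^sub>1 W * y1) / (2 * y1 + a\<^sub>1 W * x1 + a\<^sub>3 W)
        else (y2 - y1) / (x2 - x1))"
      have L: "(if x1 = x2 then cf' x1 / (2 * Y1) else (Y2 - Y1) / (x2 - x1)) = l + s"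
      proof (cases "x1 = x2")
        case True
        have "Y1\<^sup>2 = cf x1" "Y2\<^sup>2 = cf x2"
          using assms unfolding to_cubic_in_EC_iff[symmetric] sq by (simp_all add: Affine_in_EC)
        hence "Y1\<^sup>2 = Y2\<^sup>2" using True by simp
        hence "Y1 = Y2 \<or> Y1 = - Y2" by (simp add: power2_eq_iff)
        hence "Y1 \<noteq> 0" using False True by auto
        have d: "2 * y1 + a\<^sub>1 W * x1 + a\<^sub>3 W = 2 * Y1" unfolding a Y1_def by (simp add: algebra_simps)
        have n: "cf' x1 = (3 * x1\<^sup>2 + 2 * a\<^sub>2 W * x1 + a\<^sub>4 W - a\<^sub>1 W * y1) + s * (2 * Y1)"
          unfolding cf'_def weierstrass_coeffs Y1_def by (simp add: algebra_simps power2_eq_square)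
        show ?thesis unfolding l_def d n using True \<open>Y1 \<noteq> 0\<close> by (simp add: add_divide_distrib)
      next
        case x: False
        hence "x2 - x1 \<noteq> 0" by simp
        moreover have "Y2 - Y1 = (y2 - y1) + s * (x2 - x1)" unfolding Y1_def Y2_def by (simp add: algebra_simps)
        ultimately show ?thesis unfolding l_def using x by (simp add: add_divide_distrib)
      qed
      define x3 where "x3 = l\<^sup>2 + a\<^sub>1 W * l - a\<^sub>2 W - x1 - x2"
      have x3: "(l + s)\<^sup>2 - d2 - x1 - x2 = x3"
        unfolding x3_def weierstrass_coeffs by (simp add: algebra_simps power2_eq_square)
      have "point_add W P Q = Affine x3 (- (l * (x3 - x1) + y1) - a\<^sub>1 W * x3 - a\<^sub>3 W)"
        unfolding P Q point_add.simps test using False by (simp add: Let_def x3_def l_def)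
      hence "to_cubic (point_add W P Q) = Affine x3 (- (l * (x3 - x1) + y1) - 2 * s * x3 - 2 * t + s * x3 + t)"
        unfolding a by simp
      also have "- (l * (x3 - x1) + y1) - 2 * s * x3 - 2 * t + s * x3 + t = - ((l + s) * (x3 - x1) + Y1)"
        unfolding Y1_def by (simp add: algebra_simps)
      also have "Affine x3 (- ((l + s) * (x3 - x1) + Y1)) = padd (to_cubic P) (to_cubic Q)"
        unfolding sq padd.simps(3) if_not_P[OF False] L Let_def x3 ..
      finally show ?thesis .
    qed
  qed (simp add: P)
qed simp

lemma to_cubic_pow:
  assumes "on_curve W P"
  shows "on_curve W (P [^]\<^bsub>point_group W\<^esub> n)"
    "to_cubic (P [^]\<^bsub>point_group W\<^esub> (n :: nat)) = to_cubic P [^]\<^bsub>EG\<^esub> n"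
proof -
  have P: "to_cubic P \<in> EC" using assms by (simp add: to_cubic_in_EC_iff)
  have "on_curve W (P [^]\<^bsub>point_group W\<^esub> n) \<and> to_cubic (P [^]\<^bsub>point_group W\<^esub> n) = to_cubic P [^]\<^bsub>EG\<^esub> n"
  proof (induction n)
    case 0
    show ?case by (simp add: nat_pow_def point_group_def)
  next
    case (Suc n)
    have "to_cubic (P [^]\<^bsub>point_group W\<^esub> Suc n) = padd (to_cubic (P [^]\<^bsub>point_group W\<^esub> n)) (to_cubic P)"
      using Suc assms by (simp add: nat_pow_def point_group_def to_cubic_point_add)
    also have "\<dots> = to_cubic P [^]\<^bsub>EG\<^esub> Suc n" using Suc by simp
    finally have e: "to_cubic (P [^]\<^bsub>point_group W\<^esub> Suc n) = to_cubic P [^]\<^bsub>EG\<^esub> Suc n" .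
    have "to_cubic P [^]\<^bsub>EG\<^esub> Suc n \<in> EC" using P EG.nat_pow_closed[of "to_cubic P" "Suc n"] by simp
    thus ?case using e by (simp flip: to_cubic_in_EC_iff)
  qed
  thus "on_curve W (P [^]\<^bsub>point_group W\<^esub> n)"
    "to_cubic (P [^]\<^bsub>point_group W\<^esub> (n :: nat)) = to_cubic P [^]\<^bsub>EG\<^esub> n" by blast+
qed

lemma to_cubic_in_tors_iff: "to_cubic P \<in> tors N \<longleftrightarrow> P \<in> torsion_points W N"
proof (cases "on_curve W P")
  case True
  have "to_cubic P \<in> tors N \<longleftrightarrow> to_cubic (P [^]\<^bsub>point_group W\<^esub> N) = Infinity"
    using True by (simp add: tors_def to_cubic_in_EC_iff to_cubic_pow)
  thus ?thesis using True by (simp add: to_cubic_eq_Infinity_iff torsion_points_def point_group_def)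
next
  case False
  thus ?thesis by (simp add: tors_def to_cubic_in_EC_iff torsion_points_def point_group_def)
qed

lemma map_point_square:
  assumes "field_aut \<sigma>" "\<sigma> (a\<^sub>1 W) = a\<^sub>1 W" "\<sigma> (a\<^sub>3 W) = a\<^sub>3 W"
  shows "map_point \<sigma> (to_cubic P) = to_cubic (map_point \<sigma> P)"
  using assms by (cases P) (simp_all add: s_def t_def field_aut_simps[OF assms(1)])

lemma fixes_torsion_points_iff:
  assumes "field_aut \<sigma>" "\<sigma> (a\<^sub>1 W) = a\<^sub>1 W" "\<sigma> (a\<^sub>3 W) = a\<^sub>3 W"
  shows "(\<forall>P\<in>torsion_points W N. map_point \<sigma> P = P) \<longleftrightarrow> (\<forall>P\<in>tors N. map_point \<sigma> P = P)"
proof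
  assume *: "\<forall>P\<in>torsion_points W N. map_point \<sigma> P = P"
  show "\<forall>P\<in>tors N. map_point \<sigma> P = P"
  proof
    fix Q assume Q: "Q \<in> tors N"
    obtain P where P: "to_cubic P = Q" using to_cubic_surj by blast
    hence "P \<in> torsion_points W N" using Q to_cubic_in_tors_iff by blast
    thus "map_point \<sigma> Q = Q" using * P map_point_square[OF assms, of P] by simp
  qed
next
  assume *: "\<forall>P\<in>tors N. map_point \<sigma> P = P"
  show "\<forall>P\<in>torsion_points W N. map_point \<sigma> P = P"
  proof
    fix P assume "P \<in> torsion_points W N"
    hence "map_point \<sigma> (to_cubic P) = to_cubic P" using * to_cubic_in_tors_iff by blast
    thus "map_point \<sigma> P = P" unfolding map_point_square[OF assms] to_cubic_inject .
  qed
qed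

end

section \<open>Automorphisms and division fields\<close>

lemma field_aut_fixes_generate_field:
  fixes S :: "'a :: field set"
  assumes "field_aut \<sigma>" "\<And>x. x \<in> S \<Longrightarrow> \<sigma> x = x" "x \<in> generate_field ring_of_type_algebra S"
  shows "\<sigma> x = x"
proof -
  interpret R: field "ring_of_type_algebra :: 'a ring" by (rule field_from_type_algebra)
  have R: "\<one>\<^bsub>ring_of_type_algebra\<^esub> = (1 :: 'a)" "\<zero>\<^bsub>ring_of_type_algebra\<^esub> = (0 :: 'a)"
    "x \<oplus>\<^bsub>ring_of_type_algebra\<^esub> y = x + y" "x \<otimes>\<^bsub>ring_of_type_algebra\<^esub> y = x * y"
    "x \<in> carrier ring_of_type_algebra" for x y :: 'a
    by (simp_all add: ring_of_type_algebra_def)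
  have neg: "\<ominus>\<^bsub>ring_of_type_algebra\<^esub> x = - x" for x :: 'a
    using R.minus_equality[of "- x" x] by (simp add: R)
  have inv: "inv\<^bsub>ring_of_type_algebra\<^esub> x = inverse x" if "x \<noteq> 0" for x :: 'a
    using R.comm_inv_char[of x "inverse x"] that by (simp add: R)
  from assms(3) show ?thesis
    by (induction rule: generate_field.induct)
       (simp_all add: R neg inv assms(2) field_aut_simps[OF assms(1)])
qed

text \<open>An equality of division fields thereby becomes the statement that the same automorphisms
  fix the two torsion groups pointwise, the form in which the argument uses it.\<close>

lemma fixes_division_field_iff:
  assumes "field_aut \<sigma>"
  shows "(\<forall>x\<in>division_field E N. \<sigma> x = x) \<longleftrightarrow>
    (\<forall>P\<in>torsion_points (map_weierstrass to_ac E) N. map_point \<sigma> P = P)"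
proof
  assume *: "\<forall>x\<in>division_field E N. \<sigma> x = x"
  show "\<forall>P\<in>torsion_points (map_weierstrass to_ac E) N. map_point \<sigma> P = P"
  proof
    fix P assume P: "P \<in> torsion_points (map_weierstrass to_ac E) N"
    have "\<sigma> x = x" if "x \<in> set_point P" for x
      using * P that unfolding division_field_def by (blast intro: generate_field.incl)
    thus "map_point \<sigma> P = P" by (rule point.map_ident_strong)
  qed
next
  assume *: "\<forall>P\<in>torsion_points (map_weierstrass to_ac E) N. map_point \<sigma> P = P"
  show "\<forall>x\<in>division_field E N. \<sigma> x = x"
  proof
    fix x assume "x \<in> division_field E N"
    thus "\<sigma> x = x" unfolding division_field_def
    proof (rule field_aut_fixes_generate_field[OF assms, rotated])
      fix y assume y: "y \<in> range to_ac \<union> (\<Union>P\<in>torsion_points (map_weierstrass to_ac E) N. set_point P)"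
      show "\<sigma> y = y"
      proof (cases "y \<in> range to_ac")
        case True
        thus ?thesis using field_aut_to_ac[OF assms] by auto
      next
        case False
        then obtain P where P: "P \<in> torsion_points (map_weierstrass to_ac E) N" "y \<in> set_point P" using y by blast
        have "map_point \<sigma> P = P" using * P(1) by blast
        thus ?thesis using P(2) by (cases P) auto
      qed
    qed
  qed
qed

lemma discriminant_to_ac: "discriminant (map_weierstrass to_ac E) = to_ac (discriminant E)"
  by (simp add: discriminant_def Let_def weierstrass.map_sel)

theorem theorem3p2:
  fixes E :: "rat weierstrass" and p n :: nat
  assumes "elliptic_curve E"
    and "Factorial_Ring.prime p" and "p \<ge> 3"
    and "n \<ge> 1"
  shows "division_field E (p ^ n) \<noteq> division_field E (p ^ (n + 1))"
proof
  assume eq: "division_field E (p ^ n) = division_field E (p ^ (n + 1))"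
  define W where "W = map_weierstrass to_ac E"
  interpret elliptic_curve_ac W
    using assms(1) by unfold_locales (simp add: elliptic_curve_def W_def discriminant_to_ac)
  have coeffs: "a\<^sub>1 W = to_ac (a\<^sub>1 E)" "a\<^sub>2 W = to_ac (a\<^sub>2 E)" "a\<^sub>3 W = to_ac (a\<^sub>3 E)"
    "a\<^sub>4 W = to_ac (a\<^sub>4 E)" "a\<^sub>6 W = to_ac (a\<^sub>6 E)"
    by (simp_all add: W_def weierstrass.map_sel)
  \<comment> \<open>Automorphisms fix the rationals, so each one respects the Weierstrass equation
    and the completed cubic.\<close>
  have fixed: "\<sigma> (a\<^sub>1 W) = a\<^sub>1 W" "\<sigma> (a\<^sub>3 W) = a\<^sub>3 W" and gal: "gal \<sigma>" if \<sigma>: "field_aut \<sigma>" for \<sigma>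
  proof -
    have "\<sigma> d2 = d2" "\<sigma> d1 = d1" "\<sigma> d0 = d0"
      unfolding d2_def d1_def d0_def s_def t_def coeffs
      by (simp_all add: field_aut_to_ac[OF \<sigma>] field_aut_simps[OF \<sigma>])
    thus "gal \<sigma>" using \<sigma> by (simp add: gal_def)
  qed (simp_all add: coeffs field_aut_to_ac[OF \<sigma>])
  \<comment> \<open>Fixing E[p^n] pointwise means fixing its division field, which by assumption is
    that of E[p^(n+1)].\<close>
  have H: "\<forall>P\<in>tors (p ^ (n + 1)). map_point \<sigma> P = P"
    if "gal \<sigma>" "\<forall>P\<in>tors (p ^ n). map_point \<sigma> P = P" for \<sigma>
  proof -
    have \<sigma>: "field_aut \<sigma>" using that(1) by (simp add: gal_def)
    show ?thesis using that(2) 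
      unfolding fixes_torsion_points_iff[OF \<sigma> fixed[OF \<sigma>], symmetric]
      unfolding W_def fixes_division_field_iff[OF \<sigma>, symmetric] eq .
  qed
  have "odd p" using assms(2,3) by (metis prime_odd_nat less_le_trans numeral_less_iff semiring_norm(79) eval_nat_numeral(3) lessI)
  \<comment> \<open>A primitive root modulo every power of p; at p^2 its order is the totient p(p -
    1).\<close>
  then obtain g where g: "\<forall>k>0. residue_primroot (p ^ k) g"
    using residue_primroot_odd_prime_power_exists[OF assms(2)] by blast
  hence g2: "residue_primroot (p\<^sup>2) g" by simp
  hence cop: "coprime g p" by (simp add: residue_primroot_def coprime_commute)
  have gk: "p * (p - 1) dvd k" if "[g ^ k = 1] (mod p\<^sup>2)" for k
  proof -
    have "Pocklington.ord (p\<^sup>2) g dvd k" using that unfolding ord_divides .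
    moreover have "totient (p\<^sup>2) = p * (p - 1)" using totient_prime_power[OF assms(2), of 2] by simp
    ultimately show ?thesis using g2 by (simp add: residue_primroot_def)
  qed
  have cyc: "\<exists>\<sigma>. gal \<sigma> \<and> \<sigma> z = z ^ g" if z: "z ^ (p\<^sup>2) = 1" "z ^ p \<noteq> 1" for z
  proof -
    obtain \<sigma> where "field_aut \<sigma>" "\<sigma> z = z ^ g"
      using exists_field_aut[of z "z ^ g"] primitive_root_conjugate[OF assms(2) z cop] by blast
    thus ?thesis using gal by blast
  qed
  show False by (rule no_coincidence[OF assms(2,3,4) H gk cop cyc])
qed

end
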